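(* Let $\Gamma$, $\sigma$, $V$, $(e_i)_{i\in I}$, $(\eta_i)_{i\in I}$ be as in the context, and let $R=\sum_{i,j,k,\ell\in I}R_{ij,k\ell}\,E_{ik}\,\overline{\otimes}\,E_{j\ell}$ be a linear map of $V\otimes V$ into itself that is homogeneous of degree zero. Suppose in addition that $R$ is invertible and satisfies the graded Yang--Baxter equation. Then there exists a unique universal $r$-form $\varrho$ on the $\sigma$-bialgebra $A(R)$ such that $$\varrho(t_{ik},t_{j\ell})=\sigma(\eta_i-\eta_k,\eta_j-\eta_\ell)\,R_{ij,k\ell}\qquad\text{for all } i,j,k,\ell\in I.$$
   Context: $\mathbb K$ is a field of characteristic zero, $\Gamma$ is an abelian group, and $\sigma:\Gamma\times\Gamma\to\mathbb K^\times$ is a commutation factor, i.e. $\sigma$ is bimultiplicative and $\sigma(\alpha,\beta)\sigma(\beta,\alpha)=1$. All gradations are $\Gamma$-gradations. Graded tensor products. For graded associative algebras $A,B$, the graded tensor product $A\,\overline{\otimes}\,B$ is the vector space $A\otimes B$ with product $(a\otimes b)(a'\otimes b')=\sigma(\beta,\alpha')\,aa'\otimes bb'$ for $b$ homogeneous of degree $\beta$ and $a'$ homogeneous of degree $\alpha'$. For homogeneous linear maps $g,g'$, $(g\,\overline{\otimes}\,g')(x\otimes y)=\sigma(\gamma',\xi)\,g(x)\otimes g'(y)$, where $\gamma'=\deg g'$, $\xi=\deg x$. A $\sigma$-bialgebra is a graded associative unital algebra $A$ with a coassociative coproduct $\Delta:A\to A\,\overline{\otimes}\,A$ and a counit $\varepsilon:A\to\mathbb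 K$, both homogeneous of degree zero and both homomorphisms of unital algebras. $V$ is a finite-dimensional graded vector space with homogeneous basis $(e_i)_{i\in I}$, $e_i$ of degree $\eta_i$. $\mathrm{Lgr}(V)$ is the graded algebra of all linear maps $V\to V$, with basis $E_{ij}(e_k)=\delta_{jk}e_i$, and $\mathrm{Lgr}(V)\,\overline{\otimes}\,\mathrm{Lgr}(V)$ is identified with $\mathrm{Lgr}(V\otimes V)$ by $g\otimes g'\mapsto g\,\overline{\otimes}\,g'$. Homogeneity of degree zero of $R$ means $R_{ij,k\ell}=0$ unless $\eta_i+\eta_j=\eta_k+\eta_\ell$. The graded Yang--Baxter equation is $R_{12}R_{13}R_{23}=R_{23}R_{13}R_{12}$ in $\mathrm{Lgr}(V)\,\overline{\otimes}\,\mathrm{Lgr}(V)\,\overline{\otimes}\,\mathrm{Lgr}(V)$, where $R_{12}=R\otimes \mathrm{id}_V$, $R_{23}=\mathrm{id}_V\otimes R$, and $R_{13}$ is obtained from $R_{23}$ by applying the graded twist $g\otimes g'\mapsto\sigma(\gamma,\gamma')g'\otimes g$ to the first two tensor factors. The $\sigma$-bialgebra $A(R)$ is the universal graded unital associative algebra generated by elements $t_{ij}$ ($i,j\in I$), homogeneous of degree $\eta_j-\eta_i$, subject to the relations $$\sum_{a,b\in I}\sigma(\eta_j-\eta_\ell,\eta_a-\eta_k)\,R_{ij,ab}\,t_{ak}t_{b\ell}=\sum_{a,b\in I}\sigma(\eta_j-\eta_b,\eta_a-\eta_k)\,t_{jb}t_{ia}\,R_{ab,k\ell}\qquad(i,j,k,\ell\in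 I),$$ with coproduct and counit fixed by $\Delta(t_{ij})=\sum_{k\in I}\sigma(\eta_k-\eta_i,\eta_k-\eta_j)\,t_{ik}\otimes t_{kj}$ and $\varepsilon(t_{ij})=\delta_{ij}$. Universal $r$-form. For $a,b$ in a $\sigma$-bialgebra $A$ write $\Delta(a)=\sum_r a^1_r\otimes a^2_r$, $\Delta(b)=\sum_s b^1_s\otimes b^2_s$, with $a^1_r,a^2_r,b^1_s,b^2_s$ homogeneous of degrees $\alpha^1_r,\alpha^2_r,\beta^1_s,\beta^2_s$. A universal $r$-form on $A$ is a bilinear form $\varrho:A\times A\to\mathbb K$ such that: (1) $\varrho$ is homogeneous of degree zero, i.e. $\varrho(a,b)=0$ for homogeneous $a,b$ whose degrees do not add up to zero; (2) $\varrho$ is convolution invertible: there is a bilinear form $\varrho'$ on $A$, homogeneous of degree zero, with $\sum_{r,s}\sigma(\alpha^2_r,\beta^1_s)\varrho(a^1_r,b^1_s)\varrho'(a^2_r,b^2_s)=\sum_{r,s}\sigma(\alpha^2_r,\beta^1_s)\varrho'(a^1_r,b^1_s)\varrho(a^2_r,b^2_s)=\varepsilon(a)\varepsilon(b)$ for all $a,b\in A$; (3) $\sum_{r,s}\sigma(\alpha^2_r,\beta^1_s)\varrho(a^1_r,b^1_s)\,a^2_rb^2_s=\sum_{r,s}\sigma(\alpha^1_r+\alpha^2_r,\beta^1_s)\,b^1_sa^1_r\,\varrho(a^2_r,b^2_s)$ for all $a,b\in A$; (4) $\varrho(aa',b)=\sum_s\sigma(\alpha',\beta^1_s)\varrho(a,b^1_s)\varrho(a',b^2_s)$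 and $\varrho(a,bb')=\sum_r\varrho(a^1_r,b')\varrho(a^2_r,b)$ for all $a,a',b,b'\in A$, with $a'$ homogeneous of degree $\alpha'$. *)

theory Defs
  imports Complex_Main "HOL-Library.Poly_Mapping" "HOL-Algebra.QuotRing" "HOL-Algebra.Module"
begin

section \<open>Commutation factors\<close>

definition commutation_factor :: "('g::ab_group_add \<Rightarrow> 'g \<Rightarrow> 'k::field) \<Rightarrow> bool" where
  "commutation_factor \<sigma> \<longleftrightarrow>
    (\<forall>\<alpha> \<beta>. \<sigma> \<alpha> \<beta> \<noteq> 0) \<and>
    (\<forall>\<alpha> \<alpha>' \<beta>. \<sigma> (\<alpha> + \<alpha>') \<beta> = \<sigma> \<alpha> \<beta> * \<sigma> \<alpha>' \<beta>) \<and>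
    (\<forall>\<alpha> \<beta> \<beta>'. \<sigma> \<alpha> (\<beta> + \<beta>') = \<sigma> \<alpha> \<beta> * \<sigma> \<alpha> \<beta>') \<and>
    (\<forall>\<alpha> \<beta>. \<sigma> \<alpha> \<beta> * \<sigma> \<beta> \<alpha> = 1)"

section \<open>Linear maps on tensor powers of \<open>V\<close>\<close>

text \<open>
  The space \<open>V\<close> enters only through its homogeneous basis \<open>(e i)\<close>, \<open>i \<in> I\<close>, with \<open>e i\<close> of degree
  \<open>\<eta> i\<close>. A linear map on a space with basis indexed by a finite set \<open>B\<close> is its matrix
  \<open>X :: 'b \<Rightarrow> 'b \<Rightarrow> 'k\<close>, the image of the basis vector \<open>n\<close> having \<open>m\<close>-th coordinate \<open>X m n\<close>; matrices
  are \<open>0\<close> outside \<open>B \<times> B\<close>. Tensor powers of \<open>V\<close> have the bases \<open>I \<times> I\<close> and \<open>I \<times> I \<times> I\<close>.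
\<close>

definition mat_id :: "'b set \<Rightarrow> 'b \<Rightarrow> 'b \<Rightarrow> 'k::field" where
  "mat_id B m n = (if m = n \<and> m \<in> B then 1 else 0)"

definition mat_mult :: "'b set \<Rightarrow> ('b \<Rightarrow> 'b \<Rightarrow> 'k::field) \<Rightarrow> ('b \<Rightarrow> 'b \<Rightarrow> 'k) \<Rightarrow> 'b \<Rightarrow> 'b \<Rightarrow> 'k" where
  "mat_mult B X Y m n = (\<Sum>p\<in>B. X m p * Y p n)"

definition mat_invertible :: "'b set \<Rightarrow> ('b \<Rightarrow> 'b \<Rightarrow> 'k::field) \<Rightarrow> bool" where
  "mat_invertible B X \<longleftrightarrow> (\<exists>Y. mat_mult B X Y = mat_id B \<and> mat_mult B Y X = mat_id B)"

definition mat_unit :: "'b \<Rightarrow> 'b \<Rightarrow> 'b \<Rightarrow> 'b \<Rightarrow> 'k::field" where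
  "mat_unit i j m n = (if m = i \<and> n = j then 1 else 0)"

text \<open>
  Graded tensor product of linear maps: bilinear in \<open>g\<close>, \<open>h\<close>, and
  \<open>x \<otimes> y \<mapsto> \<sigma> (deg h) (deg x) (g x \<otimes> h y)\<close> for homogeneous \<open>h\<close> and \<open>x\<close>. Here \<open>d\<close> and \<open>d'\<close> are the degrees
  of the basis vectors of the two spaces; the matrix unit \<open>mat_unit n n'\<close> has degree \<open>d' n - d' n'\<close>.
\<close>

definition mat_gtensor ::
  "('g::ab_group_add \<Rightarrow> 'g \<Rightarrow> 'k::field) \<Rightarrow> ('b \<Rightarrow> 'g) \<Rightarrow> ('c \<Rightarrow> 'g)
    \<Rightarrow> ('b \<Rightarrow> 'b \<Rightarrow> 'k) \<Rightarrow> ('c \<Rightarrow> 'c \<Rightarrow> 'k) \<Rightarrow> 'b \<times> 'c \<Rightarrow> 'b \<times> 'c \<Rightarrow> 'k" where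
  "mat_gtensor \<sigma> d d' g h =
    (\<lambda>(m, n) (m', n'). \<sigma> (d' n - d' n') (d m') * g m m' * h n n')"

definition tensor2 ::
  "('g::ab_group_add \<Rightarrow> 'g \<Rightarrow> 'k::field) \<Rightarrow> ('i \<Rightarrow> 'g)
    \<Rightarrow> ('i \<Rightarrow> 'i \<Rightarrow> 'k) \<Rightarrow> ('i \<Rightarrow> 'i \<Rightarrow> 'k) \<Rightarrow> 'i \<times> 'i \<Rightarrow> 'i \<times> 'i \<Rightarrow> 'k" where
  "tensor2 \<sigma> \<eta> g h = mat_gtensor \<sigma> \<eta> \<eta> g h"

definition tensor3 ::
  "('g::ab_group_add \<Rightarrow> 'g \<Rightarrow> 'k::field) \<Rightarrow> ('i \<Rightarrow> 'g)
    \<Rightarrow> ('i \<Rightarrow> 'i \<Rightarrow> 'k) \<Rightarrow> ('i \<Rightarrow> 'i \<Rightarrow> 'k) \<Rightarrow> ('i \<Rightarrow> 'i \<Rightarrow> 'k)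
    \<Rightarrow> 'i \<times> 'i \<times> 'i \<Rightarrow> 'i \<times> 'i \<times> 'i \<Rightarrow> 'k" where
  "tensor3 \<sigma> \<eta> f g h = mat_gtensor \<sigma> \<eta> (\<lambda>(j, k). \<eta> j + \<eta> k) f (tensor2 \<sigma> \<eta> g h)"

text \<open>
  The families \<open>R :: 'i \<Rightarrow> 'i \<Rightarrow> 'i \<Rightarrow> 'i \<Rightarrow> 'k\<close> below are the coefficients of a linear map with respect
  to the \<^emph>\<open>graded\<close> tensor products of matrix units; these are not its matrix entries, from which they
  differ by values of \<open>\<sigma>\<close>.
\<close>

definition R_map ::
  "('g::ab_group_add \<Rightarrow> 'g \<Rightarrow> 'k::field) \<Rightarrow> 'i set \<Rightarrow> ('i \<Rightarrow> 'g)
    \<Rightarrow> ('i \<Rightarrow> 'i \<Rightarrow> 'i \<Rightarrow> 'i \<Rightarrow> 'k) \<Rightarrow> 'i \<times> 'i \<Rightarrow> 'i \<times> 'i \<Rightarrow> 'k" where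
  "R_map \<sigma> I \<eta> R x y =
    (\<Sum>i\<in>I. \<Sum>j\<in>I. \<Sum>k\<in>I. \<Sum>l\<in>I.
      R i j k l * tensor2 \<sigma> \<eta> (mat_unit i k) (mat_unit j l) x y)"

definition R_homogeneous ::
  "'i set \<Rightarrow> ('i \<Rightarrow> 'g::ab_group_add) \<Rightarrow> ('i \<Rightarrow> 'i \<Rightarrow> 'i \<Rightarrow> 'i \<Rightarrow> 'k::field) \<Rightarrow> bool" where
  "R_homogeneous I \<eta> R \<longleftrightarrow>
    (\<forall>i\<in>I. \<forall>j\<in>I. \<forall>k\<in>I. \<forall>l\<in>I. \<eta> i + \<eta> j \<noteq> \<eta> k + \<eta> l \<longrightarrow> R i j k l = 0)"

definition R12 ::
  "('g::ab_group_add \<Rightarrow> 'g \<Rightarrow> 'k::field) \<Rightarrow> 'i set \<Rightarrow> ('i \<Rightarrow> 'g)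
    \<Rightarrow> ('i \<Rightarrow> 'i \<Rightarrow> 'i \<Rightarrow> 'i \<Rightarrow> 'k) \<Rightarrow> 'i \<times> 'i \<times> 'i \<Rightarrow> 'i \<times> 'i \<times> 'i \<Rightarrow> 'k" where
  "R12 \<sigma> I \<eta> R x y =
    (\<Sum>i\<in>I. \<Sum>j\<in>I. \<Sum>k\<in>I. \<Sum>l\<in>I.
      R i j k l * tensor3 \<sigma> \<eta> (mat_unit i k) (mat_unit j l) (mat_id I) x y)"

definition R23 ::
  "('g::ab_group_add \<Rightarrow> 'g \<Rightarrow> 'k::field) \<Rightarrow> 'i set \<Rightarrow> ('i \<Rightarrow> 'g)
    \<Rightarrow> ('i \<Rightarrow> 'i \<Rightarrow> 'i \<Rightarrow> 'i \<Rightarrow> 'k) \<Rightarrow> 'i \<times> 'i \<times> 'i \<Rightarrow> 'i \<times> 'i \<times> 'i \<Rightarrow> 'k" where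
  "R23 \<sigma> I \<eta> R x y =
    (\<Sum>i\<in>I. \<Sum>j\<in>I. \<Sum>k\<in>I. \<Sum>l\<in>I.
      R i j k l * tensor3 \<sigma> \<eta> (mat_id I) (mat_unit i k) (mat_unit j l) x y)"

text \<open>
  The graded twist \<open>g \<otimes> g' \<mapsto> \<sigma> (deg g) (deg g') (g' \<otimes> g)\<close> applied to the first two tensor factors of
  \<^term>\<open>R23\<close>; the factor \<open>\<sigma> 0 (\<eta> i - \<eta> k)\<close> equals \<open>1\<close>.
\<close>

definition R13 ::
  "('g::ab_group_add \<Rightarrow> 'g \<Rightarrow> 'k::field) \<Rightarrow> 'i set \<Rightarrow> ('i \<Rightarrow> 'g)
    \<Rightarrow> ('i \<Rightarrow> 'i \<Rightarrow> 'i \<Rightarrow> 'i \<Rightarrow> 'k) \<Rightarrow> 'i \<times> 'i \<times> 'i \<Rightarrow> 'i \<times> 'i \<times> 'i \<Rightarrow> 'k" where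
  "R13 \<sigma> I \<eta> R x y =
    (\<Sum>i\<in>I. \<Sum>j\<in>I. \<Sum>k\<in>I. \<Sum>l\<in>I.
      R i j k l * \<sigma> 0 (\<eta> i - \<eta> k) *
      tensor3 \<sigma> \<eta> (mat_unit i k) (mat_id I) (mat_unit j l) x y)"

definition graded_yang_baxter ::
  "('g::ab_group_add \<Rightarrow> 'g \<Rightarrow> 'k::field) \<Rightarrow> 'i set \<Rightarrow> ('i \<Rightarrow> 'g)
    \<Rightarrow> ('i \<Rightarrow> 'i \<Rightarrow> 'i \<Rightarrow> 'i \<Rightarrow> 'k) \<Rightarrow> bool" where
  "graded_yang_baxter \<sigma> I \<eta> R \<longleftrightarrow>
    (let B = I \<times> I \<times> I in
      mat_mult B (mat_mult B (R12 \<sigma> I \<eta> R) (R13 \<sigma> I \<eta> R)) (R23 \<sigma> I \<eta> R) =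
      mat_mult B (mat_mult B (R23 \<sigma> I \<eta> R) (R13 \<sigma> I \<eta> R)) (R12 \<sigma> I \<eta> R))"

section \<open>Graded algebras and their homomorphisms\<close>

text \<open>
  Only the data of a graded algebra or graded bialgebra over the field \<open>'k\<close> are recorded;
  \<open>component A \<gamma>\<close> is the subspace of homogeneous elements of degree \<open>\<gamma>\<close>.
\<close>

record ('a, 'k, 'g) galgebra = "('k, 'a) module" +
  component :: "'g \<Rightarrow> 'a set"

definition galgebra_hom ::
  "('a, 'k, 'g, 'x) galgebra_scheme \<Rightarrow> ('b, 'k, 'g, 'y) galgebra_scheme \<Rightarrow> ('a \<Rightarrow> 'b) set" where
  "galgebra_hom A B =
    {h \<in> ring_hom A B.
      (\<forall>c. \<forall>a\<in>carrier A. h (c \<odot>\<^bsub>A\<^esub> a) = c \<odot>\<^bsub>B\<^esub> h a) \<and>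
      (\<forall>\<gamma>. h ` component A \<gamma> \<subseteq> component B \<gamma>)}"

definition base_field :: "('k::field, 'k, 'g::zero) galgebra" where
  "base_field =
    \<lparr>carrier = UNIV, mult = (*), one = 1, zero = 0, add = (+), smult = (*),
     component = (\<lambda>\<gamma>. if \<gamma> = 0 then UNIV else {0})\<rparr>"

section \<open>Graded tensor products\<close>

text \<open>The space with basis \<open>'b\<close> is \<open>'b \<Rightarrow>\<^sub>0 'k\<close>.\<close>

definition scale :: "'k::field \<Rightarrow> ('b \<Rightarrow>\<^sub>0 'k) \<Rightarrow> 'b \<Rightarrow>\<^sub>0 'k" where
  "scale c p = Poly_Mapping.map ((*) c) p"

text \<open>
  \<open>A \<otimes> B\<close> is the free vector space on \<open>carrier A \<times> carrier B\<close> modulo the relations of bilinearity;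
  its elements are cosets of the span of these relations.
\<close>

definition tensor_relations ::
  "('a, 'k::field, 'g, 'x) galgebra_scheme \<Rightarrow> ('b, 'k, 'g, 'y) galgebra_scheme
    \<Rightarrow> (('a \<times> 'b) \<Rightarrow>\<^sub>0 'k) set" where
  "tensor_relations A B =
    {Poly_Mapping.single (a \<oplus>\<^bsub>A\<^esub> a', b) 1 - Poly_Mapping.single (a, b) 1 - Poly_Mapping.single (a', b) 1
      | a a' b. a \<in> carrier A \<and> a' \<in> carrier A \<and> b \<in> carrier B} \<union>
    {Poly_Mapping.single (a, b \<oplus>\<^bsub>B\<^esub> b') 1 - Poly_Mapping.single (a, b) 1 - Poly_Mapping.single (a, b') 1
      | a b b'. a \<in> carrier A \<and> b \<in> carrier B \<and> b' \<in> carrier B} \<union>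
    {Poly_Mapping.single (c \<odot>\<^bsub>A\<^esub> a, b) 1 - Poly_Mapping.single (a, b) c
      | c a b. a \<in> carrier A \<and> b \<in> carrier B} \<union>
    {Poly_Mapping.single (a, c \<odot>\<^bsub>B\<^esub> b) 1 - Poly_Mapping.single (a, b) c
      | c a b. a \<in> carrier A \<and> b \<in> carrier B}"

definition tensor_class ::
  "('a, 'k::field, 'g, 'x) galgebra_scheme \<Rightarrow> ('b, 'k, 'g, 'y) galgebra_scheme
    \<Rightarrow> (('a \<times> 'b) \<Rightarrow>\<^sub>0 'k) \<Rightarrow> (('a \<times> 'b) \<Rightarrow>\<^sub>0 'k) set" where
  "tensor_class A B p = {q. q - p \<in> module.span scale (tensor_relations A B)}"

text \<open>
  \<open>represents A B us X\<close>: \<open>X = \<Sum> a \<otimes> b\<close>, summed over the entries \<open>(a, \<alpha>, b, \<beta>)\<close> of the list \<open>us\<close>, where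
  \<open>a\<close> and \<open>b\<close> are homogeneous of degrees \<open>\<alpha>\<close> and \<open>\<beta>\<close>.
\<close>

definition represents ::
  "('a, 'k::field, 'g, 'x) galgebra_scheme \<Rightarrow> ('b, 'k, 'g, 'y) galgebra_scheme
    \<Rightarrow> ('a \<times> 'g \<times> 'b \<times> 'g) list \<Rightarrow> (('a \<times> 'b) \<Rightarrow>\<^sub>0 'k) set \<Rightarrow> bool" where
  "represents A B us X \<longleftrightarrow>
    (\<forall>(a, \<alpha>, b, \<beta>)\<in>set us. a \<in> component A \<alpha> \<and> b \<in> component B \<beta>) \<and>
    X = tensor_class A B (\<Sum>(a, \<alpha>, b, \<beta>)\<leftarrow>us. Poly_Mapping.single (a, b) 1)"

text \<open>
  In \<open>mult\<close>, all pairs of representations yield the same coset, so that the union is this coset;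
  similarly for \<open>smult\<close>.
\<close>

definition gtensor ::
  "('g::ab_group_add \<Rightarrow> 'g \<Rightarrow> 'k::field) \<Rightarrow> ('a, 'k, 'g, 'x) galgebra_scheme
    \<Rightarrow> ('b, 'k, 'g, 'y) galgebra_scheme \<Rightarrow> ((('a \<times> 'b) \<Rightarrow>\<^sub>0 'k) set, 'k, 'g) galgebra" where
  "gtensor \<sigma> A B =
    \<lparr>carrier = tensor_class A B ` {p. Poly_Mapping.keys p \<subseteq> carrier A \<times> carrier B},
     mult = (\<lambda>X Y. \<Union>{tensor_class A B
         (\<Sum>(a, \<alpha>, b, \<beta>)\<leftarrow>us. \<Sum>(a', \<alpha>', b', \<beta>')\<leftarrow>vs.
           Poly_Mapping.single (a \<otimes>\<^bsub>A\<^esub> a', b \<otimes>\<^bsub>B\<^esub> b') (\<sigma> \<beta> \<alpha>'))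
       | us vs. represents A B us X \<and> represents A B vs Y}),
     one = tensor_class A B (Poly_Mapping.single (\<one>\<^bsub>A\<^esub>, \<one>\<^bsub>B\<^esub>) 1),
     zero = tensor_class A B 0,
     add = (\<lambda>X Y. {p + q | p q. p \<in> X \<and> q \<in> Y}),
     smult = (\<lambda>c X. \<Union>p\<in>X. tensor_class A B (scale c p)),
     component = (\<lambda>\<gamma>. {X. \<exists>us. represents A B us X \<and> (\<forall>(a, \<alpha>, b, \<beta>)\<in>set us. \<alpha> + \<beta> = \<gamma>)})\<rparr>"

section \<open>Universal r-forms\<close>

record (overloaded) ('a, 'k::zero, 'g) gbialgebra = "('a, 'k, 'g) galgebra" +
  coproduct :: "'a \<Rightarrow> (('a \<times> 'a) \<Rightarrow>\<^sub>0 'k) set"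
  counit :: "'a \<Rightarrow> 'k"

text \<open>A form on \<open>A\<close> is a function on \<open>carrier A \<times> carrier A\<close>, hence the extensionality.\<close>

definition bilinear_form :: "('a, 'k::field, 'g, 'x) galgebra_scheme \<Rightarrow> ('a \<times> 'a \<Rightarrow> 'k) \<Rightarrow> bool" where
  "bilinear_form A \<rho> \<longleftrightarrow>
    \<rho> \<in> extensional (carrier A \<times> carrier A) \<and>
    (\<forall>a\<in>carrier A. \<forall>a'\<in>carrier A. \<forall>b\<in>carrier A. \<rho> (a \<oplus>\<^bsub>A\<^esub> a', b) = \<rho> (a, b) + \<rho> (a', b)) \<and>
    (\<forall>a\<in>carrier A. \<forall>b\<in>carrier A. \<forall>b'\<in>carrier A. \<rho> (a, b \<oplus>\<^bsub>A\<^esub> b') = \<rho> (a, b) + \<rho> (a, b')) \<and>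
    (\<forall>c. \<forall>a\<in>carrier A. \<forall>b\<in>carrier A. \<rho> (c \<odot>\<^bsub>A\<^esub> a, b) = c * \<rho> (a, b)) \<and>
    (\<forall>c. \<forall>a\<in>carrier A. \<forall>b\<in>carrier A. \<rho> (a, c \<odot>\<^bsub>A\<^esub> b) = c * \<rho> (a, b))"

definition form_degree_zero ::
  "('a, 'k::field, 'g::ab_group_add, 'x) galgebra_scheme \<Rightarrow> ('a \<times> 'a \<Rightarrow> 'k) \<Rightarrow> bool" where
  "form_degree_zero A \<rho> \<longleftrightarrow>
    (\<forall>\<alpha> \<beta>. \<forall>a\<in>component A \<alpha>. \<forall>b\<in>component A \<beta>. \<alpha> + \<beta> \<noteq> 0 \<longrightarrow> \<rho> (a, b) = 0)"

definition convolution_inverse ::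
  "('g::ab_group_add \<Rightarrow> 'g \<Rightarrow> 'k::field) \<Rightarrow> ('a, 'k, 'g, 'x) gbialgebra_scheme
    \<Rightarrow> ('a \<times> 'a \<Rightarrow> 'k) \<Rightarrow> ('a \<times> 'a \<Rightarrow> 'k) \<Rightarrow> bool" where
  "convolution_inverse \<sigma> A \<rho> \<rho>' \<longleftrightarrow>
    (\<forall>a\<in>carrier A. \<forall>b\<in>carrier A. \<forall>us vs.
      represents A A us (coproduct A a) \<longrightarrow> represents A A vs (coproduct A b) \<longrightarrow>
      (\<Sum>(a1, \<alpha>1, a2, \<alpha>2)\<leftarrow>us. \<Sum>(b1, \<beta>1, b2, \<beta>2)\<leftarrow>vs. \<sigma> \<alpha>2 \<beta>1 * \<rho> (a1, b1) * \<rho>' (a2, b2))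
        = counit A a * counit A b \<and>
      (\<Sum>(a1, \<alpha>1, a2, \<alpha>2)\<leftarrow>us. \<Sum>(b1, \<beta>1, b2, \<beta>2)\<leftarrow>vs. \<sigma> \<alpha>2 \<beta>1 * \<rho>' (a1, b1) * \<rho> (a2, b2))
        = counit A a * counit A b)"

definition list_sum_in :: "('a, 'x) ring_scheme \<Rightarrow> 'a list \<Rightarrow> 'a" where
  "list_sum_in A xs = foldr (add A) xs \<zero>\<^bsub>A\<^esub>"

definition quasi_commutative ::
  "('g::ab_group_add \<Rightarrow> 'g \<Rightarrow> 'k::field) \<Rightarrow> ('a, 'k, 'g, 'x) gbialgebra_scheme
    \<Rightarrow> ('a \<times> 'a \<Rightarrow> 'k) \<Rightarrow> bool" where
  "quasi_commutative \<sigma> A \<rho> \<longleftrightarrow>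
    (\<forall>a\<in>carrier A. \<forall>b\<in>carrier A. \<forall>us vs.
      represents A A us (coproduct A a) \<longrightarrow> represents A A vs (coproduct A b) \<longrightarrow>
      list_sum_in A
        [(\<sigma> \<alpha>2 \<beta>1 * \<rho> (a1, b1)) \<odot>\<^bsub>A\<^esub> (a2 \<otimes>\<^bsub>A\<^esub> b2).
          (a1, \<alpha>1, a2, \<alpha>2) \<leftarrow> us, (b1, \<beta>1, b2, \<beta>2) \<leftarrow> vs] =
      list_sum_in A
        [(\<sigma> (\<alpha>1 + \<alpha>2) \<beta>1 * \<rho> (a2, b2)) \<odot>\<^bsub>A\<^esub> (b1 \<otimes>\<^bsub>A\<^esub> a1).
          (a1, \<alpha>1, a2, \<alpha>2) \<leftarrow> us, (b1, \<beta>1, b2, \<beta>2) \<leftarrow> vs])"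

definition form_multiplicative ::
  "('g::ab_group_add \<Rightarrow> 'g \<Rightarrow> 'k::field) \<Rightarrow> ('a, 'k, 'g, 'x) gbialgebra_scheme
    \<Rightarrow> ('a \<times> 'a \<Rightarrow> 'k) \<Rightarrow> bool" where
  "form_multiplicative \<sigma> A \<rho> \<longleftrightarrow>
    (\<forall>a\<in>carrier A. \<forall>\<alpha>'. \<forall>a'\<in>component A \<alpha>'. \<forall>b\<in>carrier A. \<forall>vs.
      represents A A vs (coproduct A b) \<longrightarrow>
      \<rho> (a \<otimes>\<^bsub>A\<^esub> a', b) = (\<Sum>(b1, \<beta>1, b2, \<beta>2)\<leftarrow>vs. \<sigma> \<alpha>' \<beta>1 * \<rho> (a, b1) * \<rho> (a', b2))) \<and>
    (\<forall>a\<in>carrier A. \<forall>b\<in>carrier A. \<forall>b'\<in>carrier A. \<forall>us.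
      represents A A us (coproduct A a) \<longrightarrow>
      \<rho> (a, b \<otimes>\<^bsub>A\<^esub> b') = (\<Sum>(a1, \<alpha>1, a2, \<alpha>2)\<leftarrow>us. \<rho> (a1, b') * \<rho> (a2, b)))"

definition universal_r_form ::
  "('g::ab_group_add \<Rightarrow> 'g \<Rightarrow> 'k::field) \<Rightarrow> ('a, 'k, 'g, 'x) gbialgebra_scheme
    \<Rightarrow> ('a \<times> 'a \<Rightarrow> 'k) \<Rightarrow> bool" where
  "universal_r_form \<sigma> A \<rho> \<longleftrightarrow>
    bilinear_form A \<rho> \<and>
    form_degree_zero A \<rho> \<and>
    (\<exists>\<rho>'. bilinear_form A \<rho>' \<and> form_degree_zero A \<rho>' \<and> convolution_inverse \<sigma> A \<rho> \<rho>') \<and>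
    quasi_commutative \<sigma> A \<rho> \<and>
    form_multiplicative \<sigma> A \<rho>"

section \<open>The bialgebra \<open>A(R)\<close>\<close>

text \<open>
  Words form a monoid under concatenation, so that the product of \<^typ>\<open>'x list \<Rightarrow>\<^sub>0 'k\<close> is that of the
  free unital associative algebra on \<open>'x\<close>.
\<close>

instantiation list :: (type) monoid_add
begin
definition zero_list :: "'a list" where "zero_list = []"
definition plus_list :: "'a list \<Rightarrow> 'a list \<Rightarrow> 'a list" where "plus_list = (@)"
instance by standard (simp_all add: zero_list_def plus_list_def)
end

text \<open>The letter \<open>(i, j)\<close> stands for \<open>t\<^sub>i\<^sub>j\<close>, of degree \<open>\<eta> j - \<eta> i\<close>.\<close>

definition word_degree :: "('i \<Rightarrow> 'g::ab_group_add) \<Rightarrow> ('i \<times> 'i) list \<Rightarrow> 'g" where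
  "word_degree \<eta> w = (\<Sum>(i, j)\<leftarrow>w. \<eta> j - \<eta> i)"

definition free_galgebra ::
  "'i set \<Rightarrow> ('i \<Rightarrow> 'g::ab_group_add) \<Rightarrow> (('i \<times> 'i) list \<Rightarrow>\<^sub>0 'k::field, 'k, 'g) galgebra" where
  "free_galgebra I \<eta> =
    \<lparr>carrier = {p. Poly_Mapping.keys p \<subseteq> lists (I \<times> I)},
     mult = (*), one = 1, zero = 0, add = (+), smult = scale,
     component = (\<lambda>\<gamma>. {p. Poly_Mapping.keys p \<subseteq> {w \<in> lists (I \<times> I). word_degree \<eta> w = \<gamma>}})\<rparr>"

definition free_gen :: "'i \<Rightarrow> 'i \<Rightarrow> ('i \<times> 'i) list \<Rightarrow>\<^sub>0 'k::field" where
  "free_gen i j = Poly_Mapping.single [(i, j)] 1"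

definition AR_relations ::
  "('g::ab_group_add \<Rightarrow> 'g \<Rightarrow> 'k::field) \<Rightarrow> 'i set \<Rightarrow> ('i \<Rightarrow> 'g)
    \<Rightarrow> ('i \<Rightarrow> 'i \<Rightarrow> 'i \<Rightarrow> 'i \<Rightarrow> 'k) \<Rightarrow> (('i \<times> 'i) list \<Rightarrow>\<^sub>0 'k) set" where
  "AR_relations \<sigma> I \<eta> R =
    {(\<Sum>a\<in>I. \<Sum>b\<in>I. scale (\<sigma> (\<eta> j - \<eta> l) (\<eta> a - \<eta> k) * R i j a b) (free_gen a k * free_gen b l)) -
     (\<Sum>a\<in>I. \<Sum>b\<in>I. scale (\<sigma> (\<eta> j - \<eta> b) (\<eta> a - \<eta> k) * R a b k l) (free_gen j b * free_gen i a))
      | i j k l. i \<in> I \<and> j \<in> I \<and> k \<in> I \<and> l \<in> I}"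

definition AR_ideal ::
  "('g::ab_group_add \<Rightarrow> 'g \<Rightarrow> 'k::field) \<Rightarrow> 'i set \<Rightarrow> ('i \<Rightarrow> 'g)
    \<Rightarrow> ('i \<Rightarrow> 'i \<Rightarrow> 'i \<Rightarrow> 'i \<Rightarrow> 'k) \<Rightarrow> (('i \<times> 'i) list \<Rightarrow>\<^sub>0 'k) set" where
  "AR_ideal \<sigma> I \<eta> R = Idl\<^bsub>free_galgebra I \<eta>\<^esub> (AR_relations \<sigma> I \<eta> R)"

text \<open>In \<open>smult\<close>, the cosets \<open>J + c p\<close> for \<open>p \<in> X\<close> all coincide.\<close>

definition AR_galgebra ::
  "('g::ab_group_add \<Rightarrow> 'g \<Rightarrow> 'k::field) \<Rightarrow> 'i set \<Rightarrow> ('i \<Rightarrow> 'g)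
    \<Rightarrow> ('i \<Rightarrow> 'i \<Rightarrow> 'i \<Rightarrow> 'i \<Rightarrow> 'k) \<Rightarrow> ((('i \<times> 'i) list \<Rightarrow>\<^sub>0 'k) set, 'k, 'g) galgebra" where
  "AR_galgebra \<sigma> I \<eta> R =
    (let F = free_galgebra I \<eta>; J = AR_ideal \<sigma> I \<eta> R; Q = F Quot J in
      \<lparr>carrier = carrier Q, mult = mult Q, one = one Q, zero = zero Q, add = add Q,
       smult = (\<lambda>c X. \<Union>p\<in>X. J +>\<^bsub>F\<^esub> scale c p),
       component = (\<lambda>\<gamma>. (\<lambda>p. J +>\<^bsub>F\<^esub> p) ` component F \<gamma>)\<rparr>)"

definition AR_gen ::
  "('g::ab_group_add \<Rightarrow> 'g \<Rightarrow> 'k::field) \<Rightarrow> 'i set \<Rightarrow> ('i \<Rightarrow> 'g)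
    \<Rightarrow> ('i \<Rightarrow> 'i \<Rightarrow> 'i \<Rightarrow> 'i \<Rightarrow> 'k) \<Rightarrow> 'i \<Rightarrow> 'i \<Rightarrow> (('i \<times> 'i) list \<Rightarrow>\<^sub>0 'k) set" where
  "AR_gen \<sigma> I \<eta> R i j = AR_ideal \<sigma> I \<eta> R +>\<^bsub>free_galgebra I \<eta>\<^esub> free_gen i j"

text \<open>
  The coproduct and the counit are the unique homomorphisms of graded unital algebras with the
  given values on generators; extensionality fixes them off the carrier.
\<close>

definition AR_coproduct ::
  "('g::ab_group_add \<Rightarrow> 'g \<Rightarrow> 'k::field) \<Rightarrow> 'i set \<Rightarrow> ('i \<Rightarrow> 'g) \<Rightarrow> ('i \<Rightarrow> 'i \<Rightarrow> 'i \<Rightarrow> 'i \<Rightarrow> 'k)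
    \<Rightarrow> (('i \<times> 'i) list \<Rightarrow>\<^sub>0 'k) set
    \<Rightarrow> (((('i \<times> 'i) list \<Rightarrow>\<^sub>0 'k) set \<times> (('i \<times> 'i) list \<Rightarrow>\<^sub>0 'k) set) \<Rightarrow>\<^sub>0 'k) set" where
  "AR_coproduct \<sigma> I \<eta> R =
    (let A = AR_galgebra \<sigma> I \<eta> R; t = AR_gen \<sigma> I \<eta> R in
      THE \<Delta>. \<Delta> \<in> extensional (carrier A) \<and> \<Delta> \<in> galgebra_hom A (gtensor \<sigma> A A) \<and>
        (\<forall>i\<in>I. \<forall>j\<in>I. \<Delta> (t i j) =
          tensor_class A A
            (\<Sum>k\<in>I. scale (\<sigma> (\<eta> k - \<eta> i) (\<eta> k - \<eta> j)) (Poly_Mapping.single (t i k, t k j) 1))))"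

definition AR_counit ::
  "('g::ab_group_add \<Rightarrow> 'g \<Rightarrow> 'k::field) \<Rightarrow> 'i set \<Rightarrow> ('i \<Rightarrow> 'g) \<Rightarrow> ('i \<Rightarrow> 'i \<Rightarrow> 'i \<Rightarrow> 'i \<Rightarrow> 'k)
    \<Rightarrow> (('i \<times> 'i) list \<Rightarrow>\<^sub>0 'k) set \<Rightarrow> 'k" where
  "AR_counit \<sigma> I \<eta> R =
    (let A = AR_galgebra \<sigma> I \<eta> R; t = AR_gen \<sigma> I \<eta> R in
      THE \<epsilon>. \<epsilon> \<in> extensional (carrier A) \<and> \<epsilon> \<in> galgebra_hom A base_field \<and>
        (\<forall>i\<in>I. \<forall>j\<in>I. \<epsilon> (t i j) = (if i = j then 1 else 0)))"

definition AR ::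
  "('g::ab_group_add \<Rightarrow> 'g \<Rightarrow> 'k::field) \<Rightarrow> 'i set \<Rightarrow> ('i \<Rightarrow> 'g) \<Rightarrow> ('i \<Rightarrow> 'i \<Rightarrow> 'i \<Rightarrow> 'i \<Rightarrow> 'k)
    \<Rightarrow> ((('i \<times> 'i) list \<Rightarrow>\<^sub>0 'k) set, 'k, 'g) gbialgebra" where
  "AR \<sigma> I \<eta> R =
    galgebra.extend (AR_galgebra \<sigma> I \<eta> R)
      (gbialgebra.fields (AR_coproduct \<sigma> I \<eta> R) (AR_counit \<sigma> I \<eta> R))"

end

theory Submission
  imports Defs
begin

text \<open>
  Let \<open>C\<close> be \<open>R\<close> followed by the graded flip. The graded Yang--Baxter equation says exactly that \<open>C\<close>
  satisfies the ordinary, sign-free braid relation on \<open>V \<otimes> V \<otimes> V\<close>. Rescaling a monomial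
  \<open>t\<^bsub>x\<^sub>1 y\<^sub>1\<^esub> \<dots> t\<^bsub>x\<^sub>n y\<^sub>n\<^esub>\<close> by a value of \<open>\<sigma>\<close> to \<open>T x y\<close> likewise removes the signs from the
  coproduct, \<open>\<Delta> (T x y) = \<Sum> z. T x z \<otimes> T z y\<close>, and turns the defining relations into \<open>C T = T C\<close>.
  A degree-zero form \<open>\<rho>\<close> is then, up to values of \<open>\<sigma>\<close>, a family of maps
  \<open>V\<^bsup>\<otimes>m\<^esup> \<otimes> V\<^bsup>\<otimes>n\<^esup> \<rightarrow> V\<^bsup>\<otimes>n\<^esup> \<otimes> V\<^bsup>\<otimes>m\<^esup>\<close>. Axiom (4) becomes the two hexagon identities, satisfied by the maps
  crossing \<open>m\<close> strands over \<open>n\<close> strands by means of \<open>C\<close>. The braid relation makes these natural, so that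
  the form descends to the quotient; axiom (3) says that they commute with \<open>T\<close>, and the crossings by
  \<open>C\<^sup>-\<^sup>1\<close> give the convolution inverse. For uniqueness, \<open>\<rho>(1, -)\<close> is convolution idempotent and
  invertible, hence equal to \<open>\<epsilon>\<close>, and likewise \<open>\<rho>(-, 1)\<close>; the hexagons determine everything else from
  the generators.
\<close>

section \<open>Crossing kernels of a braid operator\<close>

text \<open>Two things shape the proof. The axioms quantify over every way of writing
  \<open>\<Delta> X\<close> as a sum of homogeneous pure tensors, with signs read off the recorded
  degrees. \<open>twist\<close> turns such a sign into a linear map of a tensor factor; each side of
  an axiom is then multilinear in the factors, depends only on the classes of the coproducts, and
  may be evaluated at the one explicit coproduct of \<open>T x y\<close>. And a map into a quotient
  is handled as a map into the space above it, controlled modulo a subspace.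

  Factors of \<sigma> survive the passage to the quotient because \<open>R\<close> has degree zero:
  a nonzero entry \<open>C i j a b\<close> forces
  \<open>\<eta> i + \<eta> j = \<eta> a + \<eta> b\<close>, so a factor that depends on degrees is
  constant along a relator. In \<open>C j i k l\<close>,
  \<open>\<sigma> (\<eta> i) (\<eta> j)\<close> is the sign of the flip, and
  \<open>\<sigma> (\<eta> j - \<eta> l) (\<eta> k)\<close> converts the coefficient
  \<open>R i j k l\<close> into a matrix entry.

  The relations of the algebra are those of \<open>C\<close>, while the inverse form is built from
  \<open>C_inv\<close>. It descends to the quotient only if crossings by \<open>C_inv\<close> are
  natural with respect to \<open>C\<close>; hence a relation between two operators,
  \<open>slides_over\<close>, and not the braid relation alone.\<close>

definition tuples :: "'i set \<Rightarrow> nat \<Rightarrow> 'i list set" where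
  "tuples I n = {x. set x \<subseteq> I \<and> length x = n}"

lemma tuples_0 [simp]: "tuples I 0 = {[]}"
  by (auto simp: tuples_def)

lemma finite_tuples: "finite I \<Longrightarrow> finite (tuples I n)"
  by (simp add: tuples_def finite_lists_length_eq)

lemma tuples_length: "x \<in> tuples I n \<Longrightarrow> length x = n"
  by (simp add: tuples_def)

lemma sum_tuples_Suc:
  "(\<Sum>x\<in>tuples I (Suc n). f x) = (\<Sum>i\<in>I. \<Sum>x\<in>tuples I n. f (i # x))"
proof -
  have "tuples I (Suc n) = (\<lambda>(i, x). i # x) ` (I \<times> tuples I n)"
    by (auto simp: tuples_def length_Suc_conv image_iff)
  moreover have "inj_on (\<lambda>(i, x). i # x) (I \<times> tuples I n)"
    by (auto simp: inj_on_def)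
  ultimately show ?thesis
    by (simp add: sum.reindex sum.cartesian_product split_def)
qed

lemma sum_tuples_add:
  "(\<Sum>x\<in>tuples I (m + n). f x) = (\<Sum>x\<in>tuples I m. \<Sum>y\<in>tuples I n. f (x @ y))"
  by (induction m arbitrary: f) (simp_all add: sum_tuples_Suc)

lemma sum_of_bool_left:
  assumes "finite S" "a \<in> S"
  shows "(\<Sum>x\<in>S. of_bool (a = x) * f x) = (f a :: 'k::comm_semiring_1)"
    and "(\<Sum>x\<in>S. of_bool (x = a) * f x) = (f a :: 'k::comm_semiring_1)"
    and "(\<Sum>x\<in>S. f x * of_bool (a = x)) = (f a :: 'k::comm_semiring_1)"
    and "(\<Sum>x\<in>S. f x * of_bool (x = a)) = (f a :: 'k::comm_semiring_1)"
proof -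
  have "(\<Sum>x\<in>S. of_bool (a = x) * f x) = (\<Sum>x\<in>{a}. of_bool (a = x) * f x)"
    using assms by (intro sum.mono_neutral_right) auto
  then show "(\<Sum>x\<in>S. of_bool (a = x) * f x) = f a" by simp
  then show "(\<Sum>x\<in>S. of_bool (x = a) * f x) = f a"
    by (simp add: eq_commute)
  then show "(\<Sum>x\<in>S. f x * of_bool (x = a)) = f a"
    by (simp add: mult.commute)
  then show "(\<Sum>x\<in>S. f x * of_bool (a = x)) = f a"
    by (simp add: eq_commute)
qed

lemma sum_rotate:
  "(\<Sum>a\<in>A. \<Sum>b\<in>B. \<Sum>c\<in>C. f a b c) = (\<Sum>c\<in>C. \<Sum>a\<in>A. \<Sum>b\<in>B. f a b c)"
proof -
  have "(\<Sum>a\<in>A. \<Sum>b\<in>B. \<Sum>c\<in>C. f a b c) = (\<Sum>a\<in>A. \<Sum>c\<in>C. \<Sum>b\<in>B. f a b c)"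
    by (intro sum.cong[OF refl] sum.swap)
  also have "\<dots> = (\<Sum>c\<in>C. \<Sum>a\<in>A. \<Sum>b\<in>B. f a b c)"
    by (rule sum.swap)
  finally show ?thesis .
qed

lemma sum_pairs_swap:
  "(\<Sum>a\<in>A. \<Sum>b\<in>B. \<Sum>c\<in>C. \<Sum>d\<in>D. f a b c d) = (\<Sum>c\<in>C. \<Sum>d\<in>D. \<Sum>a\<in>A. \<Sum>b\<in>B. f a b c d)"
proof -
  have "(\<Sum>a\<in>A. \<Sum>b\<in>B. \<Sum>c\<in>C. \<Sum>d\<in>D. f a b c d) = (\<Sum>c\<in>C. \<Sum>a\<in>A. \<Sum>b\<in>B. \<Sum>d\<in>D. f a b c d)"
    by (rule sum_rotate)
  also have "\<dots> = (\<Sum>c\<in>C. \<Sum>d\<in>D. \<Sum>a\<in>A. \<Sum>b\<in>B. f a b c d)"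
    by (intro sum.cong[OF refl] sum_rotate)
  finally show ?thesis .
qed

text \<open>
  Matrix coefficients of the crossings built from \<open>X\<close>, as a map from \<open>V \<otimes> V\<close> to itself: \<open>cross I X z' x' x z\<close> is
  the coefficient of \<open>z' \<otimes> x'\<close> in the image of \<open>x \<otimes> z\<close>, the strands of \<open>x\<close> passing those of \<open>z\<close>.
\<close>

fun cross1 ::
  "'i set \<Rightarrow> ('i \<Rightarrow> 'i \<Rightarrow> 'i \<Rightarrow> 'i \<Rightarrow> 'k::field) \<Rightarrow> 'i list \<Rightarrow> 'i \<Rightarrow> 'i \<Rightarrow> 'i list \<Rightarrow> 'k" where
  "cross1 I X [] i' i [] = of_bool (i' = i)"
| "cross1 I X (c' # z') i' i (c # z) = (\<Sum>j\<in>I. X c' j i c * cross1 I X z' i' j z)"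
| "cross1 I X _ _ _ _ = 0"

text \<open>The tail \<open>x\<close> stands next to \<open>z\<close>, so it crosses first and turns
  \<open>z\<close> into \<open>w\<close>; the head then passes \<open>w\<close>. Words whose lengths
  do not match give 0.\<close>

fun cross ::
  "'i set \<Rightarrow> ('i \<Rightarrow> 'i \<Rightarrow> 'i \<Rightarrow> 'i \<Rightarrow> 'k::field) \<Rightarrow> 'i list \<Rightarrow> 'i list \<Rightarrow> 'i list \<Rightarrow> 'i list \<Rightarrow> 'k" where
  "cross I X z' [] [] z = of_bool (z' = z)"
| "cross I X z' (i' # x') (i # x) z =
    (\<Sum>w\<in>tuples I (length z). cross1 I X z' i' i w * cross I X w x' x z)"
| "cross I X _ _ _ _ = 0"

text \<open>
  \<open>X\<^sub>1 X\<^sub>2 Y\<^sub>1 = Y\<^sub>2 X\<^sub>1 X\<^sub>2\<close> and \<open>Y\<^sub>1 X\<^sub>2 X\<^sub>1 = X\<^sub>2 X\<^sub>1 Y\<^sub>2\<close> on \<open>V \<otimes> V \<otimes> V\<close>; needed for \<open>X = Y\<close> and for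
  \<open>X = Y\<^sup>-\<^sup>1\<close>.
\<close>

definition slides_over ::
  "'i set \<Rightarrow> ('i \<Rightarrow> 'i \<Rightarrow> 'i \<Rightarrow> 'i \<Rightarrow> 'k::field) \<Rightarrow> ('i \<Rightarrow> 'i \<Rightarrow> 'i \<Rightarrow> 'i \<Rightarrow> 'k) \<Rightarrow> bool" where
  "slides_over I X Y \<longleftrightarrow>
    (\<forall>p\<in>I. \<forall>q\<in>I. \<forall>r\<in>I. \<forall>k\<in>I. \<forall>l\<in>I. \<forall>m\<in>I.
      (\<Sum>a\<in>I. \<Sum>b\<in>I. \<Sum>d\<in>I. X p q a d * X d r b m * Y a b k l)
        = (\<Sum>a\<in>I. \<Sum>b\<in>I. \<Sum>d\<in>I. Y q r a b * X p a k d * X d b l m) \<and>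
      (\<Sum>a\<in>I. \<Sum>b\<in>I. \<Sum>d\<in>I. Y p q a b * X a d k l * X b r d m)
        = (\<Sum>a\<in>I. \<Sum>b\<in>I. \<Sum>d\<in>I. X p d k a * X q r d b * Y a b l m))"

context
  fixes I :: "'i set"
  assumes fin: "finite I"
begin

lemma cross_Nil_right: "length x' = length x \<Longrightarrow> cross I X [] x' x [] = of_bool (x' = x)"
  by (induction x' x rule: list_induct2) auto

section \<open>The hexagon identities for crossings\<close>

lemma cross1_append:
  assumes "length z' = length z" "i \<in> I"
  shows "cross1 I X (z' @ w') i' i (z @ w) = (\<Sum>j\<in>I. cross1 I X z' j i z * cross1 I X w' i' j w)"
  using assms
proof (induction z' z arbitrary: i rule: list_induct2)
  case Nil
  then show ?case by (simp add: sum_of_bool_left[OF fin])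
next
  case (Cons c' z' c z)
  have "cross1 I X ((c' # z') @ w') i' i ((c # z) @ w)
      = (\<Sum>h\<in>I. \<Sum>j\<in>I. X c' h i c * (cross1 I X z' j h z * cross1 I X w' i' j w))"
    using Cons.IH by (simp add: sum_distrib_left)
  also have "\<dots> = (\<Sum>j\<in>I. \<Sum>h\<in>I. X c' h i c * (cross1 I X z' j h z * cross1 I X w' i' j w))"
    by (rule sum.swap)
  finally show ?case
    by (simp add: sum_distrib_right mult.assoc)
qed

text \<open>First hexagon. The strands of \<open>u\<close> are nearer to \<open>z\<close> and cross
  before those of \<open>x\<close>; this is the order in which \<open>cross\<close> recurses, so
  only the sum over intermediate words has to be regrouped.\<close>

lemma cross_append_left:
  assumes "length x' = length x" "z' \<in> tuples I (length z)"
  shows "cross I X z' (x' @ u') (x @ u) z =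
    (\<Sum>w\<in>tuples I (length z). cross I X z' x' x w * cross I X w u' u z)"
  using assms
proof (induction x' x arbitrary: z' rule: list_induct2)
  case Nil
  then show ?case by (simp add: sum_of_bool_left[OF finite_tuples[OF fin]])
next
  case (Cons i' x' i x)
  let ?T = "tuples I (length z)"
  have "cross I X z' ((i' # x') @ u') ((i # x) @ u) z
      = (\<Sum>w\<in>?T. \<Sum>v\<in>?T. cross1 I X z' i' i w * (cross I X w x' x v * cross I X v u' u z))"
    using Cons.IH by (simp add: sum_distrib_left)
  also have "\<dots> = (\<Sum>v\<in>?T. \<Sum>w\<in>?T. cross1 I X z' i' i w * (cross I X w x' x v * cross I X v u' u z))"
    by (rule sum.swap)
  finally show ?case
    by (simp add: sum_distrib_right mult.assoc tuples_length)
qed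

text \<open>Second hexagon, which runs against the recursion: \<open>cross\<close> peels strands off
  \<open>x\<close>, whereas here the word passed over is split. The head crossing \<open>z\<close>
  and the tail crossing \<open>w\<close> involve disjoint strands and can be interchanged.\<close>

lemma cross_append_right:
  assumes "length x' = length x" "length z' = length z" "length w' = length w" "set x \<subseteq> I"
  shows "cross I X (z' @ w') x' x (z @ w) =
    (\<Sum>u\<in>tuples I (length x). cross I X z' u x z * cross I X w' x' u w)"
  using assms
proof (induction x' x arbitrary: z' w' rule: list_induct2)
  case Nil
  then show ?case by auto
next
  case (Cons i' x' i x)
  let ?Z = "tuples I (length z)" let ?W = "tuples I (length w)" let ?U = "tuples I (length x)"
  have "cross I X (z' @ w') (i' # x') (i # x) (z @ w)
      = (\<Sum>v\<in>?Z. \<Sum>v'\<in>?W. (\<Sum>j\<in>I. cross1 I X z' j i v * cross1 I X w' i' j v') *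
          (\<Sum>u\<in>?U. cross I X v u x z * cross I X v' x' u w))"
    using Cons.prems
    by (auto simp: sum_tuples_add tuples_length cross1_append Cons.IH intro!: sum.cong)
  also have "\<dots> = (\<Sum>v\<in>?Z. \<Sum>v'\<in>?W. \<Sum>j\<in>I. \<Sum>u\<in>?U.
      cross1 I X z' j i v * cross1 I X w' i' j v' * (cross I X v u x z * cross I X v' x' u w))"
    by (simp add: sum_product)
  also have "\<dots> = (\<Sum>j\<in>I. \<Sum>v\<in>?Z. \<Sum>v'\<in>?W. \<Sum>u\<in>?U.
      cross1 I X z' j i v * cross1 I X w' i' j v' * (cross I X v u x z * cross I X v' x' u w))"
    by (rule sum_rotate)
  \<comment> \<open>Regrouping by the block that is passed: the factors with \<open>v\<close>
    concern only \<open>z\<close>, those with \<open>v'\<close> only \<open>w\<close>.\<close>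
  also have "\<dots> = (\<Sum>j\<in>I. \<Sum>u\<in>?U. \<Sum>v\<in>?Z. \<Sum>v'\<in>?W.
      (cross1 I X z' j i v * cross I X v u x z) * (cross1 I X w' i' j v' * cross I X v' x' u w))"
    by (intro sum.cong[OF refl]) (subst sum_rotate, simp add: ac_simps)
  finally show ?case
    by (simp add: sum_tuples_Suc sum_product)
qed

section \<open>Conservation of degree along crossings\<close>

lemma cross1_homogeneous:
  fixes \<eta> :: "'i \<Rightarrow> 'g::ab_group_add"
  assumes X: "\<And>i j k l. \<lbrakk>i \<in> I; j \<in> I; k \<in> I; l \<in> I; \<eta> i + \<eta> j \<noteq> \<eta> k + \<eta> l\<rbrakk> \<Longrightarrow> X i j k l = 0"
  shows "\<lbrakk>length z' = length z; set z' \<subseteq> I; set z \<subseteq> I; i' \<in> I; i \<in> I; cross1 I X z' i' i z \<noteq> 0\<rbrakk>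
    \<Longrightarrow> sum_list (map \<eta> z') + \<eta> i' = \<eta> i + sum_list (map \<eta> z)"
proof (induction z' z arbitrary: i rule: list_induct2)
  case Nil
  then show ?case by (simp split: if_splits)
next
  case (Cons c' z' c z)
  then obtain j where j: "j \<in> I" "X c' j i c * cross1 I X z' i' j z \<noteq> 0"
    by (auto elim: sum.not_neutral_contains_not_neutral)
  have "\<eta> c' + \<eta> j = \<eta> i + \<eta> c"
    using Cons.prems j X[of c' j i c] by auto
  moreover have "sum_list (map \<eta> z') + \<eta> i' = \<eta> j + sum_list (map \<eta> z)"
    using Cons.prems Cons.IH j by auto
  ultimately have "\<eta> c' + \<eta> j + (sum_list (map \<eta> z') + \<eta> i') = \<eta> i + \<eta> c + (\<eta> j + sum_list (map \<eta> z))"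
    by simp
  then show ?case
    by (simp add: algebra_simps)
qed

text \<open>Mostly used in the form that the kernel vanishes unless the total degrees agree. This
  makes the forms homogeneous of degree zero and allows signs to be evaluated inside sums.\<close>

lemma cross_homogeneous:
  fixes \<eta> :: "'i \<Rightarrow> 'g::ab_group_add"
  assumes X: "\<And>i j k l. \<lbrakk>i \<in> I; j \<in> I; k \<in> I; l \<in> I; \<eta> i + \<eta> j \<noteq> \<eta> k + \<eta> l\<rbrakk> \<Longrightarrow> X i j k l = 0"
    and "length x' = length x" "z' \<in> tuples I (length z)" "set z \<subseteq> I" "set x' \<subseteq> I" "set x \<subseteq> I"
    and "cross I X z' x' x z \<noteq> 0"
  shows "sum_list (map \<eta> z') + sum_list (map \<eta> x') = sum_list (map \<eta> x) + sum_list (map \<eta> z)"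
  using assms(2-)
proof (induction x' x arbitrary: z' rule: list_induct2)
  case Nil
  then show ?case by (simp split: if_splits)
next
  case (Cons i' x' i x)
  then obtain w where w: "w \<in> tuples I (length z)" "cross1 I X z' i' i w * cross I X w x' x z \<noteq> 0"
    by (auto elim: sum.not_neutral_contains_not_neutral)
  have "sum_list (map \<eta> z') + \<eta> i' = \<eta> i + sum_list (map \<eta> w)"
    using Cons.prems w cross1_homogeneous[of \<eta> X z' w i' i] X by (auto simp: tuples_def)
  moreover have "sum_list (map \<eta> w) + sum_list (map \<eta> x') = sum_list (map \<eta> x) + sum_list (map \<eta> z)"
    using Cons.prems Cons.IH w by auto
  ultimately have "sum_list (map \<eta> z') + \<eta> i' + (sum_list (map \<eta> w) + sum_list (map \<eta> x'))
     = \<eta> i + sum_list (map \<eta> w) + (sum_list (map \<eta> x) + sum_list (map \<eta> z))"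
    by simp
  then show ?case
    by (simp add: algebra_simps)
qed

text \<open>To undo the passage of one strand past \<open>z\<close>, the word \<open>z\<close>
  passes that strand by the inverse operator, so the two arguments of \<open>cross\<close> change
  places. The last crossing of the one factor and the first of the other both involve the leading
  letter; they are adjacent and cancel, and the rest is the induction hypothesis.\<close>

lemma cross1_inverse:
  assumes inv: "\<And>i j k l. \<lbrakk>i \<in> I; j \<in> I; k \<in> I; l \<in> I\<rbrakk> \<Longrightarrow>
      (\<Sum>a\<in>I. \<Sum>b\<in>I. X i j a b * Y a b k l) = of_bool (i = k \<and> j = l)"
    and "length z' = length z" "set z' \<subseteq> I" "set z \<subseteq> I" "i' \<in> I" "i \<in> I"
  shows "(\<Sum>j\<in>I. \<Sum>w\<in>tuples I (length z). cross1 I X z' i' j w * cross I Y [j] w z [i])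
    = of_bool (z' = z \<and> i' = i)"
  using assms(2-)
proof (induction z' z rule: list_induct2)
  case Nil
  then show ?case by (simp add: sum_of_bool_left[OF fin] cross_Nil_right)
next
  case (Cons c' z' c z)
  let ?T = "tuples I (length z)"
  have Y1: "cross I Y [j] (d # w) (c # z) [i] = (\<Sum>y\<in>I. Y j d c y * cross I Y [y] w z [i])"
    if "d \<in> I" for j d w
    using that by (simp add: sum_tuples_Suc sum_of_bool_left[OF fin])
  have "(\<Sum>j\<in>I. \<Sum>w\<in>tuples I (length (c # z)). cross1 I X (c' # z') i' j w * cross I Y [j] w (c # z) [i])
      = (\<Sum>j\<in>I. \<Sum>d\<in>I. \<Sum>w\<in>?T. (\<Sum>h\<in>I. X c' h j d * cross1 I X z' i' h w) *
           (\<Sum>y\<in>I. Y j d c y * cross I Y [y] w z [i]))"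
    by (simp add: sum_tuples_Suc Y1 del: cross.simps)
  also have "\<dots> = (\<Sum>j\<in>I. \<Sum>d\<in>I. \<Sum>w\<in>?T. \<Sum>h\<in>I. \<Sum>y\<in>I.
      (X c' h j d * Y j d c y) * (cross1 I X z' i' h w * cross I Y [y] w z [i]))"
    by (simp add: sum_product ac_simps)
  also have "\<dots> = (\<Sum>w\<in>?T. \<Sum>j\<in>I. \<Sum>d\<in>I. \<Sum>h\<in>I. \<Sum>y\<in>I.
      (X c' h j d * Y j d c y) * (cross1 I X z' i' h w * cross I Y [y] w z [i]))"
    by (rule sum_rotate)
  also have "\<dots> = (\<Sum>w\<in>?T. \<Sum>h\<in>I. \<Sum>j\<in>I. \<Sum>d\<in>I. \<Sum>y\<in>I.
      (X c' h j d * Y j d c y) * (cross1 I X z' i' h w * cross I Y [y] w z [i]))"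
    by (intro sum.cong[OF refl] sum_rotate)
  also have "\<dots> = (\<Sum>w\<in>?T. \<Sum>h\<in>I. \<Sum>y\<in>I. \<Sum>j\<in>I. \<Sum>d\<in>I.
      (X c' h j d * Y j d c y) * (cross1 I X z' i' h w * cross I Y [y] w z [i]))"
    by (intro sum.cong[OF refl] sum_rotate)
  \<comment> \<open>The inner sum over \<open>j\<close> and \<open>d\<close> is the product of the
    two adjacent crossings, an identity matrix by \<open>inv\<close>.\<close>
  also have "\<dots> = (\<Sum>w\<in>?T. \<Sum>h\<in>I. \<Sum>y\<in>I. of_bool (c' = c \<and> h = y) * (cross1 I X z' i' h w * cross I Y [y] w z [i]))"
    using Cons.prems by (intro sum.cong[OF refl]) (simp add: sum_distrib_right[symmetric] inv)
  also have "\<dots> = of_bool (c' = c) * (\<Sum>w\<in>?T. \<Sum>h\<in>I. \<Sum>y\<in>I. of_bool (h = y) * (cross1 I X z' i' h w * cross I Y [y] w z [i]))"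
    by (simp add: sum_distrib_left of_bool_conj mult.assoc)
  also have "\<dots> = of_bool (c' = c) * (\<Sum>w\<in>?T. \<Sum>h\<in>I. cross1 I X z' i' h w * cross I Y [h] w z [i])"
    by (simp add: sum_of_bool_left[OF fin] del: sum_of_bool_mult_eq sum_mult_of_bool_eq)
  also have "\<dots> = of_bool (c' # z' = c # z \<and> i' = i)"
    using Cons by (subst sum.swap) auto
  finally show ?case .
qed

text \<open>Peels off the head strand of \<open>x\<close>. The crossings of the tail are the inner
  pair and cancel by induction; the head is then left to \<open>cross1_inverse\<close>.\<close>

lemma cross_inverse:
  assumes inv: "\<And>i j k l. \<lbrakk>i \<in> I; j \<in> I; k \<in> I; l \<in> I\<rbrakk> \<Longrightarrow>
      (\<Sum>a\<in>I. \<Sum>b\<in>I. X i j a b * Y a b k l) = of_bool (i = k \<and> j = l)"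
    and "length x' = length x" "z' \<in> tuples I (length z)" "set z \<subseteq> I" "set x' \<subseteq> I" "set x \<subseteq> I"
  shows "(\<Sum>u\<in>tuples I (length x). \<Sum>v\<in>tuples I (length z). cross I X z' x' u v * cross I Y u v z x)
    = of_bool (z' = z \<and> x' = x)"
  using assms(2-)
proof (induction x' x arbitrary: z' z rule: list_induct2)
  case Nil
  then show ?case
    by (simp add: cross_Nil_right tuples_length sum_of_bool_left[OF finite_tuples[OF fin]]
        del: sum_of_bool_mult_eq sum_mult_of_bool_eq)
next
  case (Cons i' x' i x)
  let ?T = "tuples I (length z)" let ?U = "tuples I (length x)"
  \<comment> \<open>In the inverse crossing \<open>z\<close> is the moving word, so splitting off
    the letter \<open>i\<close> is an instance of the second hexagon.\<close>
  have Y: "cross I Y (j # u) v z (i # x) = (\<Sum>y\<in>?T. cross I Y [j] y z [i] * cross I Y u v y x)"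
    if "v \<in> ?T" "u \<in> ?U" for j u v
    using cross_append_right[of v z "[j]" "[i]" u x Y] that Cons.prems by (simp add: tuples_length)
  have "(\<Sum>u\<in>tuples I (length (i # x)). \<Sum>v\<in>?T. cross I X z' (i' # x') u v * cross I Y u v z (i # x))
     = (\<Sum>j\<in>I. \<Sum>u\<in>?U. \<Sum>v\<in>?T. (\<Sum>w\<in>?T. cross1 I X z' i' j w * cross I X w x' u v) *
          (\<Sum>y\<in>?T. cross I Y [j] y z [i] * cross I Y u v y x))"
    by (simp add: sum_tuples_Suc Y tuples_length)
  also have "\<dots> = (\<Sum>j\<in>I. \<Sum>u\<in>?U. \<Sum>v\<in>?T. \<Sum>w\<in>?T. \<Sum>y\<in>?T.
      (cross1 I X z' i' j w * cross I Y [j] y z [i]) * (cross I X w x' u v * cross I Y u v y x))"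
    by (simp add: sum_product ac_simps)
  also have "\<dots> = (\<Sum>j\<in>I. \<Sum>w\<in>?T. \<Sum>u\<in>?U. \<Sum>v\<in>?T. \<Sum>y\<in>?T.
      (cross1 I X z' i' j w * cross I Y [j] y z [i]) * (cross I X w x' u v * cross I Y u v y x))"
    by (intro sum.cong[OF refl] sum_rotate)
  also have "\<dots> = (\<Sum>j\<in>I. \<Sum>w\<in>?T. \<Sum>y\<in>?T. \<Sum>u\<in>?U. \<Sum>v\<in>?T.
      (cross1 I X z' i' j w * cross I Y [j] y z [i]) * (cross I X w x' u v * cross I Y u v y x))"
    by (intro sum.cong[OF refl] sum_rotate)
  also have "\<dots> = (\<Sum>j\<in>I. \<Sum>w\<in>?T. \<Sum>y\<in>?T.
      (cross1 I X z' i' j w * cross I Y [j] y z [i]) * of_bool (w = y \<and> x' = x))"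
  proof (intro sum.cong[OF refl])
    fix j w y assume "w \<in> ?T" "y \<in> ?T"
    then have "(\<Sum>u\<in>?U. \<Sum>v\<in>?T. cross I X w x' u v * cross I Y u v y x) = of_bool (w = y \<and> x' = x)"
      using Cons.IH[of w y] Cons.prems tuples_length[of y I "length z"] by (simp add: tuples_def)
    then show "(\<Sum>u\<in>?U. \<Sum>v\<in>?T. (cross1 I X z' i' j w * cross I Y [j] y z [i]) * (cross I X w x' u v * cross I Y u v y x))
       = (cross1 I X z' i' j w * cross I Y [j] y z [i]) * of_bool (w = y \<and> x' = x)"
      by (simp add: sum_distrib_left[symmetric])
  qed
  also have "\<dots> = of_bool (x' = x) * (\<Sum>j\<in>I. \<Sum>w\<in>?T. \<Sum>y\<in>?T.
      of_bool (w = y) * (cross1 I X z' i' j w * cross I Y [j] y z [i]))"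
    by (simp add: sum_distrib_left of_bool_conj ac_simps)
  also have "\<dots> = of_bool (x' = x) * (\<Sum>j\<in>I. \<Sum>w\<in>?T. cross1 I X z' i' j w * cross I Y [j] w z [i])"
    by (simp add: sum_of_bool_left[OF finite_tuples[OF fin]] del: sum_of_bool_mult_eq sum_mult_of_bool_eq)
  also have "\<dots> = of_bool (z' = z \<and> i' # x' = i # x)"
    using Cons.prems cross1_inverse[OF inv, of z' z i' i] by (auto simp: tuples_def)
  finally show ?case .
qed

section \<open>Sliding an operator through a crossing\<close>

lemma cross_pair:
  assumes "set z \<subseteq> I"
  shows "cross I X z' [i, j] [a, b] z = (\<Sum>w\<in>tuples I (length z). cross1 I X z' i a w * cross1 I X w j b z)"
proof -
  have "(\<Sum>w\<in>tuples I (length z). cross1 I X x j b w * of_bool (w = z)) = cross1 I X x j b z" for x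
    using assms by (intro sum_of_bool_left[OF finite_tuples[OF fin]]) (simp add: tuples_def)
  then show ?thesis
    by (simp add: tuples_length)
qed

lemma cross_pair_Cons:
  assumes "set z \<subseteq> I" "c \<in> I"
  shows "cross I X (c' # z') [i, j] [a, b] (c # z) =
    (\<Sum>h\<in>I. \<Sum>h'\<in>I. (\<Sum>d\<in>I. X c' h a d * X d h' b c) * cross I X z' [i, j] [h, h'] z)"
proof -
  let ?T = "tuples I (length z)"
  have "cross I X (c' # z') [i, j] [a, b] (c # z)
     = (\<Sum>d\<in>I. \<Sum>w\<in>?T. \<Sum>h\<in>I. \<Sum>h'\<in>I.
          (X c' h a d * X d h' b c) * (cross1 I X z' i h w * cross1 I X w j h' z))"
    using assms by (simp add: cross_pair sum_tuples_Suc sum_product del: cross.simps) (simp add: ac_simps)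
  also have "\<dots> = (\<Sum>h\<in>I. \<Sum>d\<in>I. \<Sum>w\<in>?T. \<Sum>h'\<in>I.
          (X c' h a d * X d h' b c) * (cross1 I X z' i h w * cross1 I X w j h' z))"
    by (rule sum_rotate)
  also have "\<dots> = (\<Sum>h\<in>I. \<Sum>h'\<in>I. \<Sum>d\<in>I. \<Sum>w\<in>?T.
          (X c' h a d * X d h' b c) * (cross1 I X z' i h w * cross1 I X w j h' z))"
    by (intro sum.cong[OF refl] sum_rotate)
  finally show ?thesis
    using assms by (simp add: cross_pair sum_product del: cross.simps)
qed

text \<open>Naturality for \<open>Y\<close> acting on two moving strands. Passing one letter of
  \<open>z\<close> is the first equation of \<open>slides_over\<close>; the induction carries
  \<open>Y\<close> past the whole word.\<close>

lemma cross_slides_left_pair: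
  assumes "slides_over I X Y"
    and "length z' = length z" "set z' \<subseteq> I" "set z \<subseteq> I" "i \<in> I" "j \<in> I" "k \<in> I" "l \<in> I"
  shows "(\<Sum>a\<in>I. \<Sum>b\<in>I. cross I X z' [i, j] [a, b] z * Y a b k l)
    = (\<Sum>a\<in>I. \<Sum>b\<in>I. Y i j a b * cross I X z' [a, b] [k, l] z)"
  using assms(2-)
proof (induction z' z arbitrary: k l rule: list_induct2)
  case Nil
  then show ?case
    by (simp add: cross_Nil_right of_bool_conj mult.assoc sum_distrib_left[symmetric] sum_of_bool_left[OF fin]
       del: cross.simps sum_of_bool_mult_eq sum_mult_of_bool_eq)
      (simp add: mult.assoc[symmetric] sum_of_bool_left[OF fin] del: sum_of_bool_mult_eq sum_mult_of_bool_eq)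
next
  case (Cons c' z' c z)
  have "(\<Sum>a\<in>I. \<Sum>b\<in>I. cross I X (c' # z') [i, j] [a, b] (c # z) * Y a b k l)
      = (\<Sum>a\<in>I. \<Sum>b\<in>I. \<Sum>h\<in>I. \<Sum>h'\<in>I.
          cross I X z' [i, j] [h, h'] z * (\<Sum>d\<in>I. X c' h a d * X d h' b c * Y a b k l))"
    using Cons.prems by (simp add: cross_pair_Cons sum_distrib_left sum_distrib_right ac_simps del: cross.simps)
  also have "\<dots> = (\<Sum>h\<in>I. \<Sum>h'\<in>I. cross I X z' [i, j] [h, h'] z *
      (\<Sum>a\<in>I. \<Sum>b\<in>I. \<Sum>d\<in>I. X c' h a d * X d h' b c * Y a b k l))"
    by (subst sum_pairs_swap) (simp add: sum_distrib_left)
  also have "\<dots> = (\<Sum>h\<in>I. \<Sum>h'\<in>I. cross I X z' [i, j] [h, h'] z *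
      (\<Sum>a\<in>I. \<Sum>b\<in>I. \<Sum>d\<in>I. Y h h' a b * X c' a k d * X d b l c))"
    using assms(1) Cons.prems by (intro sum.cong[OF refl]) (simp add: slides_over_def)
  also have "\<dots> = (\<Sum>h\<in>I. \<Sum>h'\<in>I. \<Sum>a\<in>I. \<Sum>b\<in>I. cross I X z' [i, j] [h, h'] z * Y h h' a b *
      (\<Sum>d\<in>I. X c' a k d * X d b l c))"
    by (simp add: sum_distrib_left mult.assoc)
  also have "\<dots> = (\<Sum>a\<in>I. \<Sum>b\<in>I. (\<Sum>h\<in>I. \<Sum>h'\<in>I. cross I X z' [i, j] [h, h'] z * Y h h' a b) *
      (\<Sum>d\<in>I. X c' a k d * X d b l c))"
    by (subst sum_pairs_swap) (simp add: sum_distrib_right)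
  also have "\<dots> = (\<Sum>a\<in>I. \<Sum>b\<in>I. (\<Sum>h\<in>I. \<Sum>h'\<in>I. Y i j h h' * cross I X z' [h, h'] [a, b] z) *
      (\<Sum>d\<in>I. X c' a k d * X d b l c))"
    using Cons by (intro sum.cong[OF refl]) (simp del: cross.simps)
  also have "\<dots> = (\<Sum>a\<in>I. \<Sum>b\<in>I. \<Sum>h\<in>I. \<Sum>h'\<in>I. Y i j h h' * ((\<Sum>d\<in>I. X c' a k d * X d b l c) *
      cross I X z' [h, h'] [a, b] z))"
  proof -
    have "(\<Sum>h\<in>I. \<Sum>h'\<in>I. Y i j h h' * cross I X z' [h, h'] [a, b] z) * q
      = (\<Sum>h\<in>I. \<Sum>h'\<in>I. Y i j h h' * (q * cross I X z' [h, h'] [a, b] z))" for a b q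
      by (simp add: sum_distrib_left sum_distrib_right ac_simps del: cross.simps)
    then show ?thesis by (simp only:)
  qed
  also have "\<dots> = (\<Sum>h\<in>I. \<Sum>h'\<in>I. Y i j h h' * cross I X (c' # z') [h, h'] [k, l] (c # z))"
    using Cons.prems by (subst sum_pairs_swap) (simp add: cross_pair_Cons sum_distrib_left del: cross.simps)
  finally show ?case .
qed

text \<open>The mirror image: \<open>Y\<close> acts on two strands that are passed over, and each
  moving strand costs one use of the second equation of \<open>slides_over\<close>.\<close>

lemma cross_slides_right_pair:
  assumes "slides_over I X Y"
    and "length x' = length x" "set x' \<subseteq> I" "set x \<subseteq> I" "i \<in> I" "j \<in> I" "k \<in> I" "l \<in> I"
  shows "(\<Sum>a\<in>I. \<Sum>b\<in>I. Y i j a b * cross I X [a, b] x' x [k, l])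
    = (\<Sum>a\<in>I. \<Sum>b\<in>I. cross I X [i, j] x' x [a, b] * Y a b k l)"
  using assms(2-)
proof (induction x' x arbitrary: i j rule: list_induct2)
  case Nil
  then show ?case
    by (simp add: of_bool_conj mult.assoc sum_distrib_left[symmetric] sum_of_bool_left[OF fin]
       del: sum_of_bool_mult_eq sum_mult_of_bool_eq)
      (simp add: mult.assoc[symmetric] sum_of_bool_left[OF fin] del: sum_of_bool_mult_eq sum_mult_of_bool_eq)
next
  case (Cons h' x' h x)
  have c: "cross I X [a, b] (h' # x') (h # x) [m, n]
     = (\<Sum>c\<in>I. \<Sum>d\<in>I. (\<Sum>g\<in>I. X a g h c * X b h' g d) * cross I X [c, d] x' x [m, n])" for a b m n
  proof -
    have "cross1 I X [a, b] h' h [c, d] = (\<Sum>g\<in>I. X a g h c * X b h' g d)" for c d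
      using Cons.prems by (simp add: sum_of_bool_left[OF fin] del: sum_of_bool_mult_eq sum_mult_of_bool_eq)
    then show ?thesis
      by (simp add: sum_tuples_Suc numeral_2_eq_2 del: cross1.simps)
  qed
  have "(\<Sum>a\<in>I. \<Sum>b\<in>I. Y i j a b * cross I X [a, b] (h' # x') (h # x) [k, l])
      = (\<Sum>a\<in>I. \<Sum>b\<in>I. \<Sum>c\<in>I. \<Sum>d\<in>I. (\<Sum>g\<in>I. Y i j a b * X a g h c * X b h' g d) *
           cross I X [c, d] x' x [k, l])"
    by (simp only: c) (simp add: sum_distrib_left sum_distrib_right ac_simps del: cross.simps)
  also have "\<dots> = (\<Sum>c\<in>I. \<Sum>d\<in>I. (\<Sum>a\<in>I. \<Sum>b\<in>I. \<Sum>g\<in>I. Y i j a b * X a g h c * X b h' g d) *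
           cross I X [c, d] x' x [k, l])"
    by (subst sum_pairs_swap) (simp add: sum_distrib_right)
  also have "\<dots> = (\<Sum>c\<in>I. \<Sum>d\<in>I. (\<Sum>a\<in>I. \<Sum>b\<in>I. \<Sum>g\<in>I. X i g h a * X j h' g b * Y a b c d) *
           cross I X [c, d] x' x [k, l])"
    using assms(1) Cons.prems by (intro sum.cong[OF refl]) (simp add: slides_over_def)
  also have "\<dots> = (\<Sum>c\<in>I. \<Sum>d\<in>I. \<Sum>a\<in>I. \<Sum>b\<in>I. (\<Sum>g\<in>I. X i g h a * X j h' g b) *
          (Y a b c d * cross I X [c, d] x' x [k, l]))"
    by (simp add: sum_distrib_right mult.assoc)
  also have "\<dots> = (\<Sum>a\<in>I. \<Sum>b\<in>I. (\<Sum>g\<in>I. X i g h a * X j h' g b) *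
          (\<Sum>c\<in>I. \<Sum>d\<in>I. Y a b c d * cross I X [c, d] x' x [k, l]))"
    by (subst sum_pairs_swap) (simp add: sum_distrib_left)
  also have "\<dots> = (\<Sum>a\<in>I. \<Sum>b\<in>I. (\<Sum>g\<in>I. X i g h a * X j h' g b) *
          (\<Sum>c\<in>I. \<Sum>d\<in>I. cross I X [a, b] x' x [c, d] * Y c d k l))"
    using Cons by (intro sum.cong[OF refl]) (simp del: cross.simps)
  also have "\<dots> = (\<Sum>a\<in>I. \<Sum>b\<in>I. \<Sum>c\<in>I. \<Sum>d\<in>I. (\<Sum>g\<in>I. X i g h a * X j h' g b) *
          cross I X [a, b] x' x [c, d] * Y c d k l)"
    by (simp add: sum_distrib_left mult.assoc)
  also have "\<dots> = (\<Sum>c\<in>I. \<Sum>d\<in>I. cross I X [i, j] (h' # x') (h # x) [c, d] * Y c d k l)"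
    by (subst sum_pairs_swap) (simp only: c sum_distrib_right)
  finally show ?case .
qed

text \<open>The first hexagon splits the moving word into what precedes the pair, the pair, and what
  follows it; \<open>Y\<close> meets only the middle factor.\<close>

lemma cross_slides_left:
  assumes sl: "slides_over I X Y"
    and len: "length s' = length s" "length r' = length r"
    and z': "z' \<in> tuples I (length z)" and I: "i \<in> I" "j \<in> I" "k \<in> I" "l \<in> I"
  shows "(\<Sum>a\<in>I. \<Sum>b\<in>I. cross I X z' (s' @ i # j # r') (s @ a # b # r) z * Y a b k l)
    = (\<Sum>a\<in>I. \<Sum>b\<in>I. Y i j a b * cross I X z' (s' @ a # b # r') (s @ k # l # r) z)"
proof -
  let ?T = "tuples I (length z)"
  have split: "cross I X z' (s' @ m # n # r') (s @ a # b # r) z =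
    (\<Sum>w\<in>?T. \<Sum>v\<in>?T. cross I X z' s' s w * (cross I X w [m, n] [a, b] v * cross I X v r' r z))" for m n a b
  proof -
    have "cross I X w ([m, n] @ r') ([a, b] @ r) z =
        (\<Sum>v\<in>?T. cross I X w [m, n] [a, b] v * cross I X v r' r z)" if "w \<in> ?T" for w
      using that by (intro cross_append_left) auto
    then show ?thesis
      using cross_append_left[of s' s z' z X "m # n # r'" "a # b # r"] len z'
      by (simp add: sum_distrib_left del: cross.simps)
  qed
  have "(\<Sum>a\<in>I. \<Sum>b\<in>I. cross I X z' (s' @ i # j # r') (s @ a # b # r) z * Y a b k l)
     = (\<Sum>a\<in>I. \<Sum>b\<in>I. \<Sum>w\<in>?T. \<Sum>v\<in>?T. cross I X z' s' s w * cross I X v r' r z *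
         (cross I X w [i, j] [a, b] v * Y a b k l))"
    by (simp add: split sum_distrib_left sum_distrib_right ac_simps del: cross.simps)
  also have "\<dots> = (\<Sum>w\<in>?T. \<Sum>v\<in>?T. cross I X z' s' s w * cross I X v r' r z *
         (\<Sum>a\<in>I. \<Sum>b\<in>I. cross I X w [i, j] [a, b] v * Y a b k l))"
    by (subst sum_pairs_swap) (simp add: sum_distrib_left)
  also have "\<dots> = (\<Sum>w\<in>?T. \<Sum>v\<in>?T. cross I X z' s' s w * cross I X v r' r z *
         (\<Sum>a\<in>I. \<Sum>b\<in>I. Y i j a b * cross I X w [a, b] [k, l] v))"
    using I by (intro sum.cong[OF refl] arg_cong2[of _ _ _ _ "(*)"] cross_slides_left_pair[OF sl])
      (auto simp: tuples_def)
  also have "\<dots> = (\<Sum>w\<in>?T. \<Sum>v\<in>?T. \<Sum>a\<in>I. \<Sum>b\<in>I. Y i j a b *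
        (cross I X z' s' s w * (cross I X w [a, b] [k, l] v * cross I X v r' r z)))"
    by (simp add: sum_distrib_left ac_simps del: cross.simps)
  also have "\<dots> = (\<Sum>a\<in>I. \<Sum>b\<in>I. Y i j a b * cross I X z' (s' @ a # b # r') (s @ k # l # r) z)"
    by (subst sum_pairs_swap) (simp add: split sum_distrib_left del: cross.simps)
  finally show ?thesis .
qed

lemma cross_slides_right:
  assumes sl: "slides_over I X Y"
    and len: "length s' = length s" "length r' = length r"
    and x: "length x' = length x" "set x' \<subseteq> I" "set x \<subseteq> I" and I: "i \<in> I" "j \<in> I" "k \<in> I" "l \<in> I"
  shows "(\<Sum>a\<in>I. \<Sum>b\<in>I. Y i j a b * cross I X (s' @ a # b # r') x' x (s @ k # l # r))
    = (\<Sum>a\<in>I. \<Sum>b\<in>I. cross I X (s' @ i # j # r') x' x (s @ a # b # r) * Y a b k l)"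
proof -
  let ?T = "tuples I (length x)"
  have split: "cross I X (s' @ m # n # r') x' x (s @ a # b # r) =
    (\<Sum>w\<in>?T. \<Sum>v\<in>?T. cross I X s' w x s * (cross I X [m, n] v w [a, b] * cross I X r' x' v r))" for m n a b
  proof -
    have "cross I X ([m, n] @ r') x' w ([a, b] @ r) =
        (\<Sum>v\<in>?T. cross I X [m, n] v w [a, b] * cross I X r' x' v r)" if "w \<in> ?T" for w
      using that len x cross_append_right[of x' w "[m, n]" "[a, b]" r' r X] by (simp add: tuples_def)
    then show ?thesis
      using cross_append_right[of x' x s' s "m # n # r'" "a # b # r" X] len x
      by (simp add: sum_distrib_left del: cross.simps)
  qed
  have "(\<Sum>a\<in>I. \<Sum>b\<in>I. Y i j a b * cross I X (s' @ a # b # r') x' x (s @ k # l # r))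
     = (\<Sum>a\<in>I. \<Sum>b\<in>I. \<Sum>w\<in>?T. \<Sum>v\<in>?T. cross I X s' w x s * cross I X r' x' v r *
         (Y i j a b * cross I X [a, b] v w [k, l]))"
    by (simp add: split sum_distrib_left ac_simps del: cross.simps)
  also have "\<dots> = (\<Sum>w\<in>?T. \<Sum>v\<in>?T. cross I X s' w x s * cross I X r' x' v r *
         (\<Sum>a\<in>I. \<Sum>b\<in>I. Y i j a b * cross I X [a, b] v w [k, l]))"
    by (subst sum_pairs_swap) (simp add: sum_distrib_left)
  also have "\<dots> = (\<Sum>w\<in>?T. \<Sum>v\<in>?T. cross I X s' w x s * cross I X r' x' v r *
         (\<Sum>a\<in>I. \<Sum>b\<in>I. cross I X [i, j] v w [a, b] * Y a b k l))"
    using I by (intro sum.cong[OF refl] arg_cong2[of _ _ _ _ "(*)"] cross_slides_right_pair[OF sl])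
      (auto simp: tuples_def)
  also have "\<dots> = (\<Sum>w\<in>?T. \<Sum>v\<in>?T. \<Sum>a\<in>I. \<Sum>b\<in>I.
        cross I X s' w x s * (cross I X [i, j] v w [a, b] * cross I X r' x' v r) * Y a b k l)"
    by (simp add: sum_distrib_left ac_simps del: cross.simps)
  also have "\<dots> = (\<Sum>a\<in>I. \<Sum>b\<in>I. cross I X (s' @ i # j # r') x' x (s @ a # b # r) * Y a b k l)"
    by (subst sum_pairs_swap) (simp add: split sum_distrib_right del: cross.simps)
  finally show ?thesis .
qed

end

section \<open>The braid operator of a graded Yang--Baxter matrix\<close>

locale graded_yb =
  fixes \<sigma> :: "'g::ab_group_add \<Rightarrow> 'g \<Rightarrow> 'k::field_char_0"
    and I :: "'i set" and \<eta> :: "'i \<Rightarrow> 'g"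
    and R :: "'i \<Rightarrow> 'i \<Rightarrow> 'i \<Rightarrow> 'i \<Rightarrow> 'k"
  assumes commutation: "commutation_factor \<sigma>"
    and fin: "finite I"
    and hom: "R_homogeneous I \<eta> R"
    and invertible: "mat_invertible (I \<times> I) (R_map \<sigma> I \<eta> R)"
    and yang_baxter: "graded_yang_baxter \<sigma> I \<eta> R"
begin

lemma \<sigma>_nz [simp]: "\<sigma> \<alpha> \<beta> \<noteq> 0"
  using commutation by (simp add: commutation_factor_def)

lemma \<sigma>_add_left: "\<sigma> (\<alpha> + \<alpha>') \<beta> = \<sigma> \<alpha> \<beta> * \<sigma> \<alpha>' \<beta>"
  using commutation by (simp add: commutation_factor_def)

lemma \<sigma>_add_right: "\<sigma> \<alpha> (\<beta> + \<beta>') = \<sigma> \<alpha> \<beta> * \<sigma> \<alpha> \<beta>'"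
  using commutation by (simp add: commutation_factor_def)

lemma \<sigma>_sym: "\<sigma> \<alpha> \<beta> * \<sigma> \<beta> \<alpha> = 1"
  using commutation by (simp add: commutation_factor_def)

lemma \<sigma>_0_left [simp]: "\<sigma> 0 \<beta> = 1"
  using \<sigma>_add_left[of 0 0 \<beta>] by simp

lemma \<sigma>_0_right [simp]: "\<sigma> \<alpha> 0 = 1"
  using \<sigma>_add_right[of \<alpha> 0 0] by simp

lemma \<sigma>_diff_left: "\<sigma> (\<alpha> - \<alpha>') \<beta> = \<sigma> \<alpha> \<beta> / \<sigma> \<alpha>' \<beta>"
  using \<sigma>_add_left[of "\<alpha> - \<alpha>'" \<alpha>' \<beta>] by (simp add: field_simps)

lemma \<sigma>_diff_right: "\<sigma> \<alpha> (\<beta> - \<beta>') = \<sigma> \<alpha> \<beta> / \<sigma> \<alpha> \<beta>'"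
  using \<sigma>_add_right[of \<alpha> "\<beta> - \<beta>'" \<beta>'] by (simp add: field_simps)

lemma \<sigma>_minus_left: "\<sigma> (- \<alpha>) \<beta> = 1 / \<sigma> \<alpha> \<beta>"
  using \<sigma>_diff_left[of 0 \<alpha> \<beta>] by simp

lemma \<sigma>_minus_right: "\<sigma> \<alpha> (- \<beta>) = 1 / \<sigma> \<alpha> \<beta>"
  using \<sigma>_diff_right[of \<alpha> 0 \<beta>] by simp

lemmas \<sigma>_simps = \<sigma>_add_left \<sigma>_add_right \<sigma>_diff_left \<sigma>_diff_right \<sigma>_minus_left \<sigma>_minus_right

text \<open>On the left are the rescalings hidden in \<open>T\<close> for a product and for its two
  tensor factors, on the right the sign of the graded tensor product. Their equality is the reason
  why the coproduct of \<open>T x y\<close> carries no signs.\<close>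

lemma \<sigma>_comult_mult:
  "1 / \<sigma> (y - x) x' * (\<sigma> (z - x) x' * \<sigma> (y - z) z') = \<sigma> (y - z) (z' - x')"
  by (simp add: \<sigma>_simps field_simps)

text \<open>The case of one letter: it singles out
  \<open>\<sigma> (\<eta> j - \<eta> i) (\<eta> j)\<close> as the rescaling of the generator with
  indices \<open>i\<close>, \<open>j\<close>.\<close>

lemma \<sigma>_comult_gen:
  "\<sigma> (k - i) (k - j) * (1 / \<sigma> (k - i) k * (1 / \<sigma> (j - k) j)) = 1 / \<sigma> (j - i) j"
  by (simp add: \<sigma>_simps field_simps)

lemma R_zero: "\<lbrakk>i \<in> I; j \<in> I; k \<in> I; l \<in> I; \<eta> i + \<eta> j \<noteq> \<eta> k + \<eta> l\<rbrakk> \<Longrightarrow> R i j k l = 0"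
  using hom by (simp add: R_homogeneous_def)

text \<open>\<open>R\<close> followed by the graded flip.\<close>

definition C :: "'i \<Rightarrow> 'i \<Rightarrow> 'i \<Rightarrow> 'i \<Rightarrow> 'k" where
  "C j i k l = \<sigma> (\<eta> i) (\<eta> j) * \<sigma> (\<eta> j - \<eta> l) (\<eta> k) * R i j k l"

lemma C_zero: "\<lbrakk>i \<in> I; j \<in> I; k \<in> I; l \<in> I; \<eta> i + \<eta> j \<noteq> \<eta> k + \<eta> l\<rbrakk> \<Longrightarrow> C i j k l = 0"
  using R_zero[of j i k l] by (simp add: C_def add.commute)

section \<open>Matrix entries and the braid relation\<close>

lemma sum4_delta:
  assumes "x \<in> I" "y \<in> I" "z \<in> I" "w \<in> I"
  shows "(\<Sum>i\<in>I. \<Sum>j\<in>I. \<Sum>k\<in>I. \<Sum>l\<in>I. f i j k l * (mat_unit i k x z * mat_unit j l y w)) = (f x y z w :: 'k)"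
proof -
  have "(\<Sum>i\<in>I. \<Sum>j\<in>I. \<Sum>k\<in>I. \<Sum>l\<in>I. f i j k l * (mat_unit i k x z * mat_unit j l y w))
     = (\<Sum>i\<in>I. if x = i then (\<Sum>j\<in>I. if y = j then (\<Sum>k\<in>I. if z = k then (\<Sum>l\<in>I. if w = l then f i j k l else 0) else 0) else 0) else 0)"
    by (intro sum.cong[OF refl]) (auto simp: mat_unit_def intro!: sum.cong sum.neutral)
  also have "\<dots> = f x y z w"
    using assms fin by simp
  finally show ?thesis .
qed

lemma R_map_entry:
  assumes "x \<in> I" "y \<in> I" "z \<in> I" "w \<in> I"
  shows "R_map \<sigma> I \<eta> R (x, y) (z, w) = \<sigma> (\<eta> y - \<eta> w) (\<eta> z) * R x y z w"
  using sum4_delta[OF assms, of "\<lambda>i j k l. \<sigma> (\<eta> y - \<eta> w) (\<eta> z) * R i j k l"]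
  by (simp add: R_map_def tensor2_def mat_gtensor_def ac_simps)

lemma R12_entry:
  assumes "x1 \<in> I" "x2 \<in> I" "x3 \<in> I" "y1 \<in> I" "y2 \<in> I" "y3 \<in> I"
  shows "R12 \<sigma> I \<eta> R (x1, x2, x3) (y1, y2, y3) =
    (if x3 = y3 then \<sigma> (\<eta> x2 - \<eta> y2) (\<eta> y1) * R x1 x2 y1 y2 else 0)"
proof -
  let ?c = "\<sigma> (\<eta> x2 + \<eta> x3 - (\<eta> y2 + \<eta> y3)) (\<eta> y1) * \<sigma> (\<eta> x3 - \<eta> y3) (\<eta> y2) * mat_id I x3 y3"
  have "R12 \<sigma> I \<eta> R (x1, x2, x3) (y1, y2, y3) = ?c * R x1 x2 y1 y2"
    using sum4_delta[OF assms(1,2,4,5), of "\<lambda>i j k l. ?c * R i j k l"]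
    by (simp add: R12_def tensor3_def tensor2_def mat_gtensor_def ac_simps)
  then show ?thesis
    using assms by (simp add: mat_id_def)
qed

text \<open>The graded tensor product puts the total degree of the last two matrix units against the
  first basis vector. That sign is 1 because \<open>R\<close> has degree zero.\<close>

lemma R23_entry:
  assumes "x1 \<in> I" "x2 \<in> I" "x3 \<in> I" "y1 \<in> I" "y2 \<in> I" "y3 \<in> I"
  shows "R23 \<sigma> I \<eta> R (x1, x2, x3) (y1, y2, y3) =
    (if x1 = y1 then \<sigma> (\<eta> x3 - \<eta> y3) (\<eta> y2) * R x2 x3 y2 y3 else 0)"
proof -
  let ?c = "\<sigma> (\<eta> x2 + \<eta> x3 - (\<eta> y2 + \<eta> y3)) (\<eta> y1) * \<sigma> (\<eta> x3 - \<eta> y3) (\<eta> y2) * mat_id I x1 y1"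
  have "R23 \<sigma> I \<eta> R (x1, x2, x3) (y1, y2, y3) = ?c * R x2 x3 y2 y3"
    using sum4_delta[OF assms(2,3,5,6), of "\<lambda>i j k l. ?c * R i j k l"]
    by (simp add: R23_def tensor3_def tensor2_def mat_gtensor_def ac_simps)
  then show ?thesis
    using assms R_zero[of x2 x3 y2 y3] by (cases "\<eta> x2 + \<eta> x3 = \<eta> y2 + \<eta> y3") (auto simp: mat_id_def)
qed

lemma R13_entry:
  assumes "x1 \<in> I" "x2 \<in> I" "x3 \<in> I" "y1 \<in> I" "y2 \<in> I" "y3 \<in> I"
  shows "R13 \<sigma> I \<eta> R (x1, x2, x3) (y1, y2, y3) =
    (if x2 = y2 then \<sigma> (\<eta> x3 - \<eta> y3) (\<eta> y1 + \<eta> x2) * R x1 x3 y1 y3 else 0)"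
proof -
  let ?c = "\<sigma> (\<eta> x2 + \<eta> x3 - (\<eta> y2 + \<eta> y3)) (\<eta> y1) * \<sigma> (\<eta> x3 - \<eta> y3) (\<eta> y2) * mat_id I x2 y2"
  have "R13 \<sigma> I \<eta> R (x1, x2, x3) (y1, y2, y3) = ?c * R x1 x3 y1 y3"
    using sum4_delta[OF assms(1,3,4,6), of "\<lambda>i j k l. ?c * R i j k l"]
    by (simp add: R13_def tensor3_def tensor2_def mat_gtensor_def ac_simps)
  then show ?thesis
    using assms by (simp add: mat_id_def \<sigma>_add_right)
qed

lemma mat_mult_pairs:
  "mat_mult (I \<times> I) X Y m n = (\<Sum>a\<in>I. \<Sum>b\<in>I. X m (a, b) * Y (a, b) n)"
  by (simp add: mat_mult_def sum.cartesian_product split_def)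

lemma mat_mult_triples:
  "mat_mult (I \<times> I \<times> I) X Y m n = (\<Sum>a\<in>I. \<Sum>b\<in>I. \<Sum>c\<in>I. X m (a, b, c) * Y (a, b, c) n)"
  by (simp add: mat_mult_def sum.cartesian_product split_def)

lemma if_zero_mult:
  "(if P then x else 0) * (y::'k) = (if P then x * y else 0)" "y * (if P then x else 0) = (if P then y * x else 0)"
  by simp_all

lemma sum_if_const: "(\<Sum>x\<in>S. if P then f x else 0) = (if P then \<Sum>x\<in>S. f x else (0::'k))"
  by simp

lemma yang_baxter_entries:
  assumes I: "x1 \<in> I" "x2 \<in> I" "x3 \<in> I" "y1 \<in> I" "y2 \<in> I" "y3 \<in> I"
  shows "(\<Sum>a\<in>I. \<Sum>b\<in>I. \<Sum>c\<in>I. \<sigma> (\<eta> x2 - \<eta> b) (\<eta> a) * R x1 x2 a b *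
      (\<sigma> (\<eta> x3 - \<eta> c) (\<eta> y1 + \<eta> b) * R a x3 y1 c) * (\<sigma> (\<eta> c - \<eta> y3) (\<eta> y2) * R b c y2 y3))
    = (\<Sum>a\<in>I. \<Sum>b\<in>I. \<Sum>c\<in>I. \<sigma> (\<eta> x3 - \<eta> c) (\<eta> b) * R x2 x3 b c *
      (\<sigma> (\<eta> c - \<eta> y3) (\<eta> a + \<eta> b) * R x1 c a y3) * (\<sigma> (\<eta> b - \<eta> y2) (\<eta> y1) * R a b y1 y2))"
    (is "?L = ?R")
proof -
  let ?B = "I \<times> I \<times> I"
  have "mat_mult ?B (mat_mult ?B (R12 \<sigma> I \<eta> R) (R13 \<sigma> I \<eta> R)) (R23 \<sigma> I \<eta> R) (x1, x2, x3) (y1, y2, y3)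
    = mat_mult ?B (mat_mult ?B (R23 \<sigma> I \<eta> R) (R13 \<sigma> I \<eta> R)) (R12 \<sigma> I \<eta> R) (x1, x2, x3) (y1, y2, y3)"
    using yang_baxter by (simp add: graded_yang_baxter_def Let_def)
  moreover have "mat_mult ?B (mat_mult ?B (R12 \<sigma> I \<eta> R) (R13 \<sigma> I \<eta> R)) (R23 \<sigma> I \<eta> R) (x1, x2, x3) (y1, y2, y3)
     = (\<Sum>b\<in>I. \<Sum>c\<in>I. \<Sum>a\<in>I. \<sigma> (\<eta> x2 - \<eta> b) (\<eta> a) * R x1 x2 a b *
      (\<sigma> (\<eta> x3 - \<eta> c) (\<eta> y1 + \<eta> b) * R a x3 y1 c) * (\<sigma> (\<eta> c - \<eta> y3) (\<eta> y2) * R b c y2 y3))"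
    using I fin
    by (simp add: mat_mult_triples R12_entry R13_entry R23_entry if_zero_mult sum_if_const sum_distrib_right cong: if_cong)
  moreover have "\<dots> = ?L"
    by (rule sum_rotate)
  moreover have "mat_mult ?B (mat_mult ?B (R23 \<sigma> I \<eta> R) (R13 \<sigma> I \<eta> R)) (R12 \<sigma> I \<eta> R) (x1, x2, x3) (y1, y2, y3)
     = ?R"
    using I fin
    by (simp add: mat_mult_triples R12_entry R13_entry R23_entry if_zero_mult sum_if_const sum_distrib_right cong: if_cong)
  ultimately show ?thesis by simp
qed

text \<open>Both sides of the braid relation contain three flips, which together reverse the three
  tensor factors. Collecting their signs leaves the graded Yang--Baxter equation, read at the
  reversed word.\<close>

lemma C_slides_over_C: "slides_over I C C"
proof -
  have braid: "(\<Sum>a\<in>I. \<Sum>b\<in>I. \<Sum>d\<in>I. C p q a d * C d r b m * C a b k l)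
      = (\<Sum>a\<in>I. \<Sum>b\<in>I. \<Sum>d\<in>I. C q r a b * C p a k d * C d b l m)"
    if I: "p \<in> I" "q \<in> I" "r \<in> I" "k \<in> I" "l \<in> I" "m \<in> I" for p q r k l m
  proof -
    \<comment> \<open>The sign of the graded reversal that sends
      \<open>e_r \<otimes> e_q \<otimes> e_p\<close> to
      \<open>e_p \<otimes> e_q \<otimes> e_r\<close>.\<close>
    let ?s = "\<sigma> (\<eta> q) (\<eta> p) * \<sigma> (\<eta> r) (\<eta> p + \<eta> q)"
    have L: "C p q a d * C d r b m * C a b k l = ?s * (\<sigma> (\<eta> p - \<eta> d) (\<eta> a) * R q p a d *
         (\<sigma> (\<eta> d - \<eta> m) (\<eta> b + \<eta> a) * R r d b m) * (\<sigma> (\<eta> a - \<eta> l) (\<eta> k) * R b a k l))"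
      if "a \<in> I" "b \<in> I" "d \<in> I" for a b d
    \<comment> \<open>If these two coefficients do not vanish, homogeneity expresses
      \<open>\<eta> p\<close> and \<open>\<eta> r\<close> by the other degrees, and the signs then
      agree identically.\<close>
    proof (cases "R q p a d = 0 \<or> R r d b m = 0")
      case False
      then have "\<eta> q + \<eta> p = \<eta> a + \<eta> d" "\<eta> r + \<eta> d = \<eta> b + \<eta> m"
        using I that R_zero by blast+
      then have e: "\<eta> p = \<eta> a + \<eta> d - \<eta> q" "\<eta> r = \<eta> b + \<eta> m - \<eta> d"
        by (simp_all add: algebra_simps)
      show ?thesis
        unfolding C_def
        by (simp add: e \<sigma>_simps \<sigma>_sym field_simps)
    qed (auto simp: C_def)
    have R: "?s * (\<sigma> (\<eta> q - \<eta> b) (\<eta> a) * R r q a b *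
        (\<sigma> (\<eta> p - \<eta> d) (\<eta> k + \<eta> b) * R a p k d) * (\<sigma> (\<eta> d - \<eta> m) (\<eta> l) * R b d l m))
        = C q r a b * C p a k d * C d b l m" if "a \<in> I" "b \<in> I" "d \<in> I" for a b d
    proof (cases "R r q a b = 0 \<or> R a p k d = 0")
      case False
      then have "\<eta> r + \<eta> q = \<eta> a + \<eta> b" "\<eta> a + \<eta> p = \<eta> k + \<eta> d"
        using I that R_zero by blast+
      then have e: "\<eta> r = \<eta> a + \<eta> b - \<eta> q" "\<eta> p = \<eta> k + \<eta> d - \<eta> a"
        by (simp_all add: algebra_simps)
      show ?thesis
        unfolding C_def
        by (simp add: e \<sigma>_simps \<sigma>_sym field_simps)
    qed (auto simp: C_def)
    have "(\<Sum>a\<in>I. \<Sum>b\<in>I. \<Sum>d\<in>I. C p q a d * C d r b m * C a b k l)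
      = (\<Sum>a\<in>I. \<Sum>b\<in>I. \<Sum>d\<in>I. ?s * (\<sigma> (\<eta> p - \<eta> d) (\<eta> a) * R q p a d *
         (\<sigma> (\<eta> d - \<eta> m) (\<eta> b + \<eta> a) * R r d b m) * (\<sigma> (\<eta> a - \<eta> l) (\<eta> k) * R b a k l)))"
      by (intro sum.cong[OF refl] L)
    also have "\<dots> = ?s * (\<Sum>b\<in>I. \<Sum>a\<in>I. \<Sum>d\<in>I. \<sigma> (\<eta> p - \<eta> d) (\<eta> a) * R q p a d *
      (\<sigma> (\<eta> d - \<eta> m) (\<eta> b + \<eta> a) * R r d b m) * (\<sigma> (\<eta> a - \<eta> l) (\<eta> k) * R b a k l))"
      unfolding sum_distrib_left[symmetric] by (subst sum.swap) (rule refl)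
    also have "\<dots> = ?s * (\<Sum>a\<in>I. \<Sum>b\<in>I. \<Sum>d\<in>I. \<sigma> (\<eta> q - \<eta> b) (\<eta> a) * R r q a b *
      (\<sigma> (\<eta> p - \<eta> d) (\<eta> k + \<eta> b) * R a p k d) * (\<sigma> (\<eta> d - \<eta> m) (\<eta> l) * R b d l m))"
      using yang_baxter_entries[of r q p k l m] I by simp
    also have "\<dots> = (\<Sum>a\<in>I. \<Sum>b\<in>I. \<Sum>d\<in>I. C q r a b * C p a k d * C d b l m)"
      unfolding sum_distrib_left by (intro sum.cong[OF refl] R)
    finally show ?thesis .
  qed
  \<comment> \<open>For equal operators the second equation is the first one with its summation
    indices renamed.\<close>
  have "(\<Sum>a\<in>I. \<Sum>b\<in>I. \<Sum>d\<in>I. C p q a b * C a d k l * C b r d m)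
      = (\<Sum>a\<in>I. \<Sum>b\<in>I. \<Sum>d\<in>I. C p d k a * C q r d b * C a b l m)"
    if I: "p \<in> I" "q \<in> I" "r \<in> I" "k \<in> I" "l \<in> I" "m \<in> I" for p q r k l m
  proof -
    have "(\<Sum>a\<in>I. \<Sum>b\<in>I. \<Sum>d\<in>I. C p q a b * C a d k l * C b r d m)
      = (\<Sum>a\<in>I. \<Sum>d\<in>I. \<Sum>b\<in>I. C p q a b * C b r d m * C a d k l)"
      by (subst (2) sum.swap) (simp add: ac_simps)
    also have "\<dots> = (\<Sum>d\<in>I. \<Sum>b\<in>I. \<Sum>a\<in>I. C q r d b * C p d k a * C a b l m)"
      by (rule braid[OF I])
    also have "\<dots> = (\<Sum>a\<in>I. \<Sum>d\<in>I. \<Sum>b\<in>I. C q r d b * C p d k a * C a b l m)"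
      by (rule sum_rotate)
    also have "\<dots> = (\<Sum>a\<in>I. \<Sum>b\<in>I. \<Sum>d\<in>I. C p d k a * C q r d b * C a b l m)"
      by (subst (2) sum.swap) (simp add: ac_simps)
    finally show ?thesis .
  qed
  then show ?thesis
    unfolding slides_over_def by (intro ballI conjI braid)
qed

section \<open>The inverse braid operator\<close>

definition C_inv :: "'i \<Rightarrow> 'i \<Rightarrow> 'i \<Rightarrow> 'i \<Rightarrow> 'k" where
  "C_inv = (SOME Y. (\<forall>i\<in>I. \<forall>j\<in>I. \<forall>k\<in>I. \<forall>l\<in>I.
     (\<eta> i + \<eta> j \<noteq> \<eta> k + \<eta> l \<longrightarrow> Y i j k l = 0) \<and>
     (\<Sum>a\<in>I. \<Sum>b\<in>I. C i j a b * Y a b k l) = of_bool (i = k \<and> j = l) \<and>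
     (\<Sum>a\<in>I. \<Sum>b\<in>I. Y i j a b * C a b k l) = of_bool (i = k \<and> j = l)))"

text \<open>The degree-zero part of an inverse of the degree-zero map \<open>R\<close> is again an inverse.\<close>

lemma C_inv_exists:
  "\<exists>Y. (\<forall>i\<in>I. \<forall>j\<in>I. \<forall>k\<in>I. \<forall>l\<in>I.
     (\<eta> i + \<eta> j \<noteq> \<eta> k + \<eta> l \<longrightarrow> Y i j k l = (0::'k)) \<and>
     (\<Sum>a\<in>I. \<Sum>b\<in>I. C i j a b * Y a b k l) = of_bool (i = k \<and> j = l) \<and>
     (\<Sum>a\<in>I. \<Sum>b\<in>I. Y i j a b * C a b k l) = of_bool (i = k \<and> j = l))"
proof -
  obtain Z where Z: "mat_mult (I \<times> I) (R_map \<sigma> I \<eta> R) Z = mat_id (I \<times> I)"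
     "mat_mult (I \<times> I) Z (R_map \<sigma> I \<eta> R) = mat_id (I \<times> I)"
    using invertible by (auto simp: mat_invertible_def)
  have Z1: "(\<Sum>a\<in>I. \<Sum>b\<in>I. \<sigma> (\<eta> j - \<eta> b) (\<eta> a) * R i j a b * Z (a, b) (k, l)) = of_bool (i = k \<and> j = l)"
    if "i \<in> I" "j \<in> I" "k \<in> I" "l \<in> I" for i j k l
    using fun_cong[OF fun_cong[OF Z(1), of "(i, j)"], of "(k, l)"] that
    by (auto simp: mat_mult_pairs mat_id_def R_map_entry)
  have Z2: "(\<Sum>a\<in>I. \<Sum>b\<in>I. Z (i, j) (a, b) * (\<sigma> (\<eta> b - \<eta> l) (\<eta> k) * R a b k l)) = of_bool (i = k \<and> j = l)"
    if "i \<in> I" "j \<in> I" "k \<in> I" "l \<in> I" for i j k l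
    using fun_cong[OF fun_cong[OF Z(2), of "(i, j)"], of "(k, l)"] that
    by (auto simp: mat_mult_pairs mat_id_def R_map_entry)
  \<comment> \<open>\<open>C\<close> is the flip after \<open>R\<close>, so its inverse is
    \<open>Z\<close> after the inverse flip, which sends \<open>e_k \<otimes> e_l\<close> to
    \<open>e_l \<otimes> e_k\<close> divided by \<open>\<sigma> (\<eta> l) (\<eta> k)\<close>.
    Cutting off the entries that change the degree is harmless because \<open>C\<close> preserves
    it.\<close>
  define Y where "Y i j k l = (if \<eta> i + \<eta> j = \<eta> k + \<eta> l then Z (i, j) (l, k) / \<sigma> (\<eta> l) (\<eta> k) else 0)" for i j k l
  have "(\<Sum>a\<in>I. \<Sum>b\<in>I. C i j a b * Y a b k l) = of_bool (i = k \<and> j = l)"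
    if "i \<in> I" "j \<in> I" "k \<in> I" "l \<in> I" for i j k l
  proof -
    have "(\<Sum>a\<in>I. \<Sum>b\<in>I. C i j a b * Y a b k l) = (\<Sum>a\<in>I. \<Sum>b\<in>I.
       of_bool (\<eta> i + \<eta> j = \<eta> k + \<eta> l) * \<sigma> (\<eta> j) (\<eta> i) / \<sigma> (\<eta> l) (\<eta> k) *
       (\<sigma> (\<eta> i - \<eta> b) (\<eta> a) * R j i a b * Z (a, b) (l, k)))"
      using that R_zero by (intro sum.cong[OF refl]) (auto simp: C_def Y_def add.commute)
    also have "\<dots> = of_bool (i = k \<and> j = l)"
      using that unfolding sum_distrib_left[symmetric] by (auto simp: Z1)
    finally show ?thesis .
  qed
  moreover have "(\<Sum>a\<in>I. \<Sum>b\<in>I. Y i j a b * C a b k l) = of_bool (i = k \<and> j = l)"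
    if "i \<in> I" "j \<in> I" "k \<in> I" "l \<in> I" for i j k l
  proof -
    have "(\<Sum>a\<in>I. \<Sum>b\<in>I. Y i j a b * C a b k l) = (\<Sum>a\<in>I. \<Sum>b\<in>I.
       of_bool (\<eta> i + \<eta> j = \<eta> k + \<eta> l) *
       (Z (i, j) (b, a) * (\<sigma> (\<eta> a - \<eta> l) (\<eta> k) * R b a k l)))"
      using that R_zero by (intro sum.cong[OF refl]) (auto simp: C_def Y_def add.commute)
    also have "\<dots> = (\<Sum>b\<in>I. \<Sum>a\<in>I.
       of_bool (\<eta> i + \<eta> j = \<eta> k + \<eta> l) *
       (Z (i, j) (b, a) * (\<sigma> (\<eta> a - \<eta> l) (\<eta> k) * R b a k l)))"
      by (rule sum.swap)
    also have "\<dots> = of_bool (i = k \<and> j = l)"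
      using that unfolding sum_distrib_left[symmetric] by (auto simp: Z2)
    finally show ?thesis .
  qed
  ultimately show ?thesis
    by (intro exI[of _ Y]) (simp add: Y_def)
qed

lemma
  assumes "i \<in> I" "j \<in> I" "k \<in> I" "l \<in> I"
  shows C_inv_zero: "\<eta> i + \<eta> j \<noteq> \<eta> k + \<eta> l \<Longrightarrow> C_inv i j k l = 0"
    and C_C_inv: "(\<Sum>a\<in>I. \<Sum>b\<in>I. C i j a b * C_inv a b k l) = of_bool (i = k \<and> j = l)"
    and C_inv_C: "(\<Sum>a\<in>I. \<Sum>b\<in>I. C_inv i j a b * C a b k l) = of_bool (i = k \<and> j = l)"
  using someI_ex[OF C_inv_exists, folded C_inv_def] assms by blast+

section \<open>Operators on three tensor factors\<close>

abbreviation triples :: "('i \<times> 'i \<times> 'i) set" where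
  "triples \<equiv> I \<times> I \<times> I"

lemma mat_mult_assoc:
  "mat_mult B (mat_mult B X Y) Z = mat_mult B X (mat_mult B Y Z)"
proof (intro ext)
  fix m n
  have "mat_mult B (mat_mult B X Y) Z m n = (\<Sum>p\<in>B. \<Sum>q\<in>B. X m q * (Y q p * Z p n))"
    by (simp add: mat_mult_def sum_distrib_right mult.assoc)
  also have "\<dots> = (\<Sum>q\<in>B. \<Sum>p\<in>B. X m q * (Y q p * Z p n))"
    by (rule sum.swap)
  finally show "mat_mult B (mat_mult B X Y) Z m n = mat_mult B X (mat_mult B Y Z) m n"
    by (simp add: mat_mult_def sum_distrib_left)
qed

definition on12 :: "('i \<Rightarrow> 'i \<Rightarrow> 'i \<Rightarrow> 'i \<Rightarrow> 'k) \<Rightarrow> 'i \<times> 'i \<times> 'i \<Rightarrow> 'i \<times> 'i \<times> 'i \<Rightarrow> 'k" where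
  "on12 X = (\<lambda>(a, b, c) (d, e, f). if {a, b, c, d, e, f} \<subseteq> I \<and> c = f then X a b d e else 0)"

definition on23 :: "('i \<Rightarrow> 'i \<Rightarrow> 'i \<Rightarrow> 'i \<Rightarrow> 'k) \<Rightarrow> 'i \<times> 'i \<times> 'i \<Rightarrow> 'i \<times> 'i \<times> 'i \<Rightarrow> 'k" where
  "on23 X = (\<lambda>(a, b, c) (d, e, f). if {a, b, c, d, e, f} \<subseteq> I \<and> a = d then X b c e f else 0)"

lemma on12_entry: "\<lbrakk>a \<in> I; b \<in> I; c \<in> I; d \<in> I; e \<in> I; f \<in> I\<rbrakk>
    \<Longrightarrow> on12 X (a, b, c) (d, e, f) = (if c = f then X a b d e else 0)"
  by (simp add: on12_def)

lemma on23_entry: "\<lbrakk>a \<in> I; b \<in> I; c \<in> I; d \<in> I; e \<in> I; f \<in> I\<rbrakk>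
    \<Longrightarrow> on23 X (a, b, c) (d, e, f) = (if a = d then X b c e f else 0)"
  by (simp add: on23_def)

lemma triples_ext:
  assumes "\<And>p q r k l m. \<lbrakk>p \<in> I; q \<in> I; r \<in> I; k \<in> I; l \<in> I; m \<in> I\<rbrakk> \<Longrightarrow> X (p, q, r) (k, l, m) = Y (p, q, r) (k, l, m)"
    and "\<And>m n. m \<notin> triples \<or> n \<notin> triples \<Longrightarrow> X m n = 0" "\<And>m n. m \<notin> triples \<or> n \<notin> triples \<Longrightarrow> Y m n = 0"
  shows "X = Y"
proof (intro ext)
  fix m n show "X m n = Y m n"
    using assms by (cases m; cases n; cases "m \<in> triples \<and> n \<in> triples") auto
qed

lemma on12_outside: "m \<notin> triples \<or> n \<notin> triples \<Longrightarrow> on12 X m n = 0"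
  and on23_outside: "m \<notin> triples \<or> n \<notin> triples \<Longrightarrow> on23 X m n = 0"
  by (auto simp: on12_def on23_def split: prod.splits)

lemma mat_mult_outside:
  assumes "\<And>m n. m \<notin> B \<or> n \<notin> B \<Longrightarrow> X m n = 0" "\<And>m n. m \<notin> B \<or> n \<notin> B \<Longrightarrow> Y m n = 0" "m \<notin> B \<or> n \<notin> B"
  shows "mat_mult B X Y m n = 0"
  using assms by (auto simp: mat_mult_def)

text \<open>The bridge between \<open>slides_over\<close> and the matrix algebra: with
  \<open>X\<close>, \<open>Y\<close>, \<open>Z\<close> taken from \<open>C\<close> and
  \<open>C_inv\<close>, both sides of its equations are entries of such triple products.\<close>

lemma on_mult:
  assumes "p \<in> I" "q \<in> I" "r \<in> I" "k \<in> I" "l \<in> I" "m \<in> I"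
  shows "mat_mult triples (on12 X) (mat_mult triples (on23 Y) (on12 Z)) (p, q, r) (k, l, m)
      = (\<Sum>a\<in>I. \<Sum>b\<in>I. \<Sum>d\<in>I. X p q a d * Y d r b m * Z a b k l)"
    and "mat_mult triples (on23 Y) (mat_mult triples (on12 X) (on23 Z)) (p, q, r) (k, l, m)
      = (\<Sum>a\<in>I. \<Sum>b\<in>I. \<Sum>d\<in>I. Y q r a b * X p a k d * Z d b l m)"
proof -
  have "mat_mult triples (on12 X) (mat_mult triples (on23 Y) (on12 Z)) (p, q, r) (k, l, m)
      = (\<Sum>a\<in>I. \<Sum>d\<in>I. \<Sum>b\<in>I. X p q a d * Y d r b m * Z a b k l)"
    using assms fin
    by (simp add: mat_mult_triples on12_entry on23_entry if_zero_mult sum_if_const sum_distrib_left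
        mult.assoc cong: if_cong)
  also have "\<dots> = (\<Sum>a\<in>I. \<Sum>b\<in>I. \<Sum>d\<in>I. X p q a d * Y d r b m * Z a b k l)"
    by (intro sum.cong[OF refl] sum.swap)
  finally show "mat_mult triples (on12 X) (mat_mult triples (on23 Y) (on12 Z)) (p, q, r) (k, l, m)
      = (\<Sum>a\<in>I. \<Sum>b\<in>I. \<Sum>d\<in>I. X p q a d * Y d r b m * Z a b k l)" .
  show "mat_mult triples (on23 Y) (mat_mult triples (on12 X) (on23 Z)) (p, q, r) (k, l, m)
      = (\<Sum>a\<in>I. \<Sum>b\<in>I. \<Sum>d\<in>I. Y q r a b * X p a k d * Z d b l m)"
    using assms fin
    by (simp add: mat_mult_triples on12_entry on23_entry if_zero_mult sum_if_const sum_distrib_left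
        mult.assoc cong: if_cong)
qed

lemma on_inverse:
  assumes "\<And>i j k l. \<lbrakk>i \<in> I; j \<in> I; k \<in> I; l \<in> I\<rbrakk> \<Longrightarrow>
      (\<Sum>a\<in>I. \<Sum>b\<in>I. X i j a b * Y a b k l) = of_bool (i = k \<and> j = l)"
  shows "mat_mult triples (on12 X) (on12 Y) = mat_id triples"
    and "mat_mult triples (on23 X) (on23 Y) = mat_id triples"
proof -
  show "mat_mult triples (on12 X) (on12 Y) = mat_id triples"
  proof (rule triples_ext)
    fix p q r k l m assume I: "p \<in> I" "q \<in> I" "r \<in> I" "k \<in> I" "l \<in> I" "m \<in> I"
    then show "mat_mult triples (on12 X) (on12 Y) (p, q, r) (k, l, m) = mat_id triples (p, q, r) (k, l, m)"
      using fin assms[of p q k l]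
      by (auto simp: mat_mult_triples on12_entry if_zero_mult sum_if_const mat_id_def cong: if_cong)
  qed (rule mat_mult_outside, erule on12_outside, erule on12_outside, assumption, auto simp: mat_id_def)
  show "mat_mult triples (on23 X) (on23 Y) = mat_id triples"
  proof (rule triples_ext)
    fix p q r k l m assume I: "p \<in> I" "q \<in> I" "r \<in> I" "k \<in> I" "l \<in> I" "m \<in> I"
    then show "mat_mult triples (on23 X) (on23 Y) (p, q, r) (k, l, m) = mat_id triples (p, q, r) (k, l, m)"
      using fin assms[of q r l m]
      by (auto simp: mat_mult_triples on23_entry if_zero_mult sum_if_const mat_id_def cong: if_cong)
  qed (rule mat_mult_outside, erule on23_outside, erule on23_outside, assumption, auto simp: mat_id_def)
qed

lemma mat_id_mult:
  assumes "\<And>m n. m \<notin> B \<or> n \<notin> B \<Longrightarrow> X m n = 0" "finite B"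
  shows "mat_mult B (mat_id B) X = X" "mat_mult B X (mat_id B) = X"
proof -
  have "mat_mult B (mat_id B) X m n = X m n" "mat_mult B X (mat_id B) m n = X m n" for m n
  proof -
    have "mat_mult B (mat_id B) X m n = (\<Sum>p\<in>B. if m = p then X p n else 0)"
      by (auto simp: mat_mult_def mat_id_def intro!: sum.cong)
    then show "mat_mult B (mat_id B) X m n = X m n"
      using assms by simp
    have "mat_mult B X (mat_id B) m n = (\<Sum>p\<in>B. if p = n then X m p else 0)"
      by (auto simp: mat_mult_def mat_id_def intro!: sum.cong)
    then show "mat_mult B X (mat_id B) m n = X m n"
      using assms by simp
  qed
  then show "mat_mult B (mat_id B) X = X" "mat_mult B X (mat_id B) = X"
    by (auto intro!: ext)
qed

text \<open>The mixed relations are the braid relation \<open>c1 c2 c1 = c2 c1 c2\<close> multiplied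
  by inverses on both sides: \<open>d1 d2 c1 = c2 d1 d2\<close> and
  \<open>c1 d2 d1 = d2 d1 c2\<close>, where \<open>d1\<close>, \<open>d2\<close> invert
  \<open>c1\<close>, \<open>c2\<close>.\<close>

lemma C_inv_slides_over_C: "slides_over I C_inv C"
proof -
  note C_inv = on_inverse[of C C_inv, OF C_C_inv] on_inverse[of C_inv C, OF C_inv_C]
  have outside: "mat_mult triples (mat_id triples) (on12 X) = on12 X" "mat_mult triples (on12 X) (mat_id triples) = on12 X"
    "mat_mult triples (mat_id triples) (on23 X) = on23 X" "mat_mult triples (on23 X) (mat_id triples) = on23 X" for X
    by (rule mat_id_mult, erule on12_outside on23_outside, simp add: fin)+
  define M :: "_ \<Rightarrow> ('i \<times> 'i \<times> 'i \<Rightarrow> 'i \<times> 'i \<times> 'i \<Rightarrow> 'k) \<Rightarrow> _" where "M = mat_mult triples"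
  define c1 where "c1 = on12 C"
  define c2 where "c2 = on23 C"
  define d1 where "d1 = on12 C_inv"
  define d2 where "d2 = on23 C_inv"
  define e :: "'i \<times> 'i \<times> 'i \<Rightarrow> 'i \<times> 'i \<times> 'i \<Rightarrow> 'k" where "e = mat_id triples"
  have assoc: "M (M x y) z = M x (M y z)" for x y z
    by (simp add: M_def mat_mult_assoc)
  have inv: "M c1 d1 = e" "M d1 c1 = e" "M c2 d2 = e" "M d2 c2 = e"
    using C_inv by (simp_all add: M_def c1_def c2_def d1_def d2_def e_def)
  have unit: "M e c1 = c1" "M e c2 = c2" "M e d1 = d1" "M e d2 = d2"
     "M c1 e = c1" "M c2 e = c2" "M d1 e = d1" "M d2 e = d2"
    using outside by (simp_all add: M_def c1_def c2_def d1_def d2_def e_def)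
  have unit': "M e (M c1 z) = M c1 z" "M e (M c2 z) = M c2 z" "M e (M d1 z) = M d1 z" "M e (M d2 z) = M d2 z" for z
    by (simp_all add: assoc[symmetric] unit)
  have cancel: "M c1 (M d1 z) = M e z" "M d1 (M c1 z) = M e z" "M c2 (M d2 z) = M e z" "M d2 (M c2 z) = M e z" for z
    by (simp_all add: assoc[symmetric] inv)
  have braid: "M c1 (M c2 c1) = M c2 (M c1 c2)"
    unfolding M_def c1_def c2_def
  proof (rule triples_ext)
    fix p q r k l m assume "p \<in> I" "q \<in> I" "r \<in> I" "k \<in> I" "l \<in> I" "m \<in> I"
    then show "mat_mult triples (on12 C) (mat_mult triples (on23 C) (on12 C)) (p, q, r) (k, l, m) =
      mat_mult triples (on23 C) (mat_mult triples (on12 C) (on23 C)) (p, q, r) (k, l, m)"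
      using C_slides_over_C by (simp add: on_mult slides_over_def)
  qed ((rule mat_mult_outside | erule on12_outside | erule on23_outside | assumption)+)
  have braid': "M c1 (M c2 (M c1 z)) = M c2 (M c1 (M c2 z))" for z
    using arg_cong[OF braid, of "\<lambda>x. M x z"] by (simp add: assoc)
  \<comment> \<open>Inserts the trivial word \<open>c2 c1 d1 d2\<close> behind \<open>c1\<close>, so
    that a braid word \<open>c1 c2 c1\<close> appears.\<close>
  have "M d1 (M d2 c1) = M d1 (M d2 (M c1 (M c2 (M c1 (M d1 d2)))))"
    by (simp add: cancel unit unit' inv)
  also have "\<dots> = M c2 (M d1 d2)"
    by (simp only: braid') (simp add: cancel unit unit' inv)
  finally have 1: "M d1 (M d2 c1) = M c2 (M d1 d2)" .
  have "M d2 (M d1 c2) = M d2 (M d1 (M c2 (M c1 (M c2 (M d2 d1)))))"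
    by (simp add: cancel unit unit' inv)
  also have "\<dots> = M c1 (M d2 d1)"
    by (simp only: braid'[symmetric]) (simp add: cancel unit unit' inv)
  finally have 2: "M c1 (M d2 d1) = M d2 (M d1 c2)" ..
  note defs = M_def c1_def c2_def d1_def d2_def
  show ?thesis
    unfolding slides_over_def
  proof (intro ballI conjI)
    fix p q r k l m assume I: "p \<in> I" "q \<in> I" "r \<in> I" "k \<in> I" "l \<in> I" "m \<in> I"
    show "(\<Sum>a\<in>I. \<Sum>b\<in>I. \<Sum>d\<in>I. C_inv p q a d * C_inv d r b m * C a b k l)
        = (\<Sum>a\<in>I. \<Sum>b\<in>I. \<Sum>d\<in>I. C q r a b * C_inv p a k d * C_inv d b l m)"
      using fun_cong[OF fun_cong[OF 1[unfolded defs], of "(p, q, r)"], of "(k, l, m)"] I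
      by (simp add: on_mult)
    have "(\<Sum>a\<in>I. \<Sum>b\<in>I. \<Sum>d\<in>I. C p q a b * C_inv a d k l * C_inv b r d m)
        = (\<Sum>a\<in>I. \<Sum>d\<in>I. \<Sum>b\<in>I. C p q a b * C_inv b r d m * C_inv a d k l)"
      by (subst (2) sum.swap) (simp add: ac_simps)
    also have "\<dots> = (\<Sum>d\<in>I. \<Sum>b\<in>I. \<Sum>a\<in>I. C_inv q r d b * C_inv p d k a * C a b l m)"
      using fun_cong[OF fun_cong[OF 2[unfolded defs], of "(p, q, r)"], of "(k, l, m)"] I
      by (simp add: on_mult)
    also have "\<dots> = (\<Sum>a\<in>I. \<Sum>d\<in>I. \<Sum>b\<in>I. C_inv q r d b * C_inv p d k a * C a b l m)"
      by (rule sum_rotate)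
    also have "\<dots> = (\<Sum>a\<in>I. \<Sum>b\<in>I. \<Sum>d\<in>I. C_inv p d k a * C_inv q r d b * C a b l m)"
      by (subst (2) sum.swap) (simp add: ac_simps)
    finally show "(\<Sum>a\<in>I. \<Sum>b\<in>I. \<Sum>d\<in>I. C p q a b * C_inv a d k l * C_inv b r d m)
        = (\<Sum>a\<in>I. \<Sum>b\<in>I. \<Sum>d\<in>I. C_inv p d k a * C_inv q r d b * C a b l m)" .
  qed
qed

end

section \<open>The free algebra and the relators\<close>

lemma lookup_scale [simp]: "Poly_Mapping.lookup (scale c p) x = c * Poly_Mapping.lookup p x"
  by (simp add: scale_def Poly_Mapping.map.rep_eq when_def)

lemma scale_single [simp]: "scale c (Poly_Mapping.single x d) = Poly_Mapping.single x (c * d)"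
  by (simp add: scale_def)

interpretation pm: vector_space "scale :: 'k::field \<Rightarrow> ('b \<Rightarrow>\<^sub>0 'k) \<Rightarrow> ('b \<Rightarrow>\<^sub>0 'k)"
  by standard (auto intro!: poly_mapping_eqI simp: lookup_add algebra_simps)

lemma vector_space_field: "vector_space ((*) :: 'k::field \<Rightarrow> 'k \<Rightarrow> 'k)"
  by standard (auto simp: algebra_simps)

lemma scale_mult_left: "scale c (p :: 'b::monoid_add \<Rightarrow>\<^sub>0 'k::field) * q = scale c (p * q)"
  by (simp add: scale_def mult_map_scale_conv_mult mult.assoc)

text \<open>Scalars sit on the neutral element of the monoid, so they are central although the
  monoid need not be commutative.\<close>

lemma scale_mult_right: "(p :: 'b::monoid_add \<Rightarrow>\<^sub>0 'k::field) * scale c q = scale c (p * q)"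
proof -
  have "p * Poly_Mapping.single 0 c = Poly_Mapping.single 0 c * p"
  proof (rule poly_mapping_eqI)
    fix x
    have "p * Poly_Mapping.single 0 c = (\<Sum>y\<in>Poly_Mapping.keys p. Poly_Mapping.single y (Poly_Mapping.lookup p y)) * Poly_Mapping.single 0 c"
      by (rule arg_cong[of _ _ "\<lambda>p. p * _"], rule poly_mapping_eqI)
        (auto simp: lookup_sum lookup_single when_def in_keys_iff)
    also have "\<dots> = Poly_Mapping.single 0 c * (\<Sum>y\<in>Poly_Mapping.keys p. Poly_Mapping.single y (Poly_Mapping.lookup p y))"
      by (simp add: sum_distrib_right sum_distrib_left mult_single mult.commute)
    also have "(\<Sum>y\<in>Poly_Mapping.keys p. Poly_Mapping.single y (Poly_Mapping.lookup p y)) = p"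
      by (rule poly_mapping_eqI) (auto simp: lookup_sum lookup_single when_def in_keys_iff)
    finally show "Poly_Mapping.lookup (p * Poly_Mapping.single 0 c) x = Poly_Mapping.lookup (Poly_Mapping.single 0 c * p) x"
      by simp
  qed
  then show ?thesis
    by (simp add: scale_def mult_map_scale_conv_mult flip: mult.assoc)
qed

definition lin ::
  "('k::zero \<Rightarrow> 'v \<Rightarrow> 'v) \<Rightarrow> ('b \<Rightarrow> 'v) \<Rightarrow> ('b \<Rightarrow>\<^sub>0 'k) \<Rightarrow> 'v::comm_monoid_add" where
  "lin s f p = (\<Sum>b\<in>Poly_Mapping.keys p. s (Poly_Mapping.lookup p b) (f b))"

lemma lin_single_expand: "lin scale (\<lambda>b. Poly_Mapping.single b 1) p = p"
  unfolding lin_def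
  by (rule poly_mapping_eqI) (auto simp: lookup_sum lookup_single when_def in_keys_iff)

context
  fixes s :: "'k::field \<Rightarrow> 'v::ab_group_add \<Rightarrow> 'v"
  assumes vs: "vector_space s"
begin

interpretation V: vector_space s by (rule vs)

lemma lin_superset:
  assumes "finite S" "Poly_Mapping.keys p \<subseteq> S"
  shows "lin s f p = (\<Sum>b\<in>S. s (Poly_Mapping.lookup p b) (f b))"
  unfolding lin_def using assms
  by (intro sum.mono_neutral_left) (auto simp: in_keys_iff)

lemma lin_add: "lin s f (p + q) = lin s f p + lin s f q"
proof -
  let ?S = "Poly_Mapping.keys p \<union> Poly_Mapping.keys q"
  have "lin s f (p + q) = (\<Sum>b\<in>?S. s (Poly_Mapping.lookup (p + q) b) (f b))"
    using Poly_Mapping.keys_add[of p q] by (intro lin_superset) auto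
  also have "\<dots> = (\<Sum>b\<in>?S. s (Poly_Mapping.lookup p b) (f b)) + (\<Sum>b\<in>?S. s (Poly_Mapping.lookup q b) (f b))"
    by (simp add: lookup_add V.scale_left_distrib sum.distrib)
  also have "\<dots> = lin s f p + lin s f q"
    by (simp add: lin_superset[of ?S])
  finally show ?thesis .
qed

lemma lin_scale: "lin s f (scale c p) = s c (lin s f p)"
proof -
  have "lin s f (scale c p) = (\<Sum>b\<in>Poly_Mapping.keys p. s (Poly_Mapping.lookup (scale c p) b) (f b))"
    by (intro lin_superset) (auto simp: in_keys_iff)
  then show ?thesis
    by (simp add: lin_def V.scale_sum_right)
qed

lemma lin_0 [simp]: "lin s f 0 = 0"
  by (simp add: lin_def)

lemma lin_single [simp]: "lin s f (Poly_Mapping.single b c) = s c (f b)"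
  by (cases "c = 0") (simp_all add: lin_def)

lemma lin_uminus: "lin s f (- p) = - lin s f p"
  using lin_add[of f p "- p"] by (simp add: eq_neg_iff_add_eq_0 add.commute)

lemma lin_diff: "lin s f (p - q) = lin s f p - lin s f q"
  using lin_add[of f p "- q"] by (simp add: lin_uminus)

lemma lin_sum: "lin s f (\<Sum>x\<in>S. g x) = (\<Sum>x\<in>S. lin s f (g x))"
  by (induction S rule: infinite_finite_induct) (simp_all add: lin_add)

lemma lin_sum_list: "lin s f (\<Sum>x\<leftarrow>xs. g x) = (\<Sum>x\<leftarrow>xs. lin s f (g x))"
  by (induction xs) (simp_all add: lin_add)

lemma lin_fun_add: "lin s (\<lambda>b. f b + g b) p = lin s f p + lin s g p"
  by (simp add: lin_def V.scale_right_distrib sum.distrib)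

lemma lin_fun_diff: "lin s (\<lambda>b. f b - g b) p = lin s f p - lin s g p"
  by (simp add: lin_def V.scale_right_diff_distrib sum_subtractf)

lemma lin_fun_scale: "lin s (\<lambda>b. s c (f b)) p = s c (lin s f p)"
  by (simp add: lin_def V.scale_sum_right mult.commute)

lemma lin_fun_sum: "lin s (\<lambda>b. \<Sum>x\<in>S. f x b) p = (\<Sum>x\<in>S. lin s (f x) p)"
  by (simp add: lin_def V.scale_sum_right) (rule sum.swap)

lemma lin_mem: "\<lbrakk>module.subspace s N; \<And>b. b \<in> Poly_Mapping.keys p \<Longrightarrow> f b \<in> N\<rbrakk> \<Longrightarrow> lin s f p \<in> N"
  unfolding lin_def by (intro V.subspace_sum V.subspace_scale)

lemma lin_cong: "(\<And>b. b \<in> Poly_Mapping.keys p \<Longrightarrow> f b = g b) \<Longrightarrow> lin s f p = lin s g p"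
  by (simp add: lin_def)

lemma lin_span:
  assumes "p \<in> pm.span G" "module.subspace s N" "\<And>g. g \<in> G \<Longrightarrow> lin s f g \<in> N"
  shows "lin s f p \<in> N"
  using assms(1)
  by (induction rule: pm.span_induct_alt)
    (use assms in \<open>auto simp: lin_add lin_scale intro: V.subspace_0 V.subspace_add V.subspace_scale\<close>)

end

context graded_yb
begin

section \<open>Monomials normalised by signs\<close>

abbreviation F :: "(('i \<times> 'i) list \<Rightarrow>\<^sub>0 'k, 'k, 'g) galgebra" where
  "F \<equiv> free_galgebra I \<eta>"

definition deg :: "'i list \<Rightarrow> 'g" where
  "deg x = sum_list (map \<eta> x)"

lemma deg_simps [simp]: "deg [] = 0" "deg (i # x) = \<eta> i + deg x" "deg (x @ y) = deg x + deg y"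
  by (simp_all add: deg_def)

text \<open>The part \<open>\<sigma> (\<eta> k - \<eta> i) (\<eta> k)\<close> removes the sign from
  the coproduct of one letter, by \<open>\<sigma>_comult_gen\<close>. The part
  \<open>\<sigma> (\<eta> k - \<eta> i) (deg x)\<close> compensates the signs that arise when a
  letter is multiplied onto a word, by \<open>\<sigma>_comult_mult\<close>.\<close>

fun sg :: "'i list \<Rightarrow> 'i list \<Rightarrow> 'k" where
  "sg (i # x) (k # y) = \<sigma> (\<eta> k - \<eta> i) (\<eta> k + deg x) * sg x y"
| "sg _ _ = 1"

lemma sg_nz [simp]: "sg x y \<noteq> 0"
  by (induction x y rule: sg.induct) auto

lemma sg_append:
  "length x = length y \<Longrightarrow> sg (x @ x') (y @ y') = \<sigma> (deg y - deg x) (deg x') * sg x y * sg x' y'"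
  by (induction x y rule: list_induct2) (simp_all add: \<sigma>_simps field_simps)

text \<open>
  The monomial \<open>t\<^bsub>x y\<^esub>\<close>, rescaled so that the coproduct becomes matrix comultiplication without signs.
\<close>

definition T :: "'i list \<Rightarrow> 'i list \<Rightarrow> ('i \<times> 'i) list \<Rightarrow>\<^sub>0 'k" where
  "T x y = Poly_Mapping.single (zip x y) (sg x y)"

lemma T_mult:
  assumes "length x = length y"
  shows "T x y * T x' y' = scale (1 / \<sigma> (deg y - deg x) (deg x')) (T (x @ x') (y @ y'))"
  using assms by (simp add: T_def mult_single plus_list_def sg_append)

lemma T_append:
  assumes "length x = length y"
  shows "T (x @ x') (y @ y') = scale (\<sigma> (deg y - deg x) (deg x')) (T x y * T x' y')"
  using assms by (simp add: T_mult)

lemma T_Nil: "T [] [] = 1"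
  using single_one[where ?'a = "('i \<times> 'i) list"] unfolding zero_list_def by (simp add: T_def)

lemma single_word: "Poly_Mapping.single w c = scale (c / sg (map fst w) (map snd w)) (T (map fst w) (map snd w))"
  by (simp add: T_def zip_map_fst_snd)

lemma free_gen_T: "free_gen i k = scale (1 / \<sigma> (\<eta> k - \<eta> i) (\<eta> k)) (T [i] [k])"
  by (simp add: T_def free_gen_def)

lemma word_degree_zip: "length x = length y \<Longrightarrow> word_degree \<eta> (zip x y) = deg y - deg x"
  by (induction x y rule: list_induct2) (simp_all add: word_degree_def)

definition letters :: "('i \<times> 'i) list set" where
  "letters = lists (I \<times> I)"

lemma carrier_F: "carrier F = {p. Poly_Mapping.keys p \<subseteq> letters}"
  by (simp add: free_galgebra_def letters_def)

lemma zip_letters: "\<lbrakk>set x \<subseteq> I; set y \<subseteq> I\<rbrakk> \<Longrightarrow> zip x y \<in> letters"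
  by (auto simp: letters_def dest: set_zip_leftD set_zip_rightD)

lemma letters_unzip: "w \<in> letters \<Longrightarrow> set (map fst w) \<subseteq> I \<and> set (map snd w) \<subseteq> I"
  by (auto simp: letters_def)

lemma T_carrier [simp]: "\<lbrakk>set x \<subseteq> I; set y \<subseteq> I\<rbrakk> \<Longrightarrow> T x y \<in> carrier F"
  by (simp add: T_def carrier_F zip_letters)

lemma F_simps [simp]:
  "p \<otimes>\<^bsub>F\<^esub> q = p * q" "\<one>\<^bsub>F\<^esub> = 1" "\<zero>\<^bsub>F\<^esub> = 0" "p \<oplus>\<^bsub>F\<^esub> q = p + q" "c \<odot>\<^bsub>F\<^esub> p = scale c p"
  by (simp_all add: free_galgebra_def)

lemma carrier_F_subspace: "pm.subspace (carrier F)"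
proof -
  have "carrier F = {p. \<forall>w. w \<notin> letters \<longrightarrow> Poly_Mapping.lookup p w = 0}"
    by (auto simp: carrier_F in_keys_iff)
  then show ?thesis
    by (auto simp: pm.subspace_def lookup_add)
qed

lemma carrier_F_mult: "\<lbrakk>p \<in> carrier F; q \<in> carrier F\<rbrakk> \<Longrightarrow> p * q \<in> carrier F"
  using keys_mult[of p q] by (fastforce simp: carrier_F letters_def plus_list_def)

lemmas carrier_F_closed =
  pm.subspace_0[OF carrier_F_subspace] pm.subspace_add[OF carrier_F_subspace]
  pm.subspace_scale[OF carrier_F_subspace] pm.subspace_diff[OF carrier_F_subspace]
  pm.subspace_neg[OF carrier_F_subspace] pm.subspace_sum[OF carrier_F_subspace] carrier_F_mult

lemma carrier_F_one [simp]: "1 \<in> carrier F"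
  using T_carrier[of "[]" "[]"] by (simp add: T_Nil)

lemma ring_F: "ring F"
proof (rule ringI)
  show "abelian_group F"
  proof (rule abelian_groupI)
    fix p assume "p \<in> carrier F"
    then show "\<exists>q\<in>carrier F. q \<oplus>\<^bsub>F\<^esub> p = \<zero>\<^bsub>F\<^esub>"
      using carrier_F_closed(5) by (intro bexI[of _ "- p"]) simp_all
  qed (simp_all add: carrier_F_closed(2) carrier_F_closed(1) add.assoc add.commute)
  show "Group.monoid F"
    by (rule monoidI) (simp_all add: carrier_F_mult mult.assoc)
qed (simp_all add: algebra_simps)

text \<open>The monomials in the step are required to occur in \<open>p\<close>, so that homogeneous
  elements get an induction through monomials of their own degree.\<close>

lemma carrier_F_induct_keys:
  assumes "p \<in> carrier F" "P 0"
    and "\<And>c x y q. \<lbrakk>length x = length y; set x \<subseteq> I; set y \<subseteq> I; zip x y \<in> Poly_Mapping.keys p; q \<in> carrier F; P q\<rbrakk>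
      \<Longrightarrow> P (scale c (T x y) + q)"
  shows "P p"
proof -
  have "P (\<Sum>w\<in>S. Poly_Mapping.single w (Poly_Mapping.lookup p w)) \<and> (\<Sum>w\<in>S. Poly_Mapping.single w (Poly_Mapping.lookup p w)) \<in> carrier F"
    if "finite S" "S \<subseteq> Poly_Mapping.keys p" for S
    using that
  proof (induction S rule: finite_induct)
    case empty
    then show ?case using assms carrier_F_closed by simp
  next
    case (insert w S)
    then have w: "w \<in> letters" "set (map fst w) \<subseteq> I \<and> set (map snd w) \<subseteq> I"
      using assms(1) letters_unzip[of w] by (auto simp: carrier_F)
    from insert have "P (scale (Poly_Mapping.lookup p w / sg (map fst w) (map snd w)) (T (map fst w) (map snd w)) +
       (\<Sum>w\<in>S. Poly_Mapping.single w (Poly_Mapping.lookup p w)))"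
      using w by (intro assms(3)) (auto simp: zip_map_fst_snd)
    moreover have "Poly_Mapping.single w (Poly_Mapping.lookup p w) + (\<Sum>w\<in>S. Poly_Mapping.single w (Poly_Mapping.lookup p w)) \<in> carrier F"
      using insert w by (intro carrier_F_closed(2)) (auto simp: carrier_F)
    ultimately show ?case
      using insert single_word[of w "Poly_Mapping.lookup p w"] by simp
  qed
  from this[of "Poly_Mapping.keys p"] show ?thesis
    using lin_single_expand[of p] by (simp add: lin_def)
qed

lemma carrier_F_induct [consumes 1, case_names zero step]:
  assumes "p \<in> carrier F" "P 0"
    and "\<And>c x y q. \<lbrakk>length x = length y; set x \<subseteq> I; set y \<subseteq> I; q \<in> carrier F; P q\<rbrakk> \<Longrightarrow> P (scale c (T x y) + q)"
  shows "P p"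
  using carrier_F_induct_keys[of p P] assms by blast

section \<open>The defining ideal as a span of relators\<close>

definition relator ::
  "'i list \<Rightarrow> 'i list \<Rightarrow> 'i \<Rightarrow> 'i \<Rightarrow> 'i \<Rightarrow> 'i \<Rightarrow> 'i list \<Rightarrow> 'i list \<Rightarrow> ('i \<times> 'i) list \<Rightarrow>\<^sub>0 'k" where
  "relator s' s i j k l r' r =
    (\<Sum>a\<in>I. \<Sum>b\<in>I. scale (C i j a b) (T (s' @ a # b # r') (s @ k # l # r))) -
    (\<Sum>a\<in>I. \<Sum>b\<in>I. scale (C a b k l) (T (s' @ i # j # r') (s @ a # b # r)))"

definition relator_index :: "'i list \<Rightarrow> 'i list \<Rightarrow> 'i \<Rightarrow> 'i \<Rightarrow> 'i \<Rightarrow> 'i \<Rightarrow> 'i list \<Rightarrow> 'i list \<Rightarrow> bool" where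
  "relator_index s' s i j k l r' r \<longleftrightarrow> length s' = length s \<and> length r' = length r \<and>
    set s' \<subseteq> I \<and> set s \<subseteq> I \<and> set r' \<subseteq> I \<and> set r \<subseteq> I \<and> i \<in> I \<and> j \<in> I \<and> k \<in> I \<and> l \<in> I"

text \<open>A relator is an entry of \<open>C T - T C\<close> placed between outer words.
  Concatenation costs signs that depend on degrees only, and since \<open>C\<close> preserves degree
  all summands receive the same sign, which comes out in front.\<close>

lemma relator_factor:
  assumes "relator_index s' s i j k l r' r"
  shows "relator s' s i j k l r' r =
    scale (\<sigma> (deg s - deg s') (\<eta> i + \<eta> j + deg r') * \<sigma> (\<eta> k + \<eta> l - \<eta> i - \<eta> j) (deg r'))
      (T s' s * relator [] [] i j k l [] [] * T r' r)"
    (is "_ = scale ?c _")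
proof -
  have 1: "scale (C i j a b) (T (s' @ a # b # r') (s @ k # l # r)) =
     scale ?c (T s' s * scale (C i j a b) (T [a, b] [k, l]) * T r' r)" if "a \<in> I" "b \<in> I" for a b
  proof (cases "C i j a b = 0")
    case False
    then have e: "\<eta> a + \<eta> b = \<eta> i + \<eta> j"
      using C_zero[of i j a b] assms that by (force simp: relator_index_def)
    then have e': "\<eta> a + (\<eta> b + x) = \<eta> i + (\<eta> j + x)" for x
      by (metis add.assoc)
    have "T (s' @ a # b # r') (s @ k # l # r) = scale ?c (T s' s * (T [a, b] [k, l] * T r' r))"
      using T_append[of s' s "a # b # r'" "k # l # r"] T_append[of "[a, b]" "[k, l]" r' r] assms
      by (simp add: relator_index_def scale_mult_right e e' diff_diff_eq add.assoc)
    then show ?thesis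
      by (simp add: scale_mult_left scale_mult_right mult.assoc mult.commute)
  qed simp
  have 2: "scale (C a b k l) (T (s' @ i # j # r') (s @ a # b # r)) =
     scale ?c (T s' s * scale (C a b k l) (T [i, j] [a, b]) * T r' r)" if "a \<in> I" "b \<in> I" for a b
  proof (cases "C a b k l = 0")
    case False
    then have e: "\<eta> a + \<eta> b = \<eta> k + \<eta> l"
      using C_zero[of a b k l] assms that by (force simp: relator_index_def)
    have "T (s' @ i # j # r') (s @ a # b # r) = scale ?c (T s' s * (T [i, j] [a, b] * T r' r))"
      using T_append[of s' s "i # j # r'" "a # b # r"] T_append[of "[i, j]" "[a, b]" r' r] assms
      by (simp add: relator_index_def scale_mult_right e diff_diff_eq add.assoc)
    then show ?thesis
      by (simp add: scale_mult_left scale_mult_right mult.assoc mult.commute)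
  qed simp
  show ?thesis
    unfolding relator_def append_Nil ring_distribs sum_distrib_left sum_distrib_right
      pm.scale_right_diff_distrib pm.scale_sum_right
    by (intro arg_cong2[of _ _ _ _ minus] sum.cong[OF refl] 1 2)
qed

definition J :: "(('i \<times> 'i) list \<Rightarrow>\<^sub>0 'k) set" where
  "J = AR_ideal \<sigma> I \<eta> R"

lemma \<sigma>_cancel:
  "\<sigma> \<alpha> \<gamma> * (\<sigma> \<beta> \<gamma> * (\<sigma> \<gamma> \<alpha> * \<sigma> \<gamma> \<beta>)) = 1"
  "\<sigma> \<gamma> \<alpha> * (\<sigma> \<gamma> \<beta> * (\<sigma> \<alpha> \<gamma> * \<sigma> \<beta> \<gamma>)) = 1"
proof -
  have "\<sigma> \<alpha> \<gamma> * (\<sigma> \<beta> \<gamma> * (\<sigma> \<gamma> \<alpha> * \<sigma> \<gamma> \<beta>)) = (\<sigma> \<alpha> \<gamma> * \<sigma> \<gamma> \<alpha>) * (\<sigma> \<beta> \<gamma> * \<sigma> \<gamma> \<beta>)"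
    "\<sigma> \<gamma> \<alpha> * (\<sigma> \<gamma> \<beta> * (\<sigma> \<alpha> \<gamma> * \<sigma> \<beta> \<gamma>)) = (\<sigma> \<gamma> \<alpha> * \<sigma> \<alpha> \<gamma>) * (\<sigma> \<gamma> \<beta> * \<sigma> \<beta> \<gamma>)"
    by (simp_all only: mult_ac)
  then show "\<sigma> \<alpha> \<gamma> * (\<sigma> \<beta> \<gamma> * (\<sigma> \<gamma> \<alpha> * \<sigma> \<gamma> \<beta>)) = 1"
    "\<sigma> \<gamma> \<alpha> * (\<sigma> \<gamma> \<beta> * (\<sigma> \<alpha> \<gamma> * \<sigma> \<beta> \<gamma>)) = 1"
    by (simp_all add: \<sigma>_sym)
qed

text \<open>The indices \<open>i\<close> and \<open>j\<close> change places because \<open>C\<close>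
  contains the flip. The constant is the quotient of the two normalisations after homogeneity has
  eliminated \<open>\<eta> b\<close>; what is left does not involve \<open>a\<close>, so one unit
  serves the whole relation.\<close>

lemma AR_relation_relator:
  assumes I: "i \<in> I" "j \<in> I" "k \<in> I" "l \<in> I"
  shows "scale (\<sigma> (\<eta> i) (\<eta> j) * \<sigma> (\<eta> k) (\<eta> k) * \<sigma> (\<eta> k) (\<eta> i + \<eta> j) * \<sigma> (\<eta> l - \<eta> i - \<eta> j) (\<eta> l) * \<sigma> (\<eta> j - \<eta> l) (\<eta> k))
    ((\<Sum>a\<in>I. \<Sum>b\<in>I. scale (\<sigma> (\<eta> j - \<eta> l) (\<eta> a - \<eta> k) * R i j a b) (free_gen a k * free_gen b l)) -
     (\<Sum>a\<in>I. \<Sum>b\<in>I. scale (\<sigma> (\<eta> j - \<eta> b) (\<eta> a - \<eta> k) * R a b k l) (free_gen j b * free_gen i a)))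
   = relator [] [] j i k l [] []" (is "scale ?c _ = _")
proof -
  have gen: "free_gen a b * free_gen c d = (Poly_Mapping.single [(a, b), (c, d)] 1 :: ('i \<times> 'i) list \<Rightarrow>\<^sub>0 'k)" for a b c d
    by (simp add: free_gen_def mult_single plus_list_def)
  have 1: "?c * (\<sigma> (\<eta> j - \<eta> l) (\<eta> a - \<eta> k) * R i j a b) = C j i a b * sg [a, b] [k, l]"
    if "a \<in> I" "b \<in> I" for a b
  proof (cases "R i j a b = 0")
    case False
    then have "\<eta> i + \<eta> j = \<eta> a + \<eta> b"
      using I that R_zero by blast
    then have e: "\<eta> b = \<eta> i + \<eta> j - \<eta> a"
      by (simp add: algebra_simps)
    show ?thesis
      by (simp add: C_def e \<sigma>_simps \<sigma>_sym \<sigma>_cancel field_simps)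
  qed (simp add: C_def)
  have 2: "?c * (\<sigma> (\<eta> j - \<eta> b) (\<eta> a - \<eta> k) * R a b k l) = C b a k l * sg [j, i] [b, a]"
    if "a \<in> I" "b \<in> I" for a b
  proof (cases "R a b k l = 0")
    case False
    then have "\<eta> a + \<eta> b = \<eta> k + \<eta> l"
      using I that R_zero by blast
    then have e: "\<eta> b = \<eta> k + \<eta> l - \<eta> a"
      by (simp add: algebra_simps)
    show ?thesis
      by (simp add: C_def e \<sigma>_simps \<sigma>_sym \<sigma>_cancel field_simps)
  qed (simp add: C_def)
  have "(\<Sum>a\<in>I. \<Sum>b\<in>I. scale (C a b k l) (T [j, i] [a, b])) = (\<Sum>a\<in>I. \<Sum>b\<in>I. scale (C b a k l) (T [j, i] [b, a]))"
    by (rule sum.swap)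
  then show ?thesis
    unfolding relator_def pm.scale_right_diff_distrib pm.scale_sum_right gen append_Nil
    by (auto intro!: arg_cong2[of _ _ _ _ minus] sum.cong simp: T_def 1 2 simp del: sg.simps)
qed

lemma relator_carrier:
  "relator_index s' s i j k l r' r \<Longrightarrow> relator s' s i j k l r' r \<in> carrier F"
  unfolding relator_def relator_index_def by (intro carrier_F_closed T_carrier) auto

definition relators :: "(('i \<times> 'i) list \<Rightarrow>\<^sub>0 'k) set" where
  "relators = {relator s' s i j k l r' r | s' s i j k l r' r. relator_index s' s i j k l r' r}"

lemma relators_carrier: "relators \<subseteq> carrier F"
  by (auto simp: relators_def relator_carrier)

lemma AR_relations_carrier: "AR_relations \<sigma> I \<eta> R \<subseteq> carrier F"
proof -
  have "free_gen a b \<in> carrier F" if "a \<in> I" "b \<in> I" for a b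
    using that by (simp add: free_gen_T carrier_F_closed)
  then show ?thesis
    unfolding AR_relations_def by (auto intro!: carrier_F_closed)
qed

lemma AR_relations_relators: "AR_relations \<sigma> I \<eta> R \<subseteq> pm.span relators"
proof
  fix p assume "p \<in> AR_relations \<sigma> I \<eta> R"
  then obtain i j k l where I: "i \<in> I" "j \<in> I" "k \<in> I" "l \<in> I" and p: "p =
     (\<Sum>a\<in>I. \<Sum>b\<in>I. scale (\<sigma> (\<eta> j - \<eta> l) (\<eta> a - \<eta> k) * R i j a b) (free_gen a k * free_gen b l)) -
     (\<Sum>a\<in>I. \<Sum>b\<in>I. scale (\<sigma> (\<eta> j - \<eta> b) (\<eta> a - \<eta> k) * R a b k l) (free_gen j b * free_gen i a))"
    unfolding AR_relations_def by blast
  have "relator [] [] j i k l [] [] \<in> pm.span relators"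
    using I by (intro pm.span_base) (force simp: relators_def relator_index_def)
  moreover obtain c where "c \<noteq> 0" "scale c p = relator [] [] j i k l [] []"
    using AR_relation_relator[OF I, folded p] by (metis \<sigma>_nz mult_eq_0_iff)
  then have "p = scale (1 / c) (relator [] [] j i k l [] [])"
    by (metis pm.scale_scale nonzero_divide_eq_eq pm.scale_one)
  ultimately show "p \<in> pm.span relators"
    by (simp add: pm.span_scale)
qed

text \<open>By \<open>relator_factor\<close>, multiplication by a monomial only lengthens the outer
  words, up to a unit. This is what makes the span of the relators an ideal.\<close>

lemma T_mult_relator:
  assumes "relator_index s' s i j k l r' r" "length x = length y" "set x \<subseteq> I" "set y \<subseteq> I"
  shows "T x y * relator s' s i j k l r' r \<in> pm.span relators"
    and "relator s' s i j k l r' r * T x y \<in> pm.span relators"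
proof -
  have 1: "relator_index (x @ s') (y @ s) i j k l r' r" "relator_index s' s i j k l (r' @ x) (r @ y)"
    using assms by (auto simp: relator_index_def)
  then have rel: "relator (x @ s') (y @ s) i j k l r' r \<in> relators" "relator s' s i j k l (r' @ x) (r @ y) \<in> relators"
    unfolding relators_def by blast+
  define c where "c = \<sigma> (deg (y @ s) - deg (x @ s')) (\<eta> i + \<eta> j + deg r') * \<sigma> (\<eta> k + \<eta> l - \<eta> i - \<eta> j) (deg r')"
  define c' where "c' = \<sigma> (deg s - deg s') (\<eta> i + \<eta> j + deg (r' @ x)) * \<sigma> (\<eta> k + \<eta> l - \<eta> i - \<eta> j) (deg (r' @ x))"
  have "T x y * relator s' s i j k l r' r \<in> range (\<lambda>d. scale d (T (x @ s') (y @ s) * relator [] [] i j k l [] [] * T r' r))"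
    using assms(2) unfolding relator_factor[OF assms(1)]
    by (auto simp: scale_mult_left scale_mult_right mult.assoc[symmetric] T_mult)
  also have "T (x @ s') (y @ s) * relator [] [] i j k l [] [] * T r' r = scale (1 / c) (relator (x @ s') (y @ s) i j k l r' r)"
    unfolding relator_factor[OF 1(1)] by (simp add: c_def)
  finally show "T x y * relator s' s i j k l r' r \<in> pm.span relators"
    using pm.span_base[OF rel(1)] by (auto simp del: pm.scale_scale intro!: pm.span_scale)
  have "relator s' s i j k l r' r * T x y \<in> range (\<lambda>d. scale d (T s' s * relator [] [] i j k l [] [] * T (r' @ x) (r @ y)))"
    using assms(1) unfolding relator_factor[OF assms(1)]
    by (auto simp: scale_mult_left scale_mult_right mult.assoc T_mult relator_index_def)
  also have "T s' s * relator [] [] i j k l [] [] * T (r' @ x) (r @ y) = scale (1 / c') (relator s' s i j k l (r' @ x) (r @ y))"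
    unfolding relator_factor[OF 1(2)] by (simp add: c'_def)
  finally show "relator s' s i j k l r' r * T x y \<in> pm.span relators"
    using pm.span_base[OF rel(2)] by (auto simp del: pm.scale_scale intro!: pm.span_scale)
qed

lemma span_relators_mult:
  assumes "p \<in> pm.span relators" "q \<in> carrier F"
  shows "q * p \<in> pm.span relators" "p * q \<in> pm.span relators"
proof -
  have g: "q * g \<in> pm.span relators \<and> g * q \<in> pm.span relators" if "g \<in> relators" for g
    using assms(2)
  proof (induction rule: carrier_F_induct)
    case (step c x y q)
    have "T x y * g \<in> pm.span relators" "g * T x y \<in> pm.span relators"
      using that step T_mult_relator by (auto simp: relators_def)
    then show ?case
      using step by (auto simp: ring_distribs scale_mult_left scale_mult_right intro!: pm.span_add pm.span_scale)
  qed (simp add: pm.span_zero)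
  have "q * p \<in> pm.span relators \<and> p * q \<in> pm.span relators"
    using assms(1)
  proof (induction rule: pm.span_induct_alt)
    case (step c x y)
    then show ?case
      using g by (auto simp: ring_distribs scale_mult_left scale_mult_right intro!: pm.span_add pm.span_scale)
  qed (simp add: pm.span_zero)
  then show "q * p \<in> pm.span relators" "p * q \<in> pm.span relators"
    by auto
qed

lemma span_relators_carrier: "pm.span relators \<subseteq> carrier F"
  by (rule pm.span_minimal[OF relators_carrier carrier_F_subspace])

lemma ideal_J: "ideal J F"
  unfolding J_def AR_ideal_def
  by (rule ring.genideal_ideal[OF ring_F AR_relations_carrier])

lemma uminus_F: "p \<in> carrier F \<Longrightarrow> \<ominus>\<^bsub>F\<^esub> p = - p"
  by (rule abelian_group.minus_equality[OF ring.is_abelian_group[OF ring_F]]) (simp_all add: carrier_F_closed)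

lemma J_subspace: "pm.subspace J"
proof -
  interpret ideal J F by (rule ideal_J)
  have "scale c p \<in> J" if "p \<in> J" for c p
  proof -
    have "scale c 1 \<otimes>\<^bsub>F\<^esub> p \<in> J"
      using that by (intro I_l_closed carrier_F_closed) simp_all
    then show ?thesis by (simp add: scale_mult_left)
  qed
  moreover have "p + q \<in> J" if "p \<in> J" "q \<in> J" for p q
    using that additive_subgroup.a_closed[OF is_additive_subgroup] by fastforce
  ultimately show ?thesis
    using additive_subgroup.zero_closed[OF is_additive_subgroup] by (simp add: pm.subspace_def)
qed

lemmas J_closed =
  pm.subspace_0[OF J_subspace] pm.subspace_add[OF J_subspace] pm.subspace_scale[OF J_subspace]
  pm.subspace_diff[OF J_subspace] pm.subspace_neg[OF J_subspace] pm.subspace_sum[OF J_subspace]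

lemma J_mult:
  assumes "p \<in> J" "q \<in> carrier F"
  shows "q * p \<in> J" "p * q \<in> J"
  using ideal.I_l_closed[OF ideal_J assms] ideal.I_r_closed[OF ideal_J assms] by simp_all

text \<open>Together with \<open>relators_J\<close> this identifies the generated ideal with a
  linear span. A linear map therefore descends to the quotient as soon as it respects the relators,
  without reference to products; see \<open>lin_J\<close>.\<close>

lemma J_span: "J \<subseteq> pm.span relators"
  unfolding J_def AR_ideal_def
proof (rule ring.genideal_minimal[OF ring_F _ AR_relations_relators])
  show "ideal (pm.span relators) F"
  proof (rule idealI[OF ring_F])
    show "subgroup (pm.span relators) (add_monoid F)"
    proof
      fix x assume x: "x \<in> pm.span relators"
      then have "x \<in> carrier F" using span_relators_carrier by auto
      have "inv\<^bsub>add_monoid F\<^esub> x = - x"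
        using uminus_F[OF \<open>x \<in> carrier F\<close>] by (simp add: a_inv_def)
      then show "inv\<^bsub>add_monoid F\<^esub> x \<in> pm.span relators"
        using x by (simp add: pm.span_neg)
    qed (use span_relators_carrier in \<open>auto intro: pm.span_add pm.span_zero\<close>)
  qed (simp_all add: span_relators_mult)
qed

lemma relators_J: "relators \<subseteq> J"
proof -
  have 1: "relator [] [] j i k l [] [] \<in> J" if "i \<in> I" "j \<in> I" "k \<in> I" "l \<in> I" for i j k l
  proof -
    have self: "AR_relations \<sigma> I \<eta> R \<subseteq> J"
      unfolding J_def AR_ideal_def by (rule ring.genideal_self[OF ring_F AR_relations_carrier])
    show ?thesis
      unfolding AR_relation_relator[OF that, symmetric]
      by (rule J_closed(3), rule subsetD[OF self]) (use that in \<open>unfold AR_relations_def, blast\<close>)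
  qed
  have "relator s' s i j k l r' r \<in> J" if "relator_index s' s i j k l r' r" for s' s i j k l r' r
    unfolding relator_factor[OF that] using that
    by (intro J_closed(3) J_mult 1 T_carrier) (auto simp: relator_index_def)
  then show ?thesis
    unfolding relators_def by blast
qed

lemma lin_J:
  assumes "vector_space s" "module.subspace s N" "\<And>g. g \<in> relators \<Longrightarrow> lin s f g \<in> N" "p \<in> J"
  shows "lin s f p \<in> N"
  using lin_span[OF assms(1) _ assms(2,3)] J_span assms(4) by blast

section \<open>The quotient algebra and formal coproducts\<close>

abbreviation A :: "((('i \<times> 'i) list \<Rightarrow>\<^sub>0 'k) set, 'k, 'g) galgebra" where
  "A \<equiv> AR_galgebra \<sigma> I \<eta> R"

definition pr :: "(('i \<times> 'i) list \<Rightarrow>\<^sub>0 'k) \<Rightarrow> (('i \<times> 'i) list \<Rightarrow>\<^sub>0 'k) set" where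
  "pr p = J +>\<^bsub>F\<^esub> p"

lemma pr_altdef: "pr p = {h + p | h. h \<in> J}"
  by (auto simp: pr_def a_r_coset_def')

lemma pr_eq_iff: "pr p = pr q \<longleftrightarrow> p - q \<in> J"
proof
  assume "pr p = pr q"
  moreover have "p \<in> pr p"
    using J_closed(1) by (force simp: pr_altdef)
  ultimately obtain h where "h \<in> J" "p = h + q"
    by (auto simp: pr_altdef)
  then show "p - q \<in> J" by simp
next
  assume *: "p - q \<in> J"
  have "h + p \<in> pr q" "h + q \<in> pr p" if "h \<in> J" for h
  proof -
    have "h + (p - q) \<in> J" "h - (p - q) \<in> J"
      using that * J_closed by auto
    moreover have "h + p = h + (p - q) + q" "h + q = h - (p - q) + p"
      by simp_all
    ultimately show "h + p \<in> pr q" "h + q \<in> pr p"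
      unfolding pr_altdef by blast+
  qed
  then show "pr p = pr q"
    by (auto simp: pr_altdef)
qed

lemma carrier_A: "carrier A = pr ` carrier F"
  by (auto simp: AR_galgebra_def Let_def FactRing_def A_RCOSETS_def' pr_def J_def a_r_coset_def')

lemma pr_carrier [simp]: "p \<in> carrier F \<Longrightarrow> pr p \<in> carrier A"
  by (simp add: carrier_A)

lemma A_mult: "\<lbrakk>p \<in> carrier F; q \<in> carrier F\<rbrakk> \<Longrightarrow> pr p \<otimes>\<^bsub>A\<^esub> pr q = pr (p * q)"
  using ideal.rcoset_mult_add[OF ideal_J] by (simp add: AR_galgebra_def Let_def FactRing_def pr_def J_def)

lemma A_add: "\<lbrakk>p \<in> carrier F; q \<in> carrier F\<rbrakk> \<Longrightarrow> pr p \<oplus>\<^bsub>A\<^esub> pr q = pr (p + q)"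
  using abelian_subgroup.a_rcos_sum[OF abelian_subgroupI3[OF ideal.axioms(1)[OF ideal_J] ring.is_abelian_group[OF ring_F]], of p q]
  by (simp add: AR_galgebra_def Let_def FactRing_def pr_def J_def)

lemma A_one: "\<one>\<^bsub>A\<^esub> = pr 1"
  by (simp add: AR_galgebra_def Let_def FactRing_def pr_def J_def)

lemma A_zero: "\<zero>\<^bsub>A\<^esub> = pr 0"
  by (simp add: AR_galgebra_def Let_def FactRing_def pr_altdef flip: J_def)

lemma A_smult: "c \<odot>\<^bsub>A\<^esub> pr p = pr (scale c p)"
proof -
  have *: "pr (scale c q) = pr (scale c p)" if q: "q \<in> pr p" for q
  proof -
    obtain h where "h \<in> J" "q = h + p"
      using q unfolding pr_altdef by blast
    then show ?thesis
      by (simp add: pr_eq_iff pm.scale_right_distrib J_closed(3))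
  qed
  have "p \<in> pr p"
    using J_closed(1) by (force simp: pr_altdef)
  moreover have "c \<odot>\<^bsub>A\<^esub> pr p = (\<Union>q\<in>pr p. pr (scale c q))"
    by (simp add: AR_galgebra_def Let_def pr_def J_def)
  moreover have "(\<Union>q\<in>pr p. pr (scale c q)) = (\<Union>q\<in>pr p. pr (scale c p))"
    by (rule SUP_cong) (simp_all add: *)
  ultimately show ?thesis
    by (simp only: UN_constant) auto
qed

lemma A_component: "component A \<gamma> = pr ` component F \<gamma>"
  by (simp add: AR_galgebra_def Let_def pr_def J_def)

lemma component_F: "component F \<gamma> = {p. Poly_Mapping.keys p \<subseteq> {w \<in> letters. word_degree \<eta> w = \<gamma>}}"
  by (simp add: free_galgebra_def letters_def)

lemma component_F_carrier: "p \<in> component F \<gamma> \<Longrightarrow> p \<in> carrier F"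
  by (auto simp: component_F carrier_F)

lemma component_A_carrier: "X \<in> component A \<gamma> \<Longrightarrow> X \<in> carrier A"
  by (auto simp: A_component component_F_carrier)

lemma component_F_subspace: "pm.subspace (component F \<gamma>)"
proof -
  have "component F \<gamma> = {p. \<forall>w. w \<notin> {w \<in> letters. word_degree \<eta> w = \<gamma>} \<longrightarrow> Poly_Mapping.lookup p w = 0}"
    by (auto simp: component_F in_keys_iff)
  then show ?thesis
    by (auto simp: pm.subspace_def lookup_add)
qed

lemma component_F_induct [consumes 1, case_names zero step]:
  assumes "p \<in> component F \<gamma>" "P 0"
    and "\<And>c x y q. \<lbrakk>length x = length y; set x \<subseteq> I; set y \<subseteq> I; deg y - deg x = \<gamma>; q \<in> carrier F; P q\<rbrakk> \<Longrightarrow> P (scale c (T x y) + q)"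
  shows "P p"
proof (rule carrier_F_induct_keys[of p P, OF component_F_carrier[OF assms(1)] assms(2)])
  fix c x y q assume *: "length x = length y" "set x \<subseteq> I" "set y \<subseteq> I" "zip x y \<in> Poly_Mapping.keys p" "q \<in> carrier F" "P q"
  then have "deg y - deg x = \<gamma>"
    using assms(1) by (auto simp: component_F word_degree_zip)
  then show "P (scale c (T x y) + q)"
    using * assms(3) by blast
qed

lemma T_component: "\<lbrakk>length x = length y; set x \<subseteq> I; set y \<subseteq> I\<rbrakk> \<Longrightarrow> T x y \<in> component F (deg y - deg x)"
  by (simp add: component_F T_def zip_letters word_degree_zip)

lemma pr_T_component: "\<lbrakk>length x = length y; set x \<subseteq> I; set y \<subseteq> I\<rbrakk> \<Longrightarrow> pr (T x y) \<in> component A (deg y - deg x)"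
  by (simp add: A_component T_component)

definition rep :: "(('i \<times> 'i) list \<Rightarrow>\<^sub>0 'k) set \<Rightarrow> ('i \<times> 'i) list \<Rightarrow>\<^sub>0 'k" where
  "rep X = (SOME p. p \<in> carrier F \<and> pr p = X)"

lemma rep: "X \<in> carrier A \<Longrightarrow> rep X \<in> carrier F \<and> pr (rep X) = X"
  unfolding rep_def carrier_A by (rule someI_ex) auto

lemma rep_pr: "p \<in> carrier F \<Longrightarrow> rep (pr p) - p \<in> J"
  using rep[of "pr p"] by (simp add: pr_eq_iff)

section \<open>Linear maps modulo a subspace\<close>

text \<open>The linear extension of \<open>T x y \<mapsto> K x y\<close>.\<close>

definition wlin :: "('k \<Rightarrow> 'v \<Rightarrow> 'v) \<Rightarrow> ('i list \<Rightarrow> 'i list \<Rightarrow> 'v) \<Rightarrow> (('i \<times> 'i) list \<Rightarrow>\<^sub>0 'k) \<Rightarrow> 'v::ab_group_add" where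
  "wlin s K = lin s (\<lambda>w. s (1 / sg (map fst w) (map snd w)) (K (map fst w) (map snd w)))"

text \<open>By \<open>wlin_relator\<close> this says that \<open>wlin s K\<close> sends every
  relator into \<open>N\<close>: the equation \<open>C T = T C\<close> holds modulo \<open>N\<close>
  with \<open>T\<close> replaced by \<open>K\<close>.\<close>

definition kills_relators :: "('k \<Rightarrow> 'v \<Rightarrow> 'v) \<Rightarrow> 'v set \<Rightarrow> ('i list \<Rightarrow> 'i list \<Rightarrow> 'v::ab_group_add) \<Rightarrow> bool" where
  "kills_relators s N K \<longleftrightarrow> (\<forall>s' s0 i j k l r' r. relator_index s' s0 i j k l r' r \<longrightarrow>
    (\<Sum>a\<in>I. \<Sum>b\<in>I. s (C i j a b) (K (s' @ a # b # r') (s0 @ k # l # r))) -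
    (\<Sum>a\<in>I. \<Sum>b\<in>I. s (C a b k l) (K (s' @ i # j # r') (s0 @ a # b # r))) \<in> N)"

definition lin_mod ::
  "('k \<Rightarrow> 'v \<Rightarrow> 'v) \<Rightarrow> 'v set \<Rightarrow> ((('i \<times> 'i) list \<Rightarrow>\<^sub>0 'k) set \<Rightarrow> 'v::ab_group_add) \<Rightarrow> bool" where
  "lin_mod s N \<phi> \<longleftrightarrow> (\<forall>c. \<forall>p\<in>carrier F. \<forall>q\<in>carrier F.
    \<phi> (pr (scale c p + q)) - (s c (\<phi> (pr p)) + \<phi> (pr q)) \<in> N)"

end

text \<open>Stands for the target space \<open>V / N\<close> without forming it. The instances are
  the scalars modulo \<open>{0}\<close>, the free algebra modulo \<open>J\<close>, and formal
  combinations of pairs modulo the relations of the tensor product.\<close>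

locale yb_target = graded_yb \<sigma> I \<eta> R
  for \<sigma> :: "'g::ab_group_add \<Rightarrow> 'g \<Rightarrow> 'k::field_char_0" and I :: "'i set" and \<eta> R +
  fixes s :: "'k \<Rightarrow> 'v::ab_group_add \<Rightarrow> 'v" and N :: "'v set"
  assumes vs: "vector_space s" and N: "module.subspace s N"
begin

sublocale V: vector_space s by (rule vs)

lemmas N_closed = V.subspace_0[OF N] V.subspace_add[OF N] V.subspace_scale[OF N] V.subspace_diff[OF N]
  V.subspace_neg[OF N] V.subspace_sum[OF N]

lemma N_trans: "\<lbrakk>u - v \<in> N; v - w \<in> N\<rbrakk> \<Longrightarrow> u - w \<in> N"
  using N_closed(2)[of "u - v" "v - w"] by simp

lemma N_sym: "u - v \<in> N \<Longrightarrow> v - u \<in> N"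
  using N_closed(5)[of "u - v"] by simp

lemma N_sum_cong: "(\<And>x. x \<in> S \<Longrightarrow> f x - g x \<in> N) \<Longrightarrow> (\<Sum>x\<in>S. f x) - (\<Sum>x\<in>S. g x) \<in> N"
  using N_closed(6)[of S "\<lambda>x. f x - g x"] by (simp add: sum_subtractf)

lemma N_sum_list_cong: "(\<And>x. x \<in> set xs \<Longrightarrow> f x - g x \<in> N) \<Longrightarrow> (\<Sum>x\<leftarrow>xs. f x) - (\<Sum>x\<leftarrow>xs. g x) \<in> N"
proof (induction xs)
  case (Cons a xs)
  then have "(f a - g a) + ((\<Sum>x\<leftarrow>xs. f x) - (\<Sum>x\<leftarrow>xs. g x)) \<in> N"
    by (intro N_closed(2)) auto
  then show ?case by (simp add: algebra_simps)
qed (simp add: N_closed)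

lemma wlin_T [simp]: "length x = length y \<Longrightarrow> wlin s K (T x y) = K x y"
  by (simp add: wlin_def T_def lin_single[OF vs])

lemmas wlin_linear =
  lin_add[OF vs, where f = "\<lambda>w. s (1 / sg (map fst w) (map snd w)) (K (map fst w) (map snd w))" for K, folded wlin_def]
  lin_scale[OF vs, where f = "\<lambda>w. s (1 / sg (map fst w) (map snd w)) (K (map fst w) (map snd w))" for K, folded wlin_def]
  lin_diff[OF vs, where f = "\<lambda>w. s (1 / sg (map fst w) (map snd w)) (K (map fst w) (map snd w))" for K, folded wlin_def]
  lin_sum[OF vs, where f = "\<lambda>w. s (1 / sg (map fst w) (map snd w)) (K (map fst w) (map snd w))" for K, folded wlin_def]
  lin_0[OF vs, where f = "\<lambda>w. s (1 / sg (map fst w) (map snd w)) (K (map fst w) (map snd w))" for K, folded wlin_def]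

lemma wlin_sum: "wlin s (\<lambda>x y. \<Sum>z\<in>S. K z x y) p = (\<Sum>z\<in>S. wlin s (K z) p)"
  by (simp add: wlin_def V.scale_sum_right lin_fun_sum[OF vs])

lemma wlin_sum_list: "wlin s (\<lambda>x y. \<Sum>z\<leftarrow>zs. K z x y) p = (\<Sum>z\<leftarrow>zs. wlin s (K z) p)"
proof (induction zs)
  case Nil
  then show ?case by (simp add: wlin_def lin_def)
next
  case (Cons a zs)
  then show ?case by (simp add: wlin_def V.scale_right_distrib lin_fun_add[OF vs])
qed

lemma wlin_cong_mod:
  assumes "p \<in> carrier F" "\<And>x y. \<lbrakk>length x = length y; set x \<subseteq> I; set y \<subseteq> I\<rbrakk> \<Longrightarrow> K x y - L x y \<in> N"
  shows "wlin s K p - wlin s L p \<in> N"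
proof -
  have "lin s (\<lambda>w. s (1 / sg (map fst w) (map snd w)) (K (map fst w) (map snd w)) -
      s (1 / sg (map fst w) (map snd w)) (L (map fst w) (map snd w))) p \<in> N"
  proof (rule lin_mem[OF vs N])
    fix w assume "w \<in> Poly_Mapping.keys p"
    then have "set (map fst w) \<subseteq> I \<and> set (map snd w) \<subseteq> I"
      using assms(1) by (intro letters_unzip) (auto simp: carrier_F)
    then show "s (1 / sg (map fst w) (map snd w)) (K (map fst w) (map snd w)) -
      s (1 / sg (map fst w) (map snd w)) (L (map fst w) (map snd w)) \<in> N"
      using assms(2) by (simp flip: V.scale_right_diff_distrib add: N_closed)
  qed
  then show ?thesis
    by (simp add: wlin_def lin_fun_diff[OF vs])
qed

lemma wlin_relator:
  assumes "relator_index s' s0 i j k l r' r"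
  shows "wlin s K (relator s' s0 i j k l r' r) =
    (\<Sum>a\<in>I. \<Sum>b\<in>I. s (C i j a b) (K (s' @ a # b # r') (s0 @ k # l # r))) -
    (\<Sum>a\<in>I. \<Sum>b\<in>I. s (C a b k l) (K (s' @ i # j # r') (s0 @ a # b # r)))"
  using assms by (simp add: relator_def wlin_linear relator_index_def)

lemma wlin_J:
  assumes "kills_relators s N K" "p \<in> J"
  shows "wlin s K p \<in> N"
  unfolding wlin_def
  by (rule lin_J[OF vs N _ assms(2)], fold wlin_def)
    (use assms(1) in \<open>auto simp: relators_def wlin_relator kills_relators_def\<close>)

lemma lin_mod_zero: "lin_mod s N \<phi> \<Longrightarrow> \<phi> (pr 0) \<in> N"
proof -
  assume "lin_mod s N \<phi>"
  then have "\<phi> (pr (scale 1 0 + 0)) - (s 1 (\<phi> (pr 0)) + \<phi> (pr 0)) \<in> N"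
    unfolding lin_mod_def using carrier_F_closed(1) by blast
  then show ?thesis
    using N_closed(5) by fastforce
qed

lemma lin_mod_wlin:
  assumes "lin_mod s N \<phi>" "p \<in> carrier F"
  shows "\<phi> (pr p) - wlin s (\<lambda>x y. \<phi> (pr (T x y))) p \<in> N"
  using assms(2)
proof (induction rule: carrier_F_induct)
  case zero
  then show ?case using lin_mod_zero[OF assms(1)] by (simp add: wlin_linear)
next
  case (step c x y q)
  have "\<phi> (pr (scale c (T x y) + q)) - (s c (\<phi> (pr (T x y))) + \<phi> (pr q)) \<in> N"
    using assms(1) step by (simp add: lin_mod_def)
  then have "\<phi> (pr (scale c (T x y) + q)) - (s c (\<phi> (pr (T x y))) + \<phi> (pr q)) +
     (\<phi> (pr q) - wlin s (\<lambda>x y. \<phi> (pr (T x y))) q) \<in> N"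
    using step by (intro N_closed(2))
  then show ?case
    using step by (simp add: wlin_linear algebra_simps)
qed

text \<open>A map that is already defined on the quotient sees a relator as 0. This converse of
  \<open>wlin_J\<close> is what moves \<open>C\<close> across one tensor leg of a coproduct.\<close>

lemma lin_mod_kills:
  assumes "lin_mod s N \<phi>"
  shows "kills_relators s N (\<lambda>x y. \<phi> (pr (T x y)))"
  unfolding kills_relators_def
proof (intro allI impI)
  fix s' s0 i j k l r' r assume idx: "relator_index s' s0 i j k l r' r"
  let ?g = "relator s' s0 i j k l r' r"
  have g: "?g \<in> J" "?g \<in> carrier F"
    using idx relators_J relator_carrier unfolding relators_def by blast+
  then have "pr ?g = pr 0" by (simp add: pr_eq_iff)
  then have "\<phi> (pr ?g) \<in> N"
    using lin_mod_zero[OF assms] by simp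
  then have "wlin s (\<lambda>x y. \<phi> (pr (T x y))) ?g \<in> N"
    using lin_mod_wlin[OF assms g(2)] N_closed(4)[of "\<phi> (pr ?g)"] by fastforce
  then show "(\<Sum>a\<in>I. \<Sum>b\<in>I. s (C i j a b) (\<phi> (pr (T (s' @ a # b # r') (s0 @ k # l # r))))) -
    (\<Sum>a\<in>I. \<Sum>b\<in>I. s (C a b k l) (\<phi> (pr (T (s' @ i # j # r') (s0 @ a # b # r))))) \<in> N"
    using idx by (simp add: wlin_relator)
qed

lemma wlin_rep:
  assumes "kills_relators s N K" "p \<in> carrier F"
  shows "wlin s K (rep (pr p)) - wlin s K p \<in> N"
  using wlin_J[OF assms(1) rep_pr[OF assms(2)]] by (simp add: wlin_linear)

end

context graded_yb
begin

sublocale scalar: yb_target \<sigma> I \<eta> R "(*)" "{0 :: 'k}"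
proof (intro yb_target.intro yb_target_axioms.intro graded_yb_axioms)
  show vs: "vector_space ((*) :: 'k \<Rightarrow> 'k \<Rightarrow> 'k)" by (rule vector_space_field)
  show "module.subspace (*) {0 :: 'k}"
    using vs by (simp add: module.subspace_def module_iff_vector_space)
qed

declare scalar.V.scale_scale [simp del]

sublocale modulo_J: yb_target \<sigma> I \<eta> R scale J
  by (intro yb_target.intro yb_target_axioms.intro graded_yb_axioms pm.vector_space_axioms J_subspace)

text \<open>Multiplication of the component of degree \<open>\<gamma>\<close> by \<open>\<chi> \<gamma>\<close>; it absorbs the signs depending on the degree of a factor.\<close>

definition twist :: "('g \<Rightarrow> 'k) \<Rightarrow> (('i \<times> 'i) list \<Rightarrow>\<^sub>0 'k) set \<Rightarrow> (('i \<times> 'i) list \<Rightarrow>\<^sub>0 'k) set" where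
  "twist \<chi> X = pr (wlin scale (\<lambda>x y. scale (\<chi> (deg y - deg x)) (T x y)) (rep X))"

lemma wlin_carrier:
  assumes "p \<in> carrier F" "\<And>x y. \<lbrakk>length x = length y; set x \<subseteq> I; set y \<subseteq> I\<rbrakk> \<Longrightarrow> K x y \<in> carrier F"
  shows "wlin scale K p \<in> carrier F"
  using assms(1)
  by (induction rule: carrier_F_induct) (simp_all add: modulo_J.wlin_linear carrier_F_closed assms(2))

text \<open>Relators are homogeneous: since \<open>C\<close> preserves degree, all their terms have
  degree \<open>?\<delta>\<close>, so the rescaling multiplies a whole relator by one scalar and
  descends to the quotient.\<close>

lemma twist_kills: "kills_relators scale J (\<lambda>x y. scale (\<chi> (deg y - deg x)) (T x y))"
  unfolding kills_relators_def
proof (intro allI impI)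
  fix s' s i j k l r' r assume idx: "relator_index s' s i j k l r' r"
  let ?\<delta> = "\<eta> k + \<eta> l + deg s + deg r - (\<eta> i + \<eta> j + deg s' + deg r')"
  have 1: "scale (C i j a b) (scale (\<chi> (deg (s @ k # l # r) - deg (s' @ a # b # r'))) (T (s' @ a # b # r') (s @ k # l # r)))
     = scale (\<chi> ?\<delta>) (scale (C i j a b) (T (s' @ a # b # r') (s @ k # l # r)))" if "a \<in> I" "b \<in> I" for a b
  proof (cases "C i j a b = 0")
    case False
    then have "\<eta> i + \<eta> j = \<eta> a + \<eta> b"
      using C_zero[of i j a b] idx that by (auto simp: relator_index_def)
    then have "\<eta> a + (\<eta> b + \<alpha>) = \<eta> i + (\<eta> j + \<alpha>)" for \<alpha>
      by (simp flip: add.assoc)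
    then have "deg (s @ k # l # r) - deg (s' @ a # b # r') = ?\<delta>"
      by (simp add: algebra_simps)
    then show ?thesis by (simp add: mult.commute del: deg_simps)
  qed simp
  have 2: "scale (C a b k l) (scale (\<chi> (deg (s @ a # b # r) - deg (s' @ i # j # r'))) (T (s' @ i # j # r') (s @ a # b # r)))
     = scale (\<chi> ?\<delta>) (scale (C a b k l) (T (s' @ i # j # r') (s @ a # b # r)))" if "a \<in> I" "b \<in> I" for a b
  proof (cases "C a b k l = 0")
    case False
    then have "\<eta> a + \<eta> b = \<eta> k + \<eta> l"
      using C_zero[of a b k l] idx that by (auto simp: relator_index_def)
    then have "\<eta> a + (\<eta> b + \<alpha>) = \<eta> k + (\<eta> l + \<alpha>)" for \<alpha>
      by (simp flip: add.assoc)
    then have "deg (s @ a # b # r) - deg (s' @ i # j # r') = ?\<delta>"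
      by (simp add: algebra_simps)
    then show ?thesis by (simp add: mult.commute del: deg_simps)
  qed simp
  have "(\<Sum>a\<in>I. \<Sum>b\<in>I. scale (C i j a b) (scale (\<chi> (deg (s @ k # l # r) - deg (s' @ a # b # r'))) (T (s' @ a # b # r') (s @ k # l # r)))) -
    (\<Sum>a\<in>I. \<Sum>b\<in>I. scale (C a b k l) (scale (\<chi> (deg (s @ a # b # r) - deg (s' @ i # j # r'))) (T (s' @ i # j # r') (s @ a # b # r))))
    = scale (\<chi> ?\<delta>) (relator s' s i j k l r' r)"
    unfolding relator_def pm.scale_right_diff_distrib pm.scale_sum_right
    by (intro arg_cong2[of _ _ _ _ minus] sum.cong[OF refl] 1 2)
  also have "\<dots> \<in> J"
    using idx relators_J unfolding relators_def by (intro J_closed(3)) blast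
  finally show "(\<Sum>a\<in>I. \<Sum>b\<in>I. scale (C i j a b) (scale (\<chi> (deg (s @ k # l # r) - deg (s' @ a # b # r'))) (T (s' @ a # b # r') (s @ k # l # r)))) -
    (\<Sum>a\<in>I. \<Sum>b\<in>I. scale (C a b k l) (scale (\<chi> (deg (s @ a # b # r) - deg (s' @ i # j # r'))) (T (s' @ i # j # r') (s @ a # b # r)))) \<in> J" .
qed

lemma twist_pr:
  assumes "p \<in> carrier F"
  shows "twist \<chi> (pr p) = pr (wlin scale (\<lambda>x y. scale (\<chi> (deg y - deg x)) (T x y)) p)"
  unfolding twist_def pr_eq_iff by (rule modulo_J.wlin_rep[OF twist_kills assms])

lemma twist_component:
  assumes "X \<in> component A \<gamma>"
  shows "twist \<chi> X = \<chi> \<gamma> \<odot>\<^bsub>A\<^esub> X"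
proof -
  obtain p where p: "p \<in> component F \<gamma>" "X = pr p"
    using assms by (auto simp: A_component)
  have "wlin scale (\<lambda>x y. scale (\<chi> (deg y - deg x)) (T x y)) p
     = lin scale (\<lambda>w. scale (\<chi> \<gamma>) (Poly_Mapping.single w 1)) p"
    unfolding wlin_def
  proof (rule lin_cong[OF pm.vector_space_axioms])
    fix w assume "w \<in> Poly_Mapping.keys p"
    then have "word_degree \<eta> w = \<gamma>"
      using p by (auto simp: component_F)
    then have "deg (map snd w) - deg (map fst w) = \<gamma>"
      using word_degree_zip[of "map fst w" "map snd w"] by (simp add: zip_map_fst_snd)
    then show "scale (1 / sg (map fst w) (map snd w)) (scale (\<chi> (deg (map snd w) - deg (map fst w))) (T (map fst w) (map snd w)))
      = scale (\<chi> \<gamma>) (Poly_Mapping.single w 1)"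
      by (simp add: T_def zip_map_fst_snd)
  qed
  also have "\<dots> = scale (\<chi> \<gamma>) p"
    by (subst lin_fun_scale[OF pm.vector_space_axioms]) (simp add: lin_single_expand)
  finally show ?thesis
    using p by (simp add: twist_pr component_F_carrier A_smult)
qed

lemma twist_carrier: "X \<in> carrier A \<Longrightarrow> twist \<chi> X \<in> carrier A"
  unfolding twist_def by (intro pr_carrier wlin_carrier) (auto simp: rep carrier_F_closed)

text \<open>Stated through representatives, in the shape of \<open>lin_mod\<close>, so that
  composing with such a map preserves \<open>lin_mod\<close>.\<close>

definition A_linear :: "((('i \<times> 'i) list \<Rightarrow>\<^sub>0 'k) set \<Rightarrow> (('i \<times> 'i) list \<Rightarrow>\<^sub>0 'k) set) \<Rightarrow> bool" where
  "A_linear f \<longleftrightarrow> (\<forall>c. \<forall>p\<in>carrier F. \<forall>q\<in>carrier F. \<exists>p'\<in>carrier F. \<exists>q'\<in>carrier F.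
    f (pr p) = pr p' \<and> f (pr q) = pr q' \<and> f (pr (scale c p + q)) = pr (scale c p' + q'))"

lemma A_linear_carrier: "\<lbrakk>A_linear f; X \<in> carrier A\<rbrakk> \<Longrightarrow> f X \<in> carrier A"
  unfolding A_linear_def carrier_A by blast

lemma A_linear_twist: "A_linear (twist \<chi>)"
  unfolding A_linear_def
proof (intro allI ballI)
  fix c p q assume "p \<in> carrier F" "q \<in> carrier F"
  then show "\<exists>p'\<in>carrier F. \<exists>q'\<in>carrier F. twist \<chi> (pr p) = pr p' \<and> twist \<chi> (pr q) = pr q' \<and>
     twist \<chi> (pr (scale c p + q)) = pr (scale c p' + q')"
    by (intro bexI[of _ "wlin scale (\<lambda>x y. scale (\<chi> (deg y - deg x)) (T x y)) p"]
      bexI[of _ "wlin scale (\<lambda>x y. scale (\<chi> (deg y - deg x)) (T x y)) q"])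
    (simp_all add: twist_pr carrier_F_closed modulo_J.wlin_linear wlin_carrier)
qed

lemma A_linear_mult:
  assumes "X \<in> carrier A"
  shows "A_linear (\<lambda>Y. X \<otimes>\<^bsub>A\<^esub> Y)" "A_linear (\<lambda>Y. Y \<otimes>\<^bsub>A\<^esub> X)"
proof -
  obtain p where p: "p \<in> carrier F" "X = pr p"
    using assms by (auto simp: carrier_A)
  show "A_linear (\<lambda>Y. X \<otimes>\<^bsub>A\<^esub> Y)"
    unfolding A_linear_def
  proof (intro allI ballI)
    fix c q r assume "q \<in> carrier F" "r \<in> carrier F"
    then show "\<exists>p'\<in>carrier F. \<exists>q'\<in>carrier F. X \<otimes>\<^bsub>A\<^esub> pr q = pr p' \<and> X \<otimes>\<^bsub>A\<^esub> pr r = pr q' \<and>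
       X \<otimes>\<^bsub>A\<^esub> pr (scale c q + r) = pr (scale c p' + q')"
      by (intro bexI[of _ "p * q"] bexI[of _ "p * r"])
        (simp_all add: p A_mult carrier_F_closed ring_distribs scale_mult_right)
  qed
  show "A_linear (\<lambda>Y. Y \<otimes>\<^bsub>A\<^esub> X)"
    unfolding A_linear_def
  proof (intro allI ballI)
    fix c q r assume "q \<in> carrier F" "r \<in> carrier F"
    then show "\<exists>p'\<in>carrier F. \<exists>q'\<in>carrier F. pr q \<otimes>\<^bsub>A\<^esub> X = pr p' \<and> pr r \<otimes>\<^bsub>A\<^esub> X = pr q' \<and>
       pr (scale c q + r) \<otimes>\<^bsub>A\<^esub> X = pr (scale c p' + q')"
      by (intro bexI[of _ "q * p"] bexI[of _ "r * p"])
        (simp_all add: p A_mult carrier_F_closed ring_distribs scale_mult_left)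
  qed
qed

text \<open>The coproduct, with values represented by formal combinations of pairs.\<close>

definition comult :: "(('i \<times> 'i) list \<Rightarrow>\<^sub>0 'k) \<Rightarrow>
    ((('i \<times> 'i) list \<Rightarrow>\<^sub>0 'k) set \<times> (('i \<times> 'i) list \<Rightarrow>\<^sub>0 'k) set) \<Rightarrow>\<^sub>0 'k" where
  "comult = wlin scale (\<lambda>x y. \<Sum>z\<in>tuples I (length x). Poly_Mapping.single (pr (T x z), pr (T z y)) 1)"

definition bilin_mod ::
  "('k \<Rightarrow> 'v \<Rightarrow> 'v) \<Rightarrow> 'v set \<Rightarrow> ((('i \<times> 'i) list \<Rightarrow>\<^sub>0 'k) set \<Rightarrow> (('i \<times> 'i) list \<Rightarrow>\<^sub>0 'k) set \<Rightarrow> 'v::ab_group_add) \<Rightarrow> bool" where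
  "bilin_mod s N \<Phi> \<longleftrightarrow> (\<forall>X\<in>carrier A. lin_mod s N (\<Phi> X) \<and> lin_mod s N (\<lambda>Y. \<Phi> Y X))"

end

lemma sum_list_sum_swap: "(\<Sum>x\<leftarrow>xs. \<Sum>z\<in>S. f x z) = (\<Sum>z\<in>S. \<Sum>x\<leftarrow>xs. (f x z :: 'v::comm_monoid_add))"
  by (induction xs) (simp_all add: sum.distrib)

lemma sum_list_swap: "(\<Sum>x\<leftarrow>xs. \<Sum>z\<leftarrow>zs. f x z) = (\<Sum>z\<leftarrow>zs. \<Sum>x\<leftarrow>xs. (f x z :: 'v::comm_monoid_add))"
  by (induction xs) (simp_all add: sum_list_addf)

section \<open>Evaluating multilinear expressions on coproducts\<close>

context yb_target
begin

lemma lin_mod_comp: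
  assumes "lin_mod s N \<phi>" "A_linear f"
  shows "lin_mod s N (\<lambda>X. \<phi> (f X))"
  unfolding lin_mod_def
proof (intro allI ballI)
  fix c p q assume "p \<in> carrier F" "q \<in> carrier F"
  then obtain p' q' where "p' \<in> carrier F" "q' \<in> carrier F" "f (pr p) = pr p'" "f (pr q) = pr q'"
     "f (pr (scale c p + q)) = pr (scale c p' + q')"
    using assms(2) unfolding A_linear_def by meson
  then show "\<phi> (f (pr (scale c p + q))) - (s c (\<phi> (f (pr p))) + \<phi> (f (pr q))) \<in> N"
    using assms(1) by (simp add: lin_mod_def)
qed

lemma bilin_mod_comp:
  assumes "bilin_mod s N \<Phi>" "A_linear f" "A_linear g"
  shows "bilin_mod s N (\<lambda>X Y. \<Phi> (f X) (g Y))"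
  unfolding bilin_mod_def
proof (intro ballI conjI)
  fix X assume "X \<in> carrier A"
  then have X: "f X \<in> carrier A" "g X \<in> carrier A"
    using assms A_linear_carrier by blast+
  show "lin_mod s N (\<lambda>Y. \<Phi> (f X) (g Y))"
    by (rule lin_mod_comp[OF _ assms(3)]) (use assms(1) X in \<open>auto simp: bilin_mod_def\<close>)
  show "lin_mod s N (\<lambda>Y. \<Phi> (f Y) (g X))"
    by (rule lin_mod_comp[OF _ assms(2), of "\<lambda>Y. \<Phi> Y (g X)"]) (use assms(1) X in \<open>auto simp: bilin_mod_def\<close>)
qed

lemma lin_mod_smult:
  assumes "lin_mod s N \<phi>" "X \<in> carrier A"
  shows "\<phi> (c \<odot>\<^bsub>A\<^esub> X) - s c (\<phi> X) \<in> N"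
proof -
  obtain p where p: "p \<in> carrier F" "X = pr p"
    using assms(2) by (auto simp: carrier_A)
  have "\<phi> (pr (scale c p + 0)) - (s c (\<phi> (pr p)) + \<phi> (pr 0)) \<in> N"
    using assms(1) p(1) carrier_F_closed(1) unfolding lin_mod_def by blast
  then have "\<phi> (pr (scale c p + 0)) - (s c (\<phi> (pr p)) + \<phi> (pr 0)) + \<phi> (pr 0) \<in> N"
    using lin_mod_zero[OF assms(1)] by (rule N_closed(2))
  then show ?thesis
    using p by (simp add: A_smult)
qed

lemma lin_mod_add:
  assumes "lin_mod s N \<phi>" "X \<in> carrier A" "Y \<in> carrier A"
  shows "\<phi> (X \<oplus>\<^bsub>A\<^esub> Y) - (\<phi> X + \<phi> Y) \<in> N"
proof -
  obtain p q where "p \<in> carrier F" "X = pr p" "q \<in> carrier F" "Y = pr q"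
    using assms(2,3) by (auto simp: carrier_A)
  moreover from this have "\<phi> (pr (scale 1 p + q)) - (s 1 (\<phi> (pr p)) + \<phi> (pr q)) \<in> N"
    using assms(1) unfolding lin_mod_def by blast
  ultimately show ?thesis by (simp add: A_add)
qed

lemma lin_mod_twist:
  assumes "lin_mod s N \<phi>" "X \<in> component A \<gamma>"
  shows "s (\<chi> \<gamma>) (\<phi> X) - \<phi> (twist \<chi> X) \<in> N"
  using lin_mod_smult[OF assms(1) component_A_carrier[OF assms(2)], of "\<chi> \<gamma>"]
  by (simp add: twist_component[OF assms(2)] N_sym)

lemma bilin_mod_twist:
  assumes "bilin_mod s N \<Phi>" "X \<in> component A \<gamma>" "Y \<in> component A \<delta>"
  shows "s (\<chi> \<gamma> * \<psi> \<delta>) (\<Phi> X Y) - \<Phi> (twist \<chi> X) (twist \<psi> Y) \<in> N"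
proof -
  have X: "X \<in> carrier A" "twist \<chi> X \<in> carrier A" and Y: "Y \<in> carrier A"
    using assms component_A_carrier twist_carrier by blast+
  have "s (\<chi> \<gamma>) (\<Phi> X Y) - \<Phi> (twist \<chi> X) Y \<in> N"
    using assms Y by (intro lin_mod_twist[of "\<lambda>X. \<Phi> X Y"]) (auto simp: bilin_mod_def)
  then have "s (\<psi> \<delta>) (s (\<chi> \<gamma>) (\<Phi> X Y) - \<Phi> (twist \<chi> X) Y) \<in> N"
    by (rule N_closed)
  then have "s (\<chi> \<gamma> * \<psi> \<delta>) (\<Phi> X Y) - s (\<psi> \<delta>) (\<Phi> (twist \<chi> X) Y) \<in> N"
    by (simp add: V.scale_right_diff_distrib mult.commute)
  moreover have "s (\<psi> \<delta>) (\<Phi> (twist \<chi> X) Y) - \<Phi> (twist \<chi> X) (twist \<psi> Y) \<in> N"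
    using assms X by (intro lin_mod_twist[of "\<Phi> (twist \<chi> X)"]) (auto simp: bilin_mod_def)
  ultimately show ?thesis by (rule N_trans)
qed

text \<open>The universal property of the tensor product, modulo \<open>N\<close>.\<close>

lemma bilin_mod_relations:
  assumes "bilin_mod s N \<Phi>" "g \<in> tensor_relations A A"
  shows "lin s (\<lambda>(X, Y). \<Phi> X Y) g \<in> N"
proof -
  have b: "\<And>X. X \<in> carrier A \<Longrightarrow> lin_mod s N (\<Phi> X)" "\<And>X. X \<in> carrier A \<Longrightarrow> lin_mod s N (\<lambda>Y. \<Phi> Y X)"
    using assms(1) by (auto simp: bilin_mod_def)
  note l = lin_diff[OF vs] lin_single[OF vs]
  from assms(2) consider
    X X' Y where "X \<in> carrier A" "X' \<in> carrier A" "Y \<in> carrier A"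
      "g = Poly_Mapping.single (X \<oplus>\<^bsub>A\<^esub> X', Y) 1 - Poly_Mapping.single (X, Y) 1 - Poly_Mapping.single (X', Y) 1"
  | X Y Y' where "X \<in> carrier A" "Y \<in> carrier A" "Y' \<in> carrier A"
      "g = Poly_Mapping.single (X, Y \<oplus>\<^bsub>A\<^esub> Y') 1 - Poly_Mapping.single (X, Y) 1 - Poly_Mapping.single (X, Y') 1"
  | c X Y where "X \<in> carrier A" "Y \<in> carrier A"
      "g = Poly_Mapping.single (c \<odot>\<^bsub>A\<^esub> X, Y) 1 - Poly_Mapping.single (X, Y) c"
  | c X Y where "X \<in> carrier A" "Y \<in> carrier A"
      "g = Poly_Mapping.single (X, c \<odot>\<^bsub>A\<^esub> Y) 1 - Poly_Mapping.single (X, Y) c"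
    unfolding tensor_relations_def by blast
  then show ?thesis
  proof cases
    case 1
    then show ?thesis
      using lin_mod_add[OF b(2)[of Y], of X X'] by (simp add: l flip: diff_diff_eq)
  next
    case 2
    then show ?thesis
      using lin_mod_add[OF b(1)[of X], of Y Y'] by (simp add: l flip: diff_diff_eq)
  next
    case 3
    then show ?thesis
      using lin_mod_smult[OF b(2)[of Y], of X c] by (simp add: l)
  next
    case 4
    then show ?thesis
      using lin_mod_smult[OF b(1)[of X], of Y c] by (simp add: l)
  qed
qed

lemma lin_comult:
  "lin s (\<lambda>(X, Y). \<Phi> X Y) (comult p) = wlin s (\<lambda>x y. \<Sum>z\<in>tuples I (length x). \<Phi> (pr (T x z)) (pr (T z y))) p"
  unfolding comult_def wlin_def lin_def[of scale _ p]
  by (simp add: lin_sum[OF vs] lin_scale[OF vs] lin_single[OF vs] lin_def[of s _ p])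

text \<open>The signs attached to the recorded degrees are first moved into the arguments by
  \<open>twist\<close>. What remains is bilinear, hence a function of the class alone, and the given
  representation may be exchanged for the explicit coproduct \<open>comult p\<close>.\<close>

lemma represents_single:
  assumes "bilin_mod s N \<Phi>" "represents A A us (tensor_class A A (comult p))" "p \<in> carrier F"
  shows "(\<Sum>(a1, \<alpha>1, a2, \<alpha>2)\<leftarrow>us. s (\<chi> \<alpha>1 * \<psi> \<alpha>2) (\<Phi> a1 a2)) -
    wlin s (\<lambda>x y. \<Sum>z\<in>tuples I (length x). s (\<chi> (deg z - deg x) * \<psi> (deg y - deg z)) (\<Phi> (pr (T x z)) (pr (T z y)))) p \<in> N"
proof -
  define \<Psi> where "\<Psi> a b = \<Phi> (twist \<chi> a) (twist \<psi> b)" for a b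
  have \<Psi>: "bilin_mod s N \<Psi>"
    unfolding \<Psi>_def by (intro bilin_mod_comp[OF assms(1)] A_linear_twist)
  define q where "q = (\<Sum>(a, \<alpha>, b, \<beta>)\<leftarrow>us. Poly_Mapping.single (a, b) (1::'k))"
  have us: "\<And>a \<alpha> b \<beta>. (a, \<alpha>, b, \<beta>) \<in> set us \<Longrightarrow> a \<in> component A \<alpha> \<and> b \<in> component A \<beta>"
    and "tensor_class A A (comult p) = tensor_class A A q"
    using assms(2) unfolding represents_def q_def by auto
  then have "q \<in> tensor_class A A (comult p)"
    by (simp add: tensor_class_def pm.span_zero)
  then have "q - comult p \<in> pm.span (tensor_relations A A)"
    by (simp add: tensor_class_def)
  then have "lin s (\<lambda>(X, Y). \<Psi> X Y) (q - comult p) \<in> N"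
    by (rule lin_span[OF vs _ N bilin_mod_relations[OF \<Psi>]])
  then have 2: "lin s (\<lambda>(X, Y). \<Psi> X Y) q -
      wlin s (\<lambda>x y. \<Sum>z\<in>tuples I (length x). \<Psi> (pr (T x z)) (pr (T z y))) p \<in> N"
    by (simp add: lin_diff[OF vs] lin_comult)
  have "lin s (\<lambda>(X, Y). \<Psi> X Y) q = (\<Sum>(a1, \<alpha>1, a2, \<alpha>2)\<leftarrow>us. \<Psi> a1 a2)"
    by (simp add: q_def lin_sum_list[OF vs] split_def lin_single[OF vs])
  moreover have "(\<Sum>(a1, \<alpha>1, a2, \<alpha>2)\<leftarrow>us. s (\<chi> \<alpha>1 * \<psi> \<alpha>2) (\<Phi> a1 a2)) - (\<Sum>(a1, \<alpha>1, a2, \<alpha>2)\<leftarrow>us. \<Psi> a1 a2) \<in> N"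
    using us bilin_mod_twist[OF assms(1)] by (intro N_sum_list_cong) (auto simp: \<Psi>_def)
  ultimately have 1: "(\<Sum>(a1, \<alpha>1, a2, \<alpha>2)\<leftarrow>us. s (\<chi> \<alpha>1 * \<psi> \<alpha>2) (\<Phi> a1 a2)) - lin s (\<lambda>(X, Y). \<Psi> X Y) q \<in> N"
    by simp
  \<comment> \<open>Removes the twists again: in the explicit coproduct every tensor factor is
    homogeneous of known degree.\<close>
  have 3: "wlin s (\<lambda>x y. \<Sum>z\<in>tuples I (length x). s (\<chi> (deg z - deg x) * \<psi> (deg y - deg z)) (\<Phi> (pr (T x z)) (pr (T z y)))) p
     - wlin s (\<lambda>x y. \<Sum>z\<in>tuples I (length x). \<Psi> (pr (T x z)) (pr (T z y))) p \<in> N"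
    unfolding \<Psi>_def
    by (intro wlin_cong_mod[OF assms(3)] N_sum_cong bilin_mod_twist[OF assms(1)] pr_T_component)
      (auto simp: tuples_def)
  show ?thesis
    using N_trans[OF N_trans[OF 1 2] N_sym[OF 3]] .
qed

definition quadrilin :: "((('i \<times> 'i) list \<Rightarrow>\<^sub>0 'k) set \<Rightarrow> (('i \<times> 'i) list \<Rightarrow>\<^sub>0 'k) set \<Rightarrow>
    (('i \<times> 'i) list \<Rightarrow>\<^sub>0 'k) set \<Rightarrow> (('i \<times> 'i) list \<Rightarrow>\<^sub>0 'k) set \<Rightarrow> 'v) \<Rightarrow> bool" where
  "quadrilin \<Phi> \<longleftrightarrow> (\<forall>X\<in>carrier A. \<forall>Y\<in>carrier A. bilin_mod s N (\<Phi> X Y) \<and> bilin_mod s N (\<lambda>Z W. \<Phi> Z W X Y))"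

text \<open>\<open>represents_single\<close> twice: with \<open>b1\<close>, \<open>b2\<close> fixed
  the sign is a function of \<open>\<alpha>1\<close> and \<open>\<alpha>2\<close>; once the first
  coproduct is explicit, it is a function of \<open>\<beta>1\<close>. Two sign functions are allowed
  so that both \<open>\<sigma> \<alpha>2 \<beta>1\<close> and
  \<open>\<sigma> (\<alpha>1 + \<alpha>2) \<beta>1\<close> are covered.\<close>

lemma represents_double:
  assumes \<Phi>: "quadrilin \<Phi>"
    and us: "represents A A us (tensor_class A A (comult p))" "p \<in> carrier F"
    and vs': "represents A A vs (tensor_class A A (comult q))" "q \<in> carrier F"
  shows "(\<Sum>(a1, \<alpha>1, a2, \<alpha>2)\<leftarrow>us. \<Sum>(b1, \<beta>1, b2, \<beta>2)\<leftarrow>vs. s (\<chi> \<alpha>1 \<beta>1 * \<psi> \<alpha>2 \<beta>1) (\<Phi> a1 a2 b1 b2)) -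
    wlin s (\<lambda>x y. wlin s (\<lambda>x' y'. \<Sum>z\<in>tuples I (length x). \<Sum>z'\<in>tuples I (length x').
      s (\<chi> (deg z - deg x) (deg z' - deg x') * \<psi> (deg y - deg z) (deg z' - deg x'))
        (\<Phi> (pr (T x z)) (pr (T z y)) (pr (T x' z')) (pr (T z' y')))) q) p \<in> N"
proof -
  have comp: "a \<in> component A \<alpha>" "b \<in> component A \<beta>" if "(a, \<alpha>, b, \<beta>) \<in> set vs" for a \<alpha> b \<beta>
    using vs'(1) that by (auto simp: represents_def)
  have e1: "(\<Sum>(a1, \<alpha>1, a2, \<alpha>2)\<leftarrow>us. \<Sum>(b1, \<beta>1, b2, \<beta>2)\<leftarrow>vs. s (\<chi> \<alpha>1 \<beta>1 * \<psi> \<alpha>2 \<beta>1) (\<Phi> a1 a2 b1 b2))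
     = (\<Sum>(b1, \<beta>1, b2, \<beta>2)\<leftarrow>vs. \<Sum>(a1, \<alpha>1, a2, \<alpha>2)\<leftarrow>us. s (\<chi> \<alpha>1 \<beta>1 * \<psi> \<alpha>2 \<beta>1) (\<Phi> a1 a2 b1 b2))"
    unfolding split_def by (rule sum_list_swap)
  have n1: "(\<Sum>(b1, \<beta>1, b2, \<beta>2)\<leftarrow>vs. \<Sum>(a1, \<alpha>1, a2, \<alpha>2)\<leftarrow>us. s (\<chi> \<alpha>1 \<beta>1 * \<psi> \<alpha>2 \<beta>1) (\<Phi> a1 a2 b1 b2)) - (\<Sum>(b1, \<beta>1, b2, \<beta>2)\<leftarrow>vs. wlin s (\<lambda>x y. \<Sum>z\<in>tuples I (length x).
      s (\<chi> (deg z - deg x) \<beta>1 * \<psi> (deg y - deg z) \<beta>1) (\<Phi> (pr (T x z)) (pr (T z y)) b1 b2)) p) \<in> N"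
  proof (rule N_sum_list_cong, clarify)
    fix b1 \<beta>1 b2 \<beta>2 assume "(b1, \<beta>1, b2, \<beta>2) \<in> set vs"
    then have "bilin_mod s N (\<lambda>a1 a2. \<Phi> a1 a2 b1 b2)"
      using \<Phi> comp component_A_carrier unfolding quadrilin_def by blast
    from represents_single[OF this us, of "\<lambda>\<alpha>. \<chi> \<alpha> \<beta>1" "\<lambda>\<alpha>. \<psi> \<alpha> \<beta>1"]
    show "(\<Sum>(a1, \<alpha>1, a2, \<alpha>2)\<leftarrow>us. s (\<chi> \<alpha>1 \<beta>1 * \<psi> \<alpha>2 \<beta>1) (\<Phi> a1 a2 b1 b2)) -
       wlin s (\<lambda>x y. \<Sum>z\<in>tuples I (length x).
      s (\<chi> (deg z - deg x) \<beta>1 * \<psi> (deg y - deg z) \<beta>1) (\<Phi> (pr (T x z)) (pr (T z y)) b1 b2)) p \<in> N" .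
  qed
  have e2: "(\<Sum>(b1, \<beta>1, b2, \<beta>2)\<leftarrow>vs. wlin s (\<lambda>x y. \<Sum>z\<in>tuples I (length x).
      s (\<chi> (deg z - deg x) \<beta>1 * \<psi> (deg y - deg z) \<beta>1) (\<Phi> (pr (T x z)) (pr (T z y)) b1 b2)) p)
      = wlin s (\<lambda>x y. \<Sum>z\<in>tuples I (length x). \<Sum>(b1, \<beta>1, b2, \<beta>2)\<leftarrow>vs.
      s (\<chi> (deg z - deg x) \<beta>1 * \<psi> (deg y - deg z) \<beta>1) (\<Phi> (pr (T x z)) (pr (T z y)) b1 b2)) p"
    unfolding split_def by (subst wlin_sum_list[symmetric]) (subst sum_list_sum_swap, rule refl)
  have n2: "wlin s (\<lambda>x y. \<Sum>z\<in>tuples I (length x). \<Sum>(b1, \<beta>1, b2, \<beta>2)\<leftarrow>vs.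
      s (\<chi> (deg z - deg x) \<beta>1 * \<psi> (deg y - deg z) \<beta>1) (\<Phi> (pr (T x z)) (pr (T z y)) b1 b2)) p -
     wlin s (\<lambda>x y. wlin s (\<lambda>x' y'. \<Sum>z\<in>tuples I (length x). \<Sum>z'\<in>tuples I (length x').
      s (\<chi> (deg z - deg x) (deg z' - deg x') * \<psi> (deg y - deg z) (deg z' - deg x'))
        (\<Phi> (pr (T x z)) (pr (T z y)) (pr (T x' z')) (pr (T z' y')))) q) p \<in> N"
    unfolding wlin_sum[where p = q]
  proof (intro wlin_cong_mod[OF us(2)] N_sum_cong)
    fix x y z assume "length x = length y" "set x \<subseteq> I" "set y \<subseteq> I" "z \<in> tuples I (length x)"
    then have "pr (T x z) \<in> carrier A" "pr (T z y) \<in> carrier A"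
      by (auto simp: tuples_def)
    then have "bilin_mod s N (\<Phi> (pr (T x z)) (pr (T z y)))"
      using \<Phi> unfolding quadrilin_def by blast
    from represents_single[OF this vs', of "\<lambda>\<beta>. \<chi> (deg z - deg x) \<beta> * \<psi> (deg y - deg z) \<beta>" "\<lambda>_. 1"]
    show "(\<Sum>(b1, \<beta>1, b2, \<beta>2)\<leftarrow>vs.
      s (\<chi> (deg z - deg x) \<beta>1 * \<psi> (deg y - deg z) \<beta>1) (\<Phi> (pr (T x z)) (pr (T z y)) b1 b2)) -
      wlin s (\<lambda>x' y'. \<Sum>z'\<in>tuples I (length x').
      s (\<chi> (deg z - deg x) (deg z' - deg x') * \<psi> (deg y - deg z) (deg z' - deg x'))
        (\<Phi> (pr (T x z)) (pr (T z y)) (pr (T x' z')) (pr (T z' y')))) q \<in> N"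
      by simp
  qed
  show ?thesis
    unfolding e1 by (rule N_trans[OF n1 n2[folded e2]])
qed

section \<open>Coproduct and counit\<close>

lemma sum_tuples_middle:
  "(\<Sum>z\<in>tuples I (n + Suc (Suc m)). f z) = (\<Sum>u\<in>tuples I n. \<Sum>v\<in>tuples I m. \<Sum>c\<in>I. \<Sum>d\<in>I. f (u @ c # d # v))"
  unfolding sum_tuples_add sum_tuples_Suc by (intro sum.cong[OF refl] sum_rotate)

text \<open>If \<open>C\<close> commutes with the matrix \<open>T\<close>, it commutes with the
  product of the matrices in the two tensor legs: \<open>C T T = T C T = T T C\<close>. The middle
  term is \<open>?M\<close>, and each equality is \<open>lin_mod_kills\<close> applied in one
  leg.\<close>

lemma bilin_mod_kills:
  assumes \<Phi>: "bilin_mod s N \<Phi>"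
  shows "kills_relators s N (\<lambda>x y. \<Sum>z\<in>tuples I (length x). \<Phi> (pr (T x z)) (pr (T z y)))"
  unfolding kills_relators_def
proof (intro allI impI)
  fix s' s0 i j k l r' r assume idx: "relator_index s' s0 i j k l r' r"
  let ?U = "tuples I (length s')" let ?W = "tuples I (length r')"
  have len: "length (s' @ a # b # r') = length s' + Suc (Suc (length r'))" for a b by simp
  have cA: "pr (T x z) \<in> carrier A" if "set x \<subseteq> I" "set z \<subseteq> I" for x z
    using that by simp
  let ?M = "\<Sum>u\<in>?U. \<Sum>v\<in>?W. \<Sum>c\<in>I. \<Sum>d\<in>I. \<Sum>a\<in>I. \<Sum>b\<in>I.
     s (C a b c d) (\<Phi> (pr (T (s' @ i # j # r') (u @ a # b # v))) (pr (T (u @ c # d # v) (s0 @ k # l # r))))"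
  have swap: "(\<Sum>a\<in>I. \<Sum>b\<in>I. \<Sum>u\<in>?U. \<Sum>v\<in>?W. \<Sum>c\<in>I. \<Sum>d\<in>I. f a b u v c d)
     = (\<Sum>u\<in>?U. \<Sum>v\<in>?W. \<Sum>c\<in>I. \<Sum>d\<in>I. \<Sum>a\<in>I. \<Sum>b\<in>I. f a b u v c d)" for f :: "_ \<Rightarrow> _ \<Rightarrow> _ \<Rightarrow> _ \<Rightarrow> _ \<Rightarrow> _ \<Rightarrow> 'v"
  proof -
    have "(\<Sum>a\<in>I. \<Sum>b\<in>I. \<Sum>u\<in>?U. \<Sum>v\<in>?W. \<Sum>c\<in>I. \<Sum>d\<in>I. f a b u v c d)
      = (\<Sum>u\<in>?U. \<Sum>v\<in>?W. \<Sum>a\<in>I. \<Sum>b\<in>I. \<Sum>c\<in>I. \<Sum>d\<in>I. f a b u v c d)"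
      by (rule sum_pairs_swap)
    also have "\<dots> = (\<Sum>u\<in>?U. \<Sum>v\<in>?W. \<Sum>c\<in>I. \<Sum>d\<in>I. \<Sum>a\<in>I. \<Sum>b\<in>I. f a b u v c d)"
      by (intro sum.cong[OF refl] sum_pairs_swap)
    finally show ?thesis .
  qed
  have "(\<Sum>a\<in>I. \<Sum>b\<in>I. s (C i j a b) (\<Sum>z\<in>tuples I (length (s' @ a # b # r')).
       \<Phi> (pr (T (s' @ a # b # r') z)) (pr (T z (s0 @ k # l # r)))))
     = (\<Sum>u\<in>?U. \<Sum>v\<in>?W. \<Sum>c\<in>I. \<Sum>d\<in>I. \<Sum>a\<in>I. \<Sum>b\<in>I. s (C i j a b)
       (\<Phi> (pr (T (s' @ a # b # r') (u @ c # d # v))) (pr (T (u @ c # d # v) (s0 @ k # l # r)))))"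
    unfolding len sum_tuples_middle V.scale_sum_right by (rule swap)
  moreover have "\<dots> - ?M \<in> N"
  proof (rule N_sum_cong, rule N_sum_cong, rule N_sum_cong, rule N_sum_cong)
    fix u v c d assume *: "u \<in> ?U" "v \<in> ?W" "c \<in> I" "d \<in> I"
    then have "lin_mod s N (\<lambda>X. \<Phi> X (pr (T (u @ c # d # v) (s0 @ k # l # r))))"
      using \<Phi> cA[of "u @ c # d # v" "s0 @ k # l # r"] idx by (auto simp: bilin_mod_def relator_index_def tuples_def)
    from lin_mod_kills[OF this]
    show "(\<Sum>a\<in>I. \<Sum>b\<in>I. s (C i j a b)
       (\<Phi> (pr (T (s' @ a # b # r') (u @ c # d # v))) (pr (T (u @ c # d # v) (s0 @ k # l # r))))) -
      (\<Sum>a\<in>I. \<Sum>b\<in>I. s (C a b c d) (\<Phi> (pr (T (s' @ i # j # r') (u @ a # b # v))) (pr (T (u @ c # d # v) (s0 @ k # l # r))))) \<in> N"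
      using idx * unfolding kills_relators_def by (auto simp: relator_index_def tuples_def)
  qed
  ultimately have 1: "(\<Sum>a\<in>I. \<Sum>b\<in>I. s (C i j a b) (\<Sum>z\<in>tuples I (length (s' @ a # b # r')).
       \<Phi> (pr (T (s' @ a # b # r') z)) (pr (T z (s0 @ k # l # r))))) - ?M \<in> N"
    by simp
  have M: "?M = (\<Sum>u\<in>?U. \<Sum>v\<in>?W. \<Sum>c\<in>I. \<Sum>d\<in>I. \<Sum>a\<in>I. \<Sum>b\<in>I.
     s (C c d a b) (\<Phi> (pr (T (s' @ i # j # r') (u @ c # d # v))) (pr (T (u @ a # b # v) (s0 @ k # l # r)))))"
    by (rule sum.cong[OF refl], rule sum.cong[OF refl], rule sum_pairs_swap)
  have "(\<Sum>a\<in>I. \<Sum>b\<in>I. s (C a b k l) (\<Sum>z\<in>tuples I (length (s' @ i # j # r')).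
       \<Phi> (pr (T (s' @ i # j # r') z)) (pr (T z (s0 @ a # b # r)))))
     = (\<Sum>u\<in>?U. \<Sum>v\<in>?W. \<Sum>c\<in>I. \<Sum>d\<in>I. \<Sum>a\<in>I. \<Sum>b\<in>I. s (C a b k l)
       (\<Phi> (pr (T (s' @ i # j # r') (u @ c # d # v))) (pr (T (u @ c # d # v) (s0 @ a # b # r)))))"
    unfolding len sum_tuples_middle V.scale_sum_right by (rule swap)
  moreover have "?M - \<dots> \<in> N"
    unfolding M
  proof (rule N_sum_cong, rule N_sum_cong, rule N_sum_cong, rule N_sum_cong)
    fix u v c d assume *: "u \<in> ?U" "v \<in> ?W" "c \<in> I" "d \<in> I"
    then have "lin_mod s N (\<Phi> (pr (T (s' @ i # j # r') (u @ c # d # v))))"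
      using \<Phi> cA[of "s' @ i # j # r'" "u @ c # d # v"] idx by (auto simp: bilin_mod_def relator_index_def tuples_def)
    from lin_mod_kills[OF this]
    show "(\<Sum>a\<in>I. \<Sum>b\<in>I. s (C c d a b) (\<Phi> (pr (T (s' @ i # j # r') (u @ c # d # v))) (pr (T (u @ a # b # v) (s0 @ k # l # r))))) -
      (\<Sum>a\<in>I. \<Sum>b\<in>I. s (C a b k l) (\<Phi> (pr (T (s' @ i # j # r') (u @ c # d # v))) (pr (T (u @ c # d # v) (s0 @ a # b # r))))) \<in> N"
      using idx * unfolding kills_relators_def by (auto simp: relator_index_def tuples_def)
  qed
  ultimately show "(\<Sum>a\<in>I. \<Sum>b\<in>I. s (C i j a b) (\<Sum>z\<in>tuples I (length (s' @ a # b # r')).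
       \<Phi> (pr (T (s' @ a # b # r') z)) (pr (T z (s0 @ k # l # r))))) -
    (\<Sum>a\<in>I. \<Sum>b\<in>I. s (C a b k l) (\<Sum>z\<in>tuples I (length (s' @ i # j # r')).
       \<Phi> (pr (T (s' @ i # j # r') z)) (pr (T z (s0 @ a # b # r))))) \<in> N"
    using N_trans[OF 1] by simp
qed

lemma bilinear_expand:
  assumes "\<And>c p p' q. H (scale c p + p') q = s c (H p q) + H p' q"
    and "\<And>c p q q'. H p (scale c q + q') = s c (H p q) + H p q'"
    and "p \<in> carrier F" "q \<in> carrier F"
  shows "H p q = wlin s (\<lambda>x y. wlin s (\<lambda>x' y'. H (T x y) (T x' y')) q) p"
proof -
  have 0: "H 0 q = 0" "H q 0 = 0" for q
    using assms(1)[of 1 0 0 q] assms(2)[of q 1 0 0] by simp_all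
  have 1: "H p q = wlin s (\<lambda>x y. H p (T x y)) q" for p
    using assms(4) by (induction rule: carrier_F_induct) (simp_all add: 0 assms(2) wlin_linear)
  have "H p q = wlin s (\<lambda>x y. H (T x y) q) p"
    using assms(3) by (induction rule: carrier_F_induct) (simp_all add: 0 assms(1) wlin_linear)
  then show ?thesis
    by (simp flip: 1)
qed

lemma bilin_mod_smult:
  assumes "bilin_mod s N \<Phi>" "X \<in> carrier A" "Y \<in> carrier A"
  shows "\<Phi> (c \<odot>\<^bsub>A\<^esub> X) (d \<odot>\<^bsub>A\<^esub> Y) - s (c * d) (\<Phi> X Y) \<in> N"
proof -
  have d: "d \<odot>\<^bsub>A\<^esub> Y \<in> carrier A"
    using assms(3) by (auto simp: carrier_A A_smult carrier_F_closed)
  have "\<Phi> (c \<odot>\<^bsub>A\<^esub> X) (d \<odot>\<^bsub>A\<^esub> Y) - s c (\<Phi> X (d \<odot>\<^bsub>A\<^esub> Y)) \<in> N"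
    using assms d by (intro lin_mod_smult[of "\<lambda>X. \<Phi> X (d \<odot>\<^bsub>A\<^esub> Y)"]) (auto simp: bilin_mod_def)
  moreover have "s c (\<Phi> X (d \<odot>\<^bsub>A\<^esub> Y) - s d (\<Phi> X Y)) \<in> N"
    using assms by (intro N_closed lin_mod_smult[of "\<Phi> X"]) (auto simp: bilin_mod_def)
  then have "s c (\<Phi> X (d \<odot>\<^bsub>A\<^esub> Y)) - s (c * d) (\<Phi> X Y) \<in> N"
    by (simp add: V.scale_right_diff_distrib)
  ultimately show ?thesis by (rule N_trans)
qed

end

context graded_yb
begin

section \<open>The coproduct as a homomorphism into the graded tensor square\<close>

abbreviation tensor_span where
  "tensor_span \<equiv> pm.span (tensor_relations A A)"

sublocale modulo_tensor: yb_target \<sigma> I \<eta> R scale tensor_span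
  by (intro yb_target.intro yb_target_axioms.intro graded_yb_axioms pm.vector_space_axioms pm.subspace_span)

lemma class_eq_iff: "tensor_class A A p = tensor_class A A q \<longleftrightarrow> p - q \<in> tensor_span"
proof
  assume "tensor_class A A p = tensor_class A A q"
  moreover have "p \<in> tensor_class A A p"
    by (simp add: tensor_class_def pm.span_zero)
  ultimately show "p - q \<in> tensor_span"
    by (simp add: tensor_class_def)
next
  assume "p - q \<in> tensor_span"
  then show "tensor_class A A p = tensor_class A A q"
    unfolding tensor_class_def using modulo_tensor.N_trans modulo_tensor.N_sym by blast
qed

lemma single_bilin: "bilin_mod scale tensor_span (\<lambda>X Y. Poly_Mapping.single (X, Y) 1)"
  unfolding bilin_mod_def lin_mod_def
proof (intro ballI conjI allI)
  fix X c p q assume X: "X \<in> carrier A" and p: "p \<in> carrier F" and q: "q \<in> carrier F"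
  let ?s = "\<lambda>X Y. Poly_Mapping.single (X, Y) (1::'k)"
  have sum: "pr (scale c p + q) = c \<odot>\<^bsub>A\<^esub> pr p \<oplus>\<^bsub>A\<^esub> pr q" and cp: "c \<odot>\<^bsub>A\<^esub> pr p \<in> carrier A"
    using p q by (simp_all add: A_smult A_add carrier_F_closed)
  have "?s X (c \<odot>\<^bsub>A\<^esub> pr p \<oplus>\<^bsub>A\<^esub> pr q) - ?s X (c \<odot>\<^bsub>A\<^esub> pr p) - ?s X (pr q) \<in> tensor_relations A A"
    "?s (c \<odot>\<^bsub>A\<^esub> pr p \<oplus>\<^bsub>A\<^esub> pr q) X - ?s (c \<odot>\<^bsub>A\<^esub> pr p) X - ?s (pr q) X \<in> tensor_relations A A"
    "?s X (c \<odot>\<^bsub>A\<^esub> pr p) - Poly_Mapping.single (X, pr p) c \<in> tensor_relations A A"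
    "?s (c \<odot>\<^bsub>A\<^esub> pr p) X - Poly_Mapping.single (pr p, X) c \<in> tensor_relations A A"
    unfolding tensor_relations_def using X p q cp pr_carrier by blast+
  note * = pm.span_base[OF this(1)] pm.span_base[OF this(2)] pm.span_base[OF this(3)] pm.span_base[OF this(4)]
  show "?s X (pr (scale c p + q)) - (scale c (?s X (pr p)) + ?s X (pr q)) \<in> tensor_span"
    using pm.span_add[OF *(1,3)] unfolding sum by (simp add: algebra_simps)
  show "?s (pr (scale c p + q)) X - (scale c (?s (pr p) X) + ?s (pr q) X) \<in> tensor_span"
    using pm.span_add[OF *(2,4)] unfolding sum by (simp add: algebra_simps)
qed

lemma comult_J: "p \<in> J \<Longrightarrow> comult p \<in> tensor_span"
  unfolding comult_def by (rule modulo_tensor.wlin_J[OF modulo_tensor.bilin_mod_kills[OF single_bilin]])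

lemma comult_linear:
  "comult (p + q) = comult p + comult q" "comult (scale c p) = scale c (comult p)" "comult (p - q) = comult p - comult q"
  by (simp_all add: comult_def modulo_tensor.wlin_linear)

lemma comult_T: "length x = length y \<Longrightarrow> comult (T x y) = (\<Sum>z\<in>tuples I (length x). Poly_Mapping.single (pr (T x z), pr (T z y)) 1)"
  by (simp add: comult_def)

definition representable :: "'g set \<Rightarrow> ((('i \<times> 'i) list \<Rightarrow>\<^sub>0 'k) set \<times> (('i \<times> 'i) list \<Rightarrow>\<^sub>0 'k) set \<Rightarrow>\<^sub>0 'k) \<Rightarrow> bool" where
  "representable G q \<longleftrightarrow> (\<exists>us. represents A A us (tensor_class A A q) \<and> (\<forall>(a, \<alpha>, b, \<beta>)\<in>set us. \<alpha> + \<beta> \<in> G))"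

lemma representable_subspace: "pm.subspace {q. representable G q}"
proof -
  let ?S = "\<lambda>us. (\<Sum>(a, \<alpha>, b, \<beta>)\<leftarrow>us. Poly_Mapping.single (a, b) (1::'k))"
  have "representable G 0"
    unfolding representable_def by (intro exI[of _ "[]"]) (simp add: represents_def)
  moreover have "representable G (p + q)" if pq: "representable G p" "representable G q" for p q
  proof -
    obtain us vs where us: "represents A A us (tensor_class A A p)" "\<forall>(a, \<alpha>, b, \<beta>)\<in>set us. \<alpha> + \<beta> \<in> G"
      "represents A A vs (tensor_class A A q)" "\<forall>(a, \<alpha>, b, \<beta>)\<in>set vs. \<alpha> + \<beta> \<in> G"
      using pq unfolding representable_def by blast
    then have "p - ?S us \<in> tensor_span" "q - ?S vs \<in> tensor_span"
      by (simp_all add: represents_def class_eq_iff)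
    from pm.span_add[OF this] have "p + q - ?S (us @ vs) \<in> tensor_span"
      by (simp add: algebra_simps)
    then have "represents A A (us @ vs) (tensor_class A A (p + q))"
      using us by (auto simp: represents_def class_eq_iff)
    then show ?thesis
      using us unfolding representable_def by (intro exI[of _ "us @ vs"]) auto
  qed
  moreover have "representable G (scale c p)" if p: "representable G p" for c p
  proof -
    obtain us where us: "represents A A us (tensor_class A A p)" "\<forall>(a, \<alpha>, b, \<beta>)\<in>set us. \<alpha> + \<beta> \<in> G"
      using p unfolding representable_def by blast
    \<comment> \<open>The tensors in a representation carry no coefficients, so the scalar is
      absorbed into each first factor.\<close>
    let ?f = "\<lambda>(a, \<alpha>, b, \<beta>). (c \<odot>\<^bsub>A\<^esub> a, \<alpha>, b, \<beta>)"
    have comp: "\<And>a \<alpha> b \<beta>. (a, \<alpha>, b, \<beta>) \<in> set us \<Longrightarrow> a \<in> component A \<alpha> \<and> b \<in> component A \<beta>"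
      using us by (auto simp: represents_def)
    have comp': "a \<in> component A \<alpha> \<Longrightarrow> c \<odot>\<^bsub>A\<^esub> a \<in> component A \<alpha>" for a \<alpha>
      using pm.subspace_scale[OF component_F_subspace] by (auto simp: A_component A_smult)
    have "?S (map ?f us) - scale c (?S us) \<in> tensor_span"
      using comp
    proof (induction us)
      case (Cons u us)
      obtain a \<alpha> b \<beta> where u: "u = (a, \<alpha>, b, \<beta>)" by (cases u)
      then have "a \<in> carrier A" "b \<in> carrier A"
        using Cons.prems[of a \<alpha> b \<beta>] component_A_carrier by auto
      then have "Poly_Mapping.single (c \<odot>\<^bsub>A\<^esub> a, b) 1 - scale c (Poly_Mapping.single (a, b) 1) \<in> tensor_span"
        using modulo_tensor.lin_mod_smult[of "\<lambda>X. Poly_Mapping.single (X, b) 1"] single_bilin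
        by (simp add: bilin_mod_def)
      moreover have "?S (map ?f us) - scale c (?S us) \<in> tensor_span"
        by (rule Cons.IH) (use Cons.prems in auto)
      ultimately have "(Poly_Mapping.single (c \<odot>\<^bsub>A\<^esub> a, b) 1 - scale c (Poly_Mapping.single (a, b) 1)) +
         (?S (map ?f us) - scale c (?S us)) \<in> tensor_span"
        by (rule pm.span_add)
      then show ?case
        by (simp add: u pm.scale_right_distrib algebra_simps)
    qed (simp add: pm.span_zero)
    moreover have "scale c (p - ?S us) \<in> tensor_span"
      using us by (intro pm.span_scale) (simp add: represents_def class_eq_iff)
    ultimately have "scale c p - ?S (map ?f us) \<in> tensor_span"
      using pm.span_diff[of "scale c (p - ?S us)" _ "?S (map ?f us) - scale c (?S us)"]
      by (simp add: pm.scale_right_diff_distrib)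
    then have "represents A A (map ?f us) (tensor_class A A (scale c p))"
      using comp comp' by (auto simp: represents_def class_eq_iff)
    then show ?thesis
      using us unfolding representable_def by (intro exI[of _ "map ?f us"]) auto
  qed
  ultimately show ?thesis by (simp add: pm.subspace_def)
qed

lemma representable_comult:
  assumes "p \<in> carrier F" "word_degree \<eta> ` Poly_Mapping.keys p \<subseteq> G"
  shows "representable G (comult p)"
proof -
  have "comult p \<in> {q. representable G q}"
    unfolding comult_def wlin_def
  proof (rule lin_mem[OF pm.vector_space_axioms representable_subspace])
    fix w assume w: "w \<in> Poly_Mapping.keys p"
    then have I: "set (map fst w) \<subseteq> I \<and> set (map snd w) \<subseteq> I"
      using assms(1) by (intro letters_unzip) (auto simp: carrier_F)
    have d: "word_degree \<eta> w = deg (map snd w) - deg (map fst w)"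
      using word_degree_zip[of "map fst w" "map snd w"] by (simp add: zip_map_fst_snd)
    have "representable G (Poly_Mapping.single (pr (T (map fst w) z), pr (T z (map snd w))) 1)"
      if "z \<in> tuples I (length (map fst w))" for z
    proof -
      have "represents A A [(pr (T (map fst w) z), deg z - deg (map fst w), pr (T z (map snd w)), deg (map snd w) - deg z)]
        (tensor_class A A (Poly_Mapping.single (pr (T (map fst w) z), pr (T z (map snd w))) 1))"
        using that I by (auto simp: represents_def tuples_def intro!: pr_T_component)
      moreover have "deg (map snd w) - deg (map fst w) \<in> G"
        using assms(2) w d by auto
      ultimately show ?thesis
        unfolding representable_def by (intro exI conjI) (assumption, simp)
    qed
    then have "(\<Sum>z\<in>tuples I (length (map fst w)). Poly_Mapping.single (pr (T (map fst w) z), pr (T z (map snd w))) 1)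
      \<in> {q. representable G q}"
      by (intro pm.subspace_sum[OF representable_subspace]) simp
    then show "scale (1 / sg (map fst w) (map snd w)) (\<Sum>z\<in>tuples I (length (map fst w)). Poly_Mapping.single (pr (T (map fst w) z), pr (T z (map snd w))) 1)
       \<in> {q. representable G q}"
      by (rule pm.subspace_scale[OF representable_subspace])
  qed
  then show ?thesis by simp
qed

text \<open>The product of \<open>gtensor\<close> and the axioms of a universal r-form speak about
  all representations. Existence makes that product a single coset, and lets uniqueness extract
  actual equations from the axioms.\<close>

lemma represents_comult_exists:
  assumes "p \<in> carrier F"
  obtains us where "represents A A us (tensor_class A A (comult p))"
  using representable_comult[OF assms order_refl] that by (auto simp: representable_def)

lemma comult_carrier:
  assumes "p \<in> carrier F"
  shows "Poly_Mapping.keys (comult p) \<subseteq> carrier A \<times> carrier A"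
proof -
  let ?S = "{q :: _ \<Rightarrow>\<^sub>0 'k. Poly_Mapping.keys q \<subseteq> carrier A \<times> carrier A}"
  have eq: "?S = {q. \<forall>w. w \<notin> carrier A \<times> carrier A \<longrightarrow> Poly_Mapping.lookup q w = (0::'k)}"
    by (auto simp: in_keys_iff)
  have S: "pm.subspace ?S"
    unfolding eq by (auto simp: pm.subspace_def lookup_add)
  have "comult p \<in> ?S"
    unfolding comult_def wlin_def
  proof (rule lin_mem[OF pm.vector_space_axioms S], rule pm.subspace_scale[OF S], rule pm.subspace_sum[OF S])
    fix w z assume "w \<in> Poly_Mapping.keys p" "z \<in> tuples I (length (map fst w))"
    moreover from this have "set (map fst w) \<subseteq> I \<and> set (map snd w) \<subseteq> I"
      using assms(1) by (intro letters_unzip) (auto simp: carrier_F)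
    ultimately show "Poly_Mapping.single (pr (T (map fst w) z), pr (T z (map snd w))) 1 \<in> ?S"
      by (simp add: tuples_def)
  qed
  then show ?thesis by simp
qed

text \<open>On monomials, the intermediate words for a product are the concatenations
  \<open>z @ z'\<close>. The sign of the graded product is then matched with the rescalings in
  \<open>T\<close> by \<open>\<sigma>_comult_mult\<close>.\<close>

lemma comult_mult:
  assumes "p \<in> carrier F" "q \<in> carrier F"
    and us: "represents A A us (tensor_class A A (comult p))" and vs: "represents A A vs (tensor_class A A (comult q))"
  shows "(\<Sum>(a, \<alpha>, b, \<beta>)\<leftarrow>us. \<Sum>(a', \<alpha>', b', \<beta>')\<leftarrow>vs.
     Poly_Mapping.single (a \<otimes>\<^bsub>A\<^esub> a', b \<otimes>\<^bsub>A\<^esub> b') (\<sigma> \<beta> \<alpha>')) - comult (p * q) \<in> tensor_span"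
proof -
  let ?\<Phi> = "\<lambda>a b a' b'. Poly_Mapping.single (a \<otimes>\<^bsub>A\<^esub> a', b \<otimes>\<^bsub>A\<^esub> b') (1::'k)"
  have quad: "modulo_tensor.quadrilin ?\<Phi>"
    unfolding modulo_tensor.quadrilin_def
    by (intro ballI conjI modulo_tensor.bilin_mod_comp[OF single_bilin] A_linear_mult)
  have "(\<Sum>(a, \<alpha>, b, \<beta>)\<leftarrow>us. \<Sum>(a', \<alpha>', b', \<beta>')\<leftarrow>vs. scale (1 * \<sigma> \<beta> \<alpha>') (?\<Phi> a b a' b')) -
    wlin scale (\<lambda>x y. wlin scale (\<lambda>x' y'. \<Sum>z\<in>tuples I (length x). \<Sum>z'\<in>tuples I (length x').
      scale (1 * \<sigma> (deg y - deg z) (deg z' - deg x'))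
        (?\<Phi> (pr (T x z)) (pr (T z y)) (pr (T x' z')) (pr (T z' y')))) q) p \<in> tensor_span" (is "_ - ?E \<in> _")
    by (rule modulo_tensor.represents_double[OF quad us assms(1) vs assms(2)])
  moreover have "comult (p * q) = wlin scale (\<lambda>x y. wlin scale (\<lambda>x' y'. comult (T x y * T x' y')) q) p"
    by (rule modulo_tensor.bilinear_expand[OF _ _ assms(1,2)])
      (simp_all add: comult_linear ring_distribs scale_mult_left scale_mult_right)
  moreover have "?E - wlin scale (\<lambda>x y. wlin scale (\<lambda>x' y'. comult (T x y * T x' y')) q) p \<in> tensor_span"
  proof (intro modulo_tensor.wlin_cong_mod assms)
    fix x y x' y' assume xy: "length x = length y" "set x \<subseteq> I" "set y \<subseteq> I" "length x' = length y'" "set x' \<subseteq> I" "set y' \<subseteq> I"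
    have "comult (T x y * T x' y') = (\<Sum>z\<in>tuples I (length x). \<Sum>z'\<in>tuples I (length x').
       scale (1 / \<sigma> (deg y - deg x) (deg x')) (Poly_Mapping.single (pr (T (x @ x') (z @ z')), pr (T (z @ z') (y @ y'))) 1))"
      using xy by (simp add: T_mult comult_linear comult_T sum_tuples_add pm.scale_sum_right del: scale_single)
    moreover have "(\<Sum>z\<in>tuples I (length x). \<Sum>z'\<in>tuples I (length x').
      scale (1 * \<sigma> (deg y - deg z) (deg z' - deg x')) (?\<Phi> (pr (T x z)) (pr (T z y)) (pr (T x' z')) (pr (T z' y')))) - \<dots> \<in> tensor_span"
    proof (rule modulo_tensor.N_sum_cong, rule modulo_tensor.N_sum_cong)
      fix z z' assume z: "z \<in> tuples I (length x)" "z' \<in> tuples I (length x')"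
      let ?X = "pr (T x z) \<otimes>\<^bsub>A\<^esub> pr (T x' z')" and ?Y = "pr (T z y) \<otimes>\<^bsub>A\<^esub> pr (T z' y')"
      have XY: "?X \<in> carrier A" "?Y \<in> carrier A"
        using xy z by (auto simp: A_mult tuples_def carrier_F_closed)
      have e: "pr (T (x @ x') (z @ z')) = \<sigma> (deg z - deg x) (deg x') \<odot>\<^bsub>A\<^esub> ?X"
        "pr (T (z @ z') (y @ y')) = \<sigma> (deg y - deg z) (deg z') \<odot>\<^bsub>A\<^esub> ?Y"
        using xy z by (simp_all add: A_mult A_smult T_append tuples_def carrier_F_closed)
      have "scale (1 / \<sigma> (deg y - deg x) (deg x')) (Poly_Mapping.single (pr (T (x @ x') (z @ z')), pr (T (z @ z') (y @ y'))) 1 -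
           scale (\<sigma> (deg z - deg x) (deg x') * \<sigma> (deg y - deg z) (deg z')) (Poly_Mapping.single (?X, ?Y) 1)) \<in> tensor_span"
        unfolding e by (intro pm.span_scale modulo_tensor.bilin_mod_smult[OF single_bilin XY])
      moreover have "1 / \<sigma> (deg y - deg x) (deg x') * (\<sigma> (deg z - deg x) (deg x') * \<sigma> (deg y - deg z) (deg z'))
         = \<sigma> (deg y - deg z) (deg z' - deg x')"
        by (rule \<sigma>_comult_mult)
      ultimately show "scale (1 * \<sigma> (deg y - deg z) (deg z' - deg x')) (?\<Phi> (pr (T x z)) (pr (T z y)) (pr (T x' z')) (pr (T z' y'))) -
        scale (1 / \<sigma> (deg y - deg x) (deg x')) (Poly_Mapping.single (pr (T (x @ x') (z @ z')), pr (T (z @ z') (y @ y'))) 1) \<in> tensor_span"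
        by - (rule modulo_tensor.N_sym, simp add: pm.scale_right_diff_distrib del: scale_single)
    qed
    ultimately show "(\<Sum>z\<in>tuples I (length x). \<Sum>z'\<in>tuples I (length x').
      scale (1 * \<sigma> (deg y - deg z) (deg z' - deg x'))
        (?\<Phi> (pr (T x z)) (pr (T z y)) (pr (T x' z')) (pr (T z' y')))) - comult (T x y * T x' y') \<in> tensor_span"
      by (simp only:)
  qed
  ultimately have "(\<Sum>(a, \<alpha>, b, \<beta>)\<leftarrow>us. \<Sum>(a', \<alpha>', b', \<beta>')\<leftarrow>vs. scale (1 * \<sigma> \<beta> \<alpha>') (?\<Phi> a b a' b')) - comult (p * q) \<in> tensor_span"
    by (simp only:) (rule modulo_tensor.N_trans)
  then show ?thesis by simp
qed

definition \<Delta> where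
  "\<Delta> = (\<lambda>X\<in>carrier A. tensor_class A A (comult (rep X)))"

lemma \<Delta>_pr: "p \<in> carrier F \<Longrightarrow> \<Delta> (pr p) = tensor_class A A (comult p)"
  using comult_J[OF rep_pr[of p]] by (simp add: \<Delta>_def class_eq_iff comult_linear)

lemma gtensor_add: "tensor_class A A p \<oplus>\<^bsub>gtensor \<sigma> A A\<^esub> tensor_class A A q = tensor_class A A (p + q)"
proof (intro equalityI subsetI)
  fix r assume "r \<in> tensor_class A A p \<oplus>\<^bsub>gtensor \<sigma> A A\<^esub> tensor_class A A q"
  then obtain p' q' where *: "r = p' + q'" "p' - p \<in> tensor_span" "q' - q \<in> tensor_span"
    by (auto simp: gtensor_def tensor_class_def)
  show "r \<in> tensor_class A A (p + q)"
    using pm.span_add[OF *(2,3)] by (simp add: *(1) tensor_class_def algebra_simps)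
next
  fix r assume "r \<in> tensor_class A A (p + q)"
  then have "r - q \<in> tensor_class A A p" "q \<in> tensor_class A A q"
    by (simp_all add: tensor_class_def pm.span_zero algebra_simps)
  then have "\<exists>p' q'. r = p' + q' \<and> p' \<in> tensor_class A A p \<and> q' \<in> tensor_class A A q"
    by (intro exI[of _ "r - q"] exI[of _ q]) simp
  then show "r \<in> tensor_class A A p \<oplus>\<^bsub>gtensor \<sigma> A A\<^esub> tensor_class A A q"
    by (simp add: gtensor_def)
qed

lemma gtensor_smult: "c \<odot>\<^bsub>gtensor \<sigma> A A\<^esub> tensor_class A A p = tensor_class A A (scale c p)"
proof -
  have "tensor_class A A (scale c q) = tensor_class A A (scale c p)" if "q \<in> tensor_class A A p" for q
  proof -
    have "scale c q - scale c p \<in> tensor_span"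
      using that pm.span_scale[of "q - p" _ c] by (simp add: tensor_class_def pm.scale_right_diff_distrib)
    then show ?thesis by (simp only: class_eq_iff)
  qed
  moreover have "p \<in> tensor_class A A p"
    by (simp add: tensor_class_def pm.span_zero)
  ultimately show ?thesis
    unfolding gtensor_def galgebra.simps module.simps by blast
qed

lemma gtensor_mult:
  assumes "p \<in> carrier F" "q \<in> carrier F"
  shows "tensor_class A A (comult p) \<otimes>\<^bsub>gtensor \<sigma> A A\<^esub> tensor_class A A (comult q) = tensor_class A A (comult (p * q))"
proof -
  obtain us vs where *: "represents A A us (tensor_class A A (comult p))" "represents A A vs (tensor_class A A (comult q))"
    using represents_comult_exists assms by metis
  have "{tensor_class A A
         (\<Sum>(a, \<alpha>, b, \<beta>)\<leftarrow>us. \<Sum>(a', \<alpha>', b', \<beta>')\<leftarrow>vs.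
           Poly_Mapping.single (a \<otimes>\<^bsub>A\<^esub> a', b \<otimes>\<^bsub>A\<^esub> b') (\<sigma> \<beta> \<alpha>'))
       | us vs. represents A A us (tensor_class A A (comult p)) \<and> represents A A vs (tensor_class A A (comult q))}
       = {tensor_class A A (comult (p * q))}"
    using comult_mult[OF assms] * unfolding class_eq_iff[symmetric] by blast
  then show ?thesis
    by (simp add: gtensor_def)
qed

lemma \<Delta>_hom: "\<Delta> \<in> galgebra_hom A (gtensor \<sigma> A A)"
  unfolding galgebra_hom_def
proof (intro CollectI conjI allI ballI)
  show "\<Delta> \<in> ring_hom A (gtensor \<sigma> A A)"
  proof (rule ring_hom_memI)
    fix X assume "X \<in> carrier A"
    then show "\<Delta> X \<in> carrier (gtensor \<sigma> A A)"
      using comult_carrier by (auto simp: carrier_A \<Delta>_pr gtensor_def)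
    fix Y assume "Y \<in> carrier A"
    show "\<Delta> (X \<otimes>\<^bsub>A\<^esub> Y) = \<Delta> X \<otimes>\<^bsub>gtensor \<sigma> A A\<^esub> \<Delta> Y" "\<Delta> (X \<oplus>\<^bsub>A\<^esub> Y) = \<Delta> X \<oplus>\<^bsub>gtensor \<sigma> A A\<^esub> \<Delta> Y"
      using \<open>X \<in> carrier A\<close> \<open>Y \<in> carrier A\<close>
      by (auto simp: carrier_A A_mult A_add \<Delta>_pr carrier_F_closed gtensor_mult gtensor_add comult_linear)
  next
    have "comult 1 = Poly_Mapping.single (pr 1, pr 1) 1"
      using comult_T[of "[]" "[]"] by (simp add: T_Nil)
    then show "\<Delta> \<one>\<^bsub>A\<^esub> = \<one>\<^bsub>gtensor \<sigma> A A\<^esub>"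
      by (simp add: A_one \<Delta>_pr gtensor_def)
  qed
  show "\<Delta> (c \<odot>\<^bsub>A\<^esub> X) = c \<odot>\<^bsub>gtensor \<sigma> A A\<^esub> \<Delta> X" if "X \<in> carrier A" for c X
    using that by (auto simp: carrier_A A_smult \<Delta>_pr carrier_F_closed gtensor_smult comult_linear)
  show "\<Delta> ` component A \<gamma> \<subseteq> component (gtensor \<sigma> A A) \<gamma>" for \<gamma>
  proof clarify
    fix X assume "X \<in> component A \<gamma>"
    then obtain p where p: "p \<in> component F \<gamma>" "X = pr p"
      by (auto simp: A_component)
    then have "representable {\<gamma>} (comult p)"
      using component_F_carrier by (intro representable_comult) (auto simp: component_F)
    then show "\<Delta> X \<in> component (gtensor \<sigma> A A) \<gamma>"
      using p by (simp add: \<Delta>_pr component_F_carrier representable_def gtensor_def)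
  qed
qed

lemma AR_gen_pr: "AR_gen \<sigma> I \<eta> R i j = pr (free_gen i j)"
  by (simp add: AR_gen_def pr_def J_def)

lemma free_gen_carrier [simp]: "\<lbrakk>i \<in> I; j \<in> I\<rbrakk> \<Longrightarrow> free_gen i j \<in> carrier F"
  by (simp add: free_gen_T carrier_F_closed)

lemma \<Delta>_gen:
  assumes "i \<in> I" "j \<in> I"
  shows "\<Delta> (AR_gen \<sigma> I \<eta> R i j) = tensor_class A A
    (\<Sum>k\<in>I. scale (\<sigma> (\<eta> k - \<eta> i) (\<eta> k - \<eta> j)) (Poly_Mapping.single (AR_gen \<sigma> I \<eta> R i k, AR_gen \<sigma> I \<eta> R k j) 1))"
proof -
  have "comult (free_gen i j) - (\<Sum>k\<in>I. scale (\<sigma> (\<eta> k - \<eta> i) (\<eta> k - \<eta> j)) (Poly_Mapping.single (pr (free_gen i k), pr (free_gen k j)) 1))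
    = (\<Sum>k\<in>I. scale (1 / \<sigma> (\<eta> j - \<eta> i) (\<eta> j)) (Poly_Mapping.single (pr (T [i] [k]), pr (T [k] [j])) 1)) -
     (\<Sum>k\<in>I. scale (\<sigma> (\<eta> k - \<eta> i) (\<eta> k - \<eta> j)) (Poly_Mapping.single (pr (free_gen i k), pr (free_gen k j)) 1))"
    by (subst free_gen_T) (simp add: comult_linear comult_T sum_tuples_Suc pm.scale_sum_right del: scale_single)
  also have "\<dots> \<in> tensor_span"
  proof (rule modulo_tensor.N_sum_cong)
    fix k assume k: "k \<in> I"
    let ?c = "1 / \<sigma> (\<eta> k - \<eta> i) (\<eta> k) * (1 / \<sigma> (\<eta> j - \<eta> k) (\<eta> j))"
    have e: "pr (free_gen i k) = (1 / \<sigma> (\<eta> k - \<eta> i) (\<eta> k)) \<odot>\<^bsub>A\<^esub> pr (T [i] [k])"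
      "pr (free_gen k j) = (1 / \<sigma> (\<eta> j - \<eta> k) (\<eta> j)) \<odot>\<^bsub>A\<^esub> pr (T [k] [j])"
      by (simp_all add: A_smult free_gen_T)
    have "scale (\<sigma> (\<eta> k - \<eta> i) (\<eta> k - \<eta> j)) (Poly_Mapping.single (pr (free_gen i k), pr (free_gen k j)) 1 -
       scale ?c (Poly_Mapping.single (pr (T [i] [k]), pr (T [k] [j])) 1)) \<in> tensor_span"
      unfolding e using k assms by (intro pm.span_scale modulo_tensor.bilin_mod_smult[OF single_bilin]) auto
    moreover have "\<sigma> (\<eta> k - \<eta> i) (\<eta> k - \<eta> j) * ?c = 1 / \<sigma> (\<eta> j - \<eta> i) (\<eta> j)"
      by (rule \<sigma>_comult_gen)
    ultimately show "scale (1 / \<sigma> (\<eta> j - \<eta> i) (\<eta> j)) (Poly_Mapping.single (pr (T [i] [k]), pr (T [k] [j])) 1) -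
     scale (\<sigma> (\<eta> k - \<eta> i) (\<eta> k - \<eta> j)) (Poly_Mapping.single (pr (free_gen i k), pr (free_gen k j)) 1) \<in> tensor_span"
      by - (rule modulo_tensor.N_sym, simp add: pm.scale_right_diff_distrib del: scale_single)
  qed
  finally show ?thesis
    using assms by (simp add: AR_gen_pr \<Delta>_pr class_eq_iff del: scale_single)
qed

lemma T_Cons:
  assumes "i \<in> I" "k \<in> I" "set x \<subseteq> I" "set y \<subseteq> I"
  shows "pr (T (i # x) (k # y)) =
    (\<sigma> (\<eta> k - \<eta> i) (deg x) * \<sigma> (\<eta> k - \<eta> i) (\<eta> k)) \<odot>\<^bsub>A\<^esub> (AR_gen \<sigma> I \<eta> R i k \<otimes>\<^bsub>A\<^esub> pr (T x y))"
  using T_append[of "[i]" "[k]" x y] assms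
  by (simp add: AR_gen_pr A_mult A_smult carrier_F_closed free_gen_T scale_mult_left)

text \<open>\<open>T_Cons\<close> builds every monomial from generators, letter by letter. This
  gives the uniqueness required by the definite descriptions of the coproduct and the
  counit.\<close>

lemma galgebra_hom_eq:
  assumes "h1 \<in> galgebra_hom A B" "h2 \<in> galgebra_hom A B"
    and gen: "\<And>i j. \<lbrakk>i \<in> I; j \<in> I\<rbrakk> \<Longrightarrow> h1 (AR_gen \<sigma> I \<eta> R i j) = h2 (AR_gen \<sigma> I \<eta> R i j)"
    and "X \<in> carrier A"
  shows "h1 X = h2 X"
proof -
  have hom: "h (X \<otimes>\<^bsub>A\<^esub> Y) = h X \<otimes>\<^bsub>B\<^esub> h Y" "h (X \<oplus>\<^bsub>A\<^esub> Y) = h X \<oplus>\<^bsub>B\<^esub> h Y" "h \<one>\<^bsub>A\<^esub> = \<one>\<^bsub>B\<^esub>"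
    "h (c \<odot>\<^bsub>A\<^esub> X) = c \<odot>\<^bsub>B\<^esub> h X" if "h \<in> {h1, h2}" "X \<in> carrier A" "Y \<in> carrier A" for h X Y c
    using that assms(1,2) by (auto simp: galgebra_hom_def ring_hom_def)
  have T: "h1 (pr (T x y)) = h2 (pr (T x y))" if "length x = length y" "set x \<subseteq> I" "set y \<subseteq> I" for x y
    using that
  proof (induction x y rule: list_induct2)
    case Nil
    then show ?case
      using hom(3)[of h1 "pr 1" "pr 1"] hom(3)[of h2 "pr 1" "pr 1"] by (simp add: T_Nil A_one)
  next
    case (Cons i x k y)
    have "AR_gen \<sigma> I \<eta> R i k \<otimes>\<^bsub>A\<^esub> pr (T x y) \<in> carrier A"
      using Cons.prems by (simp add: AR_gen_pr A_mult carrier_F_closed)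
    then show ?case
      using Cons by (simp add: T_Cons hom AR_gen_pr gen[unfolded AR_gen_pr])
  qed
  have "h1 (pr p) = h2 (pr p)" if "p \<in> carrier F" for p
    using that
  proof (induction rule: carrier_F_induct)
    case zero
    \<comment> \<open>Zero is reached as a multiple of a monomial, because preservation of zero is
      not part of being a homomorphism here and \<open>B\<close> is arbitrary.\<close>
    have "pr 0 = 0 \<odot>\<^bsub>A\<^esub> pr (T [] [])" by (simp add: A_smult)
    then show ?case
      using T[of "[]" "[]"] hom(4)[of h1 "pr (T [] [])" "pr 1" 0] hom(4)[of h2 "pr (T [] [])" "pr 1" 0] by simp
  next
    case (step c x y q)
    have "pr (scale c (T x y) + q) = c \<odot>\<^bsub>A\<^esub> pr (T x y) \<oplus>\<^bsub>A\<^esub> pr q" "c \<odot>\<^bsub>A\<^esub> pr (T x y) \<in> carrier A"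
      using step by (simp_all add: A_smult A_add carrier_F_closed)
    then show ?case
      using step T by (simp add: hom)
  qed
  then show ?thesis
    using assms(4) by (auto simp: carrier_A)
qed

lemma AR_coproduct: "AR_coproduct \<sigma> I \<eta> R = \<Delta>"
  unfolding AR_coproduct_def Let_def
proof (rule the_equality)
  show "\<Delta> \<in> extensional (carrier A) \<and> \<Delta> \<in> galgebra_hom A (gtensor \<sigma> A A) \<and>
    (\<forall>i\<in>I. \<forall>j\<in>I. \<Delta> (AR_gen \<sigma> I \<eta> R i j) = tensor_class A A
    (\<Sum>k\<in>I. scale (\<sigma> (\<eta> k - \<eta> i) (\<eta> k - \<eta> j)) (Poly_Mapping.single (AR_gen \<sigma> I \<eta> R i k, AR_gen \<sigma> I \<eta> R k j) 1)))"
    using \<Delta>_hom \<Delta>_gen by (auto simp: \<Delta>_def)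
  fix D assume D: "D \<in> extensional (carrier A) \<and> D \<in> galgebra_hom A (gtensor \<sigma> A A) \<and>
    (\<forall>i\<in>I. \<forall>j\<in>I. D (AR_gen \<sigma> I \<eta> R i j) = tensor_class A A
    (\<Sum>k\<in>I. scale (\<sigma> (\<eta> k - \<eta> i) (\<eta> k - \<eta> j)) (Poly_Mapping.single (AR_gen \<sigma> I \<eta> R i k, AR_gen \<sigma> I \<eta> R k j) 1)))"
  show "D = \<Delta>"
  proof (rule extensionalityI)
    show "D \<in> extensional (carrier A)" "\<Delta> \<in> extensional (carrier A)"
      using D by (auto simp: \<Delta>_def)
    show "D X = \<Delta> X" if "X \<in> carrier A" for X
      by (rule galgebra_hom_eq[OF _ _ _ that, where B = "gtensor \<sigma> A A"]) (use D \<Delta>_hom \<Delta>_gen in simp_all)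
  qed
qed

section \<open>The counit\<close>

definition counit_F :: "(('i \<times> 'i) list \<Rightarrow>\<^sub>0 'k) \<Rightarrow> 'k" where
  "counit_F = wlin (*) (\<lambda>x y. of_bool (x = y))"

lemma counit_F_T: "length x = length y \<Longrightarrow> counit_F (T x y) = of_bool (x = y)"
  by (simp add: counit_F_def)

lemma counit_F_linear: "counit_F (p + q) = counit_F p + counit_F q" "counit_F (scale c p) = c * counit_F p"
  "counit_F (p - q) = counit_F p - counit_F q" "counit_F 0 = 0"
  by (simp_all add: counit_F_def scalar.wlin_linear)

text \<open>The kernel of the counit is the identity matrix, which commutes with
  \<open>C\<close>.\<close>

lemma counit_F_J: "p \<in> J \<Longrightarrow> counit_F p = 0"
proof -
  have "kills_relators (*) {0} (\<lambda>x y. of_bool (x = y) :: 'k)"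
    unfolding kills_relators_def relator_index_def
  proof (intro allI impI, elim conjE)
    fix s' s0 :: "'i list" and i j k l and r' r :: "'i list"
    assume *: "length s' = length s0" "i \<in> I" "j \<in> I" "k \<in> I" "l \<in> I"
    have "(\<Sum>a\<in>I. \<Sum>b\<in>I. C i j a b * of_bool (s' @ a # b # r' = s0 @ k # l # r)) = of_bool (s' = s0 \<and> r' = r) * C i j k l"
    proof -
      have "(\<Sum>a\<in>I. \<Sum>b\<in>I. C i j a b * of_bool (s' @ a # b # r' = s0 @ k # l # r))
        = of_bool (s' = s0 \<and> r' = r) * (\<Sum>a\<in>I. of_bool (a = k) * (\<Sum>b\<in>I. of_bool (b = l) * C i j a b))"
        using * by (simp add: sum_distrib_left of_bool_conj ac_simps del: sum_of_bool_mult_eq sum_mult_of_bool_eq)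
      then show ?thesis
        using * by (simp add: sum_of_bool_left[OF fin] del: sum_of_bool_mult_eq sum_mult_of_bool_eq)
    qed
    moreover have "(\<Sum>a\<in>I. \<Sum>b\<in>I. C a b k l * of_bool (s' @ i # j # r' = s0 @ a # b # r)) = of_bool (s' = s0 \<and> r' = r) * C i j k l"
    proof -
      have "(\<Sum>a\<in>I. \<Sum>b\<in>I. C a b k l * of_bool (s' @ i # j # r' = s0 @ a # b # r))
        = of_bool (s' = s0 \<and> r' = r) * (\<Sum>a\<in>I. of_bool (i = a) * (\<Sum>b\<in>I. of_bool (j = b) * C a b k l))"
        using * by (simp add: sum_distrib_left of_bool_conj ac_simps del: sum_of_bool_mult_eq sum_mult_of_bool_eq)
      then show ?thesis
        using * by (simp add: sum_of_bool_left[OF fin] del: sum_of_bool_mult_eq sum_mult_of_bool_eq)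
    qed
    ultimately show "(\<Sum>a\<in>I. \<Sum>b\<in>I. C i j a b * of_bool (s' @ a # b # r' = s0 @ k # l # r)) -
       (\<Sum>a\<in>I. \<Sum>b\<in>I. C a b k l * of_bool (s' @ i # j # r' = s0 @ a # b # r)) \<in> {0}"
      by simp
  qed
  from scalar.wlin_J[OF this] show "p \<in> J \<Longrightarrow> counit_F p = 0"
    by (simp add: counit_F_def)
qed

definition \<epsilon> where
  "\<epsilon> = (\<lambda>X\<in>carrier A. counit_F (rep X))"

lemma \<epsilon>_pr: "p \<in> carrier F \<Longrightarrow> \<epsilon> (pr p) = counit_F p"
  using counit_F_J[OF rep_pr[of p]] by (simp add: \<epsilon>_def counit_F_linear)

lemma counit_F_mult:
  assumes "p \<in> carrier F" "q \<in> carrier F"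
  shows "counit_F (p * q) = counit_F p * counit_F q"
proof -
  have T: "counit_F (T x y * T x' y') = counit_F (T x y) * counit_F (T x' y')"
    if "length x = length y" "length x' = length y'" for x y x' y'
    using that by (cases "x = y") (auto simp: T_mult counit_F_linear counit_F_T)
  have 1: "counit_F (T x y * q) = counit_F (T x y) * counit_F q" if "length x = length y" for x y
    using assms(2)
    by (induction rule: carrier_F_induct)
      (simp_all add: T[OF that] counit_F_linear ring_distribs scale_mult_right algebra_simps)
  show ?thesis
    using assms(1)
    by (induction rule: carrier_F_induct)
      (simp_all add: 1 counit_F_linear ring_distribs scale_mult_left )
qed

lemma counit_F_component:
  assumes "p \<in> component F \<gamma>" "\<gamma> \<noteq> 0"
  shows "counit_F p = 0"
proof -
  have z: "1 / sg (map fst w) (map snd w) * of_bool (map fst w = map snd w) = 0" if "w \<in> Poly_Mapping.keys p" for w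
  proof -
    have "word_degree \<eta> w = \<gamma>"
      using assms that by (auto simp: component_F)
    then have "deg (map snd w) - deg (map fst w) \<noteq> 0"
      using word_degree_zip[of "map fst w" "map snd w"] assms(2) by (simp add: zip_map_fst_snd)
    then have "map fst w \<noteq> map snd w" by force
    then show ?thesis by (simp del: map_eq_conv)
  qed
  show ?thesis
    unfolding counit_F_def wlin_def lin_def by (intro sum.neutral ballI) (simp only: z mult_zero_right)
qed

lemma AR_counit: "AR_counit \<sigma> I \<eta> R = \<epsilon>"
  unfolding AR_counit_def Let_def
proof (rule the_equality)
  have 1: "counit_F 1 = 1"
    using counit_F_T[of "[]" "[]"] by (simp add: T_Nil)
  have hom: "\<epsilon> \<in> galgebra_hom A base_field"
    unfolding galgebra_hom_def
  proof (intro CollectI conjI allI ballI)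
    show "\<epsilon> \<in> ring_hom A base_field"
      by (rule ring_hom_memI)
        (auto simp: base_field_def carrier_A A_mult A_add A_one \<epsilon>_pr carrier_F_closed counit_F_mult counit_F_linear 1)
    show "\<epsilon> (c \<odot>\<^bsub>A\<^esub> X) = c \<odot>\<^bsub>base_field\<^esub> \<epsilon> X" if "X \<in> carrier A" for c X
      using that by (auto simp: carrier_A A_smult \<epsilon>_pr carrier_F_closed base_field_def counit_F_linear)
    show "\<epsilon> ` component A \<gamma> \<subseteq> component base_field \<gamma>" for \<gamma>
      by (auto simp: base_field_def A_component \<epsilon>_pr component_F_carrier counit_F_component)
  qed
  have gen: "\<epsilon> (AR_gen \<sigma> I \<eta> R i j) = (if i = j then 1 else 0)" if "i \<in> I" "j \<in> I" for i j
    using that by (simp add: AR_gen_pr \<epsilon>_pr) (simp add: free_gen_T counit_F_linear counit_F_T)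
  show "\<epsilon> \<in> extensional (carrier A) \<and> \<epsilon> \<in> galgebra_hom A base_field \<and>
    (\<forall>i\<in>I. \<forall>j\<in>I. \<epsilon> (AR_gen \<sigma> I \<eta> R i j) = (if i = j then 1 else 0))"
    using hom gen by (auto simp: \<epsilon>_def)
  fix e assume e: "e \<in> extensional (carrier A) \<and> e \<in> galgebra_hom A base_field \<and>
    (\<forall>i\<in>I. \<forall>j\<in>I. e (AR_gen \<sigma> I \<eta> R i j) = (if i = j then 1 else 0))"
  show "e = \<epsilon>"
  proof (rule extensionalityI)
    show "e \<in> extensional (carrier A)" "\<epsilon> \<in> extensional (carrier A)"
      using e by (auto simp: \<epsilon>_def)
    show "e X = \<epsilon> X" if "X \<in> carrier A" for X
      by (rule galgebra_hom_eq[OF _ _ _ that, where B = base_field]) (use e hom gen in simp_all)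
  qed
qed

section \<open>Commutation of the generators with the crossing kernels\<close>

text \<open>A relation in \<open>J\<close> survives between outer words once its nonzero terms share
  their row degree and their column degree: concatenation then multiplies every term by the same
  sign \<open>?c\<close>.\<close>

lemma sandwich_J:
  assumes J: "(\<Sum>a\<in>S1. \<Sum>b\<in>S2. scale (f a b) (T (y a b) Y)) - (\<Sum>a\<in>S3. \<Sum>b\<in>S4. scale (g a b) (T Y' (w a b))) \<in> J"
    and y: "\<And>a b. \<lbrakk>a \<in> S1; b \<in> S2\<rbrakk> \<Longrightarrow> length (y a b) = length Y" "\<And>a b. \<lbrakk>a \<in> S1; b \<in> S2; f a b \<noteq> 0\<rbrakk> \<Longrightarrow> deg (y a b) = deg Y'"
    and w: "\<And>a b. \<lbrakk>a \<in> S3; b \<in> S4\<rbrakk> \<Longrightarrow> length (w a b) = length Y'" "\<And>a b. \<lbrakk>a \<in> S3; b \<in> S4; g a b \<noteq> 0\<rbrakk> \<Longrightarrow> deg (w a b) = deg Y"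
    and s: "length s' = length s" "set s' \<subseteq> I" "set s \<subseteq> I" and r: "set r' \<subseteq> I" "set r \<subseteq> I"
  shows "(\<Sum>a\<in>S1. \<Sum>b\<in>S2. scale (f a b) (T (s' @ y a b @ r') (s @ Y @ r))) -
    (\<Sum>a\<in>S3. \<Sum>b\<in>S4. scale (g a b) (T (s' @ Y' @ r') (s @ w a b @ r))) \<in> J"
proof -
  let ?c = "\<sigma> (deg s - deg s') (deg Y' + deg r') * \<sigma> (deg Y - deg Y') (deg r')"
  have 1: "scale (f a b) (T (s' @ y a b @ r') (s @ Y @ r)) = scale ?c (T s' s * scale (f a b) (T (y a b) Y) * T r' r)"
    if "a \<in> S1" "b \<in> S2" for a b
    using that y s by (cases "f a b = 0") (simp_all add: T_append scale_mult_left scale_mult_right mult.assoc mult.commute)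
  have 2: "scale (g a b) (T (s' @ Y' @ r') (s @ w a b @ r)) = scale ?c (T s' s * scale (g a b) (T Y' (w a b)) * T r' r)"
    if "a \<in> S3" "b \<in> S4" for a b
    using that w s by (cases "g a b = 0") (simp_all add: T_append scale_mult_left scale_mult_right mult.assoc mult.commute)
  have "scale ?c (T s' s * ((\<Sum>a\<in>S1. \<Sum>b\<in>S2. scale (f a b) (T (y a b) Y)) -
     (\<Sum>a\<in>S3. \<Sum>b\<in>S4. scale (g a b) (T Y' (w a b)))) * T r' r) \<in> J"
    using s r by (intro J_closed(3) J_mult J T_carrier)
  moreover have "scale ?c (T s' s * ((\<Sum>a\<in>S1. \<Sum>b\<in>S2. scale (f a b) (T (y a b) Y)) -
     (\<Sum>a\<in>S3. \<Sum>b\<in>S4. scale (g a b) (T Y' (w a b)))) * T r' r) =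
    (\<Sum>a\<in>S1. \<Sum>b\<in>S2. scale (f a b) (T (s' @ y a b @ r') (s @ Y @ r))) -
    (\<Sum>a\<in>S3. \<Sum>b\<in>S4. scale (g a b) (T (s' @ Y' @ r') (s @ w a b @ r)))"
    unfolding ring_distribs sum_distrib_left sum_distrib_right pm.scale_right_diff_distrib pm.scale_sum_right
    by (intro arg_cong2[of _ _ _ _ minus] sum.cong[OF refl] 1[symmetric] 2[symmetric])
  ultimately show ?thesis by simp
qed

lemma cross1_deg:
  "\<lbrakk>length z' = length z; set z' \<subseteq> I; set z \<subseteq> I; i' \<in> I; i \<in> I; cross1 I C z' i' i z \<noteq> 0\<rbrakk>
    \<Longrightarrow> deg z' + \<eta> i' = \<eta> i + deg z"
  unfolding deg_def by (rule cross1_homogeneous[OF fin, where X = C]) (simp_all add: C_zero)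

lemma cross_deg:
  "\<lbrakk>length x' = length x; z' \<in> tuples I (length z); set z \<subseteq> I; set x' \<subseteq> I; set x \<subseteq> I; cross I C z' x' x z \<noteq> 0\<rbrakk>
    \<Longrightarrow> deg z' + deg x' = deg x + deg z"
  unfolding deg_def by (rule cross_homogeneous[OF fin, where X = C]) (simp_all add: C_zero)

lemma cross_inv_deg:
  "\<lbrakk>length x' = length x; z' \<in> tuples I (length z); set z \<subseteq> I; set x' \<subseteq> I; set x \<subseteq> I; cross I C_inv z' x' x z \<noteq> 0\<rbrakk>
    \<Longrightarrow> deg z' + deg x' = deg x + deg z"
  unfolding deg_def by (rule cross_homogeneous[OF fin, where X = C_inv]) (simp_all add: C_inv_zero)

text \<open>A crossing of two letters commutes with \<open>T\<close> by a relator. The strand passes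
  the first letter of \<open>z\<close> in this way, and the remaining letters by induction inside
  \<open>sandwich_J\<close>.\<close>

lemma cross1_T:
  assumes "length z' = length z" "set z' \<subseteq> I" "set z \<subseteq> I" "i' \<in> I" "i \<in> I"
  shows "(\<Sum>j\<in>I. \<Sum>v\<in>tuples I (length z). scale (cross1 I C z' i' j v) (T (j # v) (i # z))) -
    (\<Sum>v\<in>tuples I (length z). \<Sum>j\<in>I. scale (cross1 I C v j i z) (T (z' @ [i']) (v @ [j]))) \<in> J"
  using assms
proof (induction z' z arbitrary: i rule: list_induct2)
  case Nil
  have "(\<Sum>j\<in>I. scale (of_bool (i' = j)) (T [j] [i])) = (\<Sum>j\<in>I. if i' = j then T [i'] [i] else 0)"
    by (intro sum.cong) auto
  moreover have "(\<Sum>j\<in>I. scale (of_bool (j = i)) (T [i'] [j])) = (\<Sum>j\<in>I. if j = i then T [i'] [i] else 0)"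
    by (intro sum.cong) auto
  ultimately show ?case
    using Nil fin by (simp add: J_closed)
next
  case (Cons c' z' c z)
  let ?T = "tuples I (length z)"
  have I: "c' \<in> I" "c \<in> I" "set z' \<subseteq> I" "set z \<subseteq> I" using Cons.prems by auto
  let ?A = "\<Sum>j\<in>I. \<Sum>v\<in>tuples I (length (c # z)). scale (cross1 I C (c' # z') i' j v) (T (j # v) (i # c # z))"
  let ?B = "\<Sum>v\<in>tuples I (length (c # z)). \<Sum>j\<in>I. scale (cross1 I C v j i (c # z)) (T ((c' # z') @ [i']) (v @ [j]))"
  \<comment> \<open>Here the crossing of the two leading letters has been moved from the row indices
    of \<open>T\<close> to the column indices, the crossings with the rest of \<open>z\<close> not
    yet.\<close>
  let ?M = "\<Sum>h\<in>I. \<Sum>v\<in>?T. \<Sum>a\<in>I. \<Sum>b\<in>I. scale (cross1 I C z' i' h v * C a b i c) (T (c' # h # v) (a # b # z))"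
  have "?A = (\<Sum>j\<in>I. \<Sum>d\<in>I. \<Sum>v\<in>?T. \<Sum>h\<in>I. scale (cross1 I C z' i' h v * C c' h j d) (T (j # d # v) (i # c # z)))"
    by (simp add: sum_tuples_Suc pm.scale_sum_left mult.commute)
  also have "\<dots> = (\<Sum>v\<in>?T. \<Sum>h\<in>I. \<Sum>j\<in>I. \<Sum>d\<in>I. scale (cross1 I C z' i' h v * C c' h j d) (T (j # d # v) (i # c # z)))"
    by (rule sum_pairs_swap)
  also have "\<dots> = (\<Sum>h\<in>I. \<Sum>v\<in>?T. \<Sum>j\<in>I. \<Sum>d\<in>I. scale (cross1 I C z' i' h v * C c' h j d) (T (j # d # v) (i # c # z)))"
    by (rule sum.swap)
  finally have A: "?A = \<dots>" .
  have 1: "?A - ?M \<in> J"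
    unfolding A
  proof (rule modulo_J.N_sum_cong, rule modulo_J.N_sum_cong)
    fix h v assume "h \<in> I" "v \<in> ?T"
    then have "relator_index [] [] c' h i c v z"
      using I Cons.prems by (auto simp: relator_index_def tuples_def)
    then have "scale (cross1 I C z' i' h v) (relator [] [] c' h i c v z) \<in> J"
      using relators_J unfolding relators_def by (intro J_closed(3)) blast
    then show "(\<Sum>j\<in>I. \<Sum>d\<in>I. scale (cross1 I C z' i' h v * C c' h j d) (T (j # d # v) (i # c # z))) -
      (\<Sum>a\<in>I. \<Sum>b\<in>I. scale (cross1 I C z' i' h v * C a b i c) (T (c' # h # v) (a # b # z))) \<in> J"
      by (simp add: relator_def pm.scale_right_diff_distrib pm.scale_sum_right)
  qed
  have M: "?M = (\<Sum>a\<in>I. \<Sum>b\<in>I. scale (C a b i c) (\<Sum>h\<in>I. \<Sum>v\<in>?T. scale (cross1 I C z' i' h v) (T ([c'] @ (h # v) @ []) ([a] @ (b # z) @ []))))"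
    by (subst sum_pairs_swap) (simp add: pm.scale_sum_right mult.commute)
  have "?B = (\<Sum>a\<in>I. \<Sum>v\<in>?T. \<Sum>h\<in>I. \<Sum>b\<in>I. scale (C a b i c * cross1 I C v h b z) (T ([c'] @ (z' @ [i']) @ []) ([a] @ (v @ [h]) @ [])))"
    by (simp add: sum_tuples_Suc pm.scale_sum_left)
  also have "\<dots> = (\<Sum>a\<in>I. \<Sum>b\<in>I. \<Sum>v\<in>?T. \<Sum>h\<in>I. scale (C a b i c * cross1 I C v h b z) (T ([c'] @ (z' @ [i']) @ []) ([a] @ (v @ [h]) @ [])))"
    by (intro sum.cong[OF refl] sum_rotate)
  also have "\<dots> = (\<Sum>a\<in>I. \<Sum>b\<in>I. scale (C a b i c) (\<Sum>v\<in>?T. \<Sum>h\<in>I. scale (cross1 I C v h b z) (T ([c'] @ (z' @ [i']) @ []) ([a] @ (v @ [h]) @ []))))"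
    by (simp add: pm.scale_sum_right)
  finally have B: "?B = \<dots>" .
  have 2: "?M - ?B \<in> J"
    unfolding M B
  proof (rule modulo_J.N_sum_cong, rule modulo_J.N_sum_cong)
    fix a b assume ab: "a \<in> I" "b \<in> I"
    have IH: "(\<Sum>j\<in>I. \<Sum>v\<in>?T. scale (cross1 I C z' i' j v) (T (j # v) (b # z))) -
      (\<Sum>v\<in>?T. \<Sum>j\<in>I. scale (cross1 I C v j b z) (T (z' @ [i']) (v @ [j]))) \<in> J"
      using Cons ab I by simp
    have "(\<Sum>h\<in>I. \<Sum>v\<in>?T. scale (cross1 I C z' i' h v) (T ([c'] @ (h # v) @ []) ([a] @ (b # z) @ []))) -
      (\<Sum>v\<in>?T. \<Sum>h\<in>I. scale (cross1 I C v h b z) (T ([c'] @ (z' @ [i']) @ []) ([a] @ (v @ [h]) @ []))) \<in> J"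
    proof (rule sandwich_J[OF IH])
      fix h v assume "h \<in> I" "v \<in> ?T" "cross1 I C z' i' h v \<noteq> 0"
      then show "deg (h # v) = deg (z' @ [i'])"
        using cross1_deg[of z' v i' h] I Cons.hyps Cons.prems by (auto simp: tuples_def)
    next
      fix v h assume "h \<in> I" "v \<in> ?T" "cross1 I C v h b z \<noteq> 0"
      then show "deg (v @ [h]) = deg (b # z)"
        using cross1_deg[of v z h b] I ab by (auto simp: tuples_def)
    qed (use I ab Cons.hyps in \<open>auto simp: tuples_def\<close>)
    then show "scale (C a b i c) (\<Sum>h\<in>I. \<Sum>v\<in>?T. scale (cross1 I C z' i' h v) (T ([c'] @ (h # v) @ []) ([a] @ (b # z) @ []))) -
      scale (C a b i c) (\<Sum>v\<in>?T. \<Sum>h\<in>I. scale (cross1 I C v h b z) (T ([c'] @ (z' @ [i']) @ []) ([a] @ (v @ [h]) @ []))) \<in> J"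
      unfolding pm.scale_right_diff_distrib[symmetric] by (rule J_closed(3))
  qed
  show ?case by (rule modulo_J.N_trans[OF 1 2])
qed

text \<open>Up to signs this is quasi-commutativity on monomials. The moving strands are treated one
  at a time: the tail by induction, then the head by \<open>cross1_T\<close>.\<close>

lemma cross_T:
  assumes "length x' = length x" "z' \<in> tuples I (length z)" "set z \<subseteq> I" "set x' \<subseteq> I" "set x \<subseteq> I"
  shows "(\<Sum>u\<in>tuples I (length x). \<Sum>v\<in>tuples I (length z). scale (cross I C z' x' u v) (T (u @ v) (x @ z))) -
    (\<Sum>u\<in>tuples I (length x). \<Sum>v\<in>tuples I (length z). scale (cross I C v u x z) (T (z' @ x') (v @ u))) \<in> J"
  using assms
proof (induction x' x arbitrary: z' rule: list_induct2)
  case Nil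
  have "(\<Sum>v\<in>tuples I (length z). scale (of_bool (z' = v)) (T v z)) = (\<Sum>v\<in>tuples I (length z). if z' = v then T z' z else 0)"
    by (intro sum.cong) auto
  moreover have "(\<Sum>v\<in>tuples I (length z). scale (of_bool (v = z)) (T z' v)) = (\<Sum>v\<in>tuples I (length z). if v = z then T z' z else 0)"
    by (intro sum.cong) auto
  moreover have "z \<in> tuples I (length z)" using Nil by (simp add: tuples_def)
  ultimately show ?case
    using Nil finite_tuples[OF fin] by (simp add: J_closed)
next
  case (Cons i' x' i x)
  let ?Z = "tuples I (length z)" and ?X = "tuples I (length x)"
  have I: "i' \<in> I" "i \<in> I" "set x' \<subseteq> I" "set x \<subseteq> I" using Cons.prems by auto
  have z': "length z' = length z" "set z' \<subseteq> I" using Cons.prems by (auto simp: tuples_def)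
  let ?A = "\<Sum>u\<in>tuples I (length (i # x)). \<Sum>v\<in>?Z. scale (cross I C z' (i' # x') u v) (T (u @ v) ((i # x) @ z))"
  let ?B = "\<Sum>u\<in>tuples I (length (i # x)). \<Sum>v\<in>?Z. scale (cross I C v u (i # x) z) (T (z' @ i' # x') (v @ u))"
  have "?A = (\<Sum>j\<in>I. \<Sum>u\<in>?X. \<Sum>v\<in>?Z. \<Sum>w\<in>?Z. scale (cross1 I C z' i' j w * cross I C w x' u v) (T (j # u @ v) (i # x @ z)))"
    by (simp add: sum_tuples_Suc pm.scale_sum_left tuples_length)
  also have "\<dots> = (\<Sum>j\<in>I. \<Sum>w\<in>?Z. \<Sum>u\<in>?X. \<Sum>v\<in>?Z. scale (cross1 I C z' i' j w * cross I C w x' u v) (T (j # u @ v) (i # x @ z)))"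
    by (intro sum.cong[OF refl] sum_rotate)
  also have "\<dots> = (\<Sum>j\<in>I. \<Sum>w\<in>?Z. scale (cross1 I C z' i' j w) (\<Sum>u\<in>?X. \<Sum>v\<in>?Z. scale (cross I C w x' u v) (T ([j] @ (u @ v) @ []) ([i] @ (x @ z) @ []))))"
    by (simp add: pm.scale_sum_right)
  finally have A: "?A = \<dots>" .
  \<comment> \<open>The crossings of the tail have reached the column side, those of the head still
    act on the rows.\<close>
  let ?M = "\<Sum>j\<in>I. \<Sum>w\<in>?Z. scale (cross1 I C z' i' j w) (\<Sum>u\<in>?X. \<Sum>v\<in>?Z. scale (cross I C v u x z) (T ([j] @ (w @ x') @ []) ([i] @ (v @ u) @ [])))"
  have 1: "?A - ?M \<in> J"
    unfolding A
  proof (rule modulo_J.N_sum_cong, rule modulo_J.N_sum_cong)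
    fix j w assume jw: "j \<in> I" "w \<in> ?Z"
    have IH: "(\<Sum>u\<in>?X. \<Sum>v\<in>?Z. scale (cross I C w x' u v) (T (u @ v) (x @ z))) -
       (\<Sum>u\<in>?X. \<Sum>v\<in>?Z. scale (cross I C v u x z) (T (w @ x') (v @ u))) \<in> J"
      using Cons.IH jw Cons.prems I by blast
    have "(\<Sum>u\<in>?X. \<Sum>v\<in>?Z. scale (cross I C w x' u v) (T ([j] @ (u @ v) @ []) ([i] @ (x @ z) @ []))) -
      (\<Sum>u\<in>?X. \<Sum>v\<in>?Z. scale (cross I C v u x z) (T ([j] @ (w @ x') @ []) ([i] @ (v @ u) @ []))) \<in> J"
    proof (rule sandwich_J[OF IH])
      fix u v assume "u \<in> ?X" "v \<in> ?Z" "cross I C w x' u v \<noteq> 0"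
      then show "deg (u @ v) = deg (w @ x')"
        using cross_deg[of x' u w v] I jw Cons.hyps by (auto simp: tuples_def)
    next
      fix u v assume "u \<in> ?X" "v \<in> ?Z" "cross I C v u x z \<noteq> 0"
      then show "deg (v @ u) = deg (x @ z)"
        using cross_deg[of u x v z] I jw Cons.prems by (auto simp: tuples_def)
    qed (use I jw Cons.hyps Cons.prems in \<open>auto simp: tuples_def\<close>)
    then show "scale (cross1 I C z' i' j w) (\<Sum>u\<in>?X. \<Sum>v\<in>?Z. scale (cross I C w x' u v) (T ([j] @ (u @ v) @ []) ([i] @ (x @ z) @ []))) -
      scale (cross1 I C z' i' j w) (\<Sum>u\<in>?X. \<Sum>v\<in>?Z. scale (cross I C v u x z) (T ([j] @ (w @ x') @ []) ([i] @ (v @ u) @ []))) \<in> J"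
      unfolding pm.scale_right_diff_distrib[symmetric] by (rule J_closed(3))
  qed
  have M: "?M = (\<Sum>u\<in>?X. \<Sum>v\<in>?Z. scale (cross I C v u x z) (\<Sum>j\<in>I. \<Sum>w\<in>?Z. scale (cross1 I C z' i' j w) (T ([] @ (j # w) @ x') ([] @ (i # v) @ u))))"
    unfolding pm.scale_sum_right by (subst sum_pairs_swap) (simp add: mult.commute)
  have "?B = (\<Sum>j\<in>I. \<Sum>u\<in>?X. \<Sum>w\<in>?Z. \<Sum>v\<in>?Z. scale (cross1 I C w j i v * cross I C v u x z) (T ([] @ (z' @ [i']) @ x') ([] @ (w @ [j]) @ u)))"
    by (simp add: sum_tuples_Suc pm.scale_sum_left)
  also have "\<dots> = (\<Sum>j\<in>I. \<Sum>v\<in>?Z. \<Sum>u\<in>?X. \<Sum>w\<in>?Z. scale (cross1 I C w j i v * cross I C v u x z) (T ([] @ (z' @ [i']) @ x') ([] @ (w @ [j]) @ u)))"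
    by (intro sum.cong[OF refl] sum_rotate)
  also have "\<dots> = (\<Sum>u\<in>?X. \<Sum>w\<in>?Z. \<Sum>j\<in>I. \<Sum>v\<in>?Z. scale (cross1 I C w j i v * cross I C v u x z) (T ([] @ (z' @ [i']) @ x') ([] @ (w @ [j]) @ u)))"
    by (rule sum_pairs_swap)
  also have "\<dots> = (\<Sum>u\<in>?X. \<Sum>v\<in>?Z. \<Sum>w\<in>?Z. \<Sum>j\<in>I. scale (cross1 I C w j i v * cross I C v u x z) (T ([] @ (z' @ [i']) @ x') ([] @ (w @ [j]) @ u)))"
    by (intro sum.cong[OF refl] sum_rotate)
  also have "\<dots> = (\<Sum>u\<in>?X. \<Sum>v\<in>?Z. scale (cross I C v u x z) (\<Sum>w\<in>?Z. \<Sum>j\<in>I. scale (cross1 I C w j i v) (T ([] @ (z' @ [i']) @ x') ([] @ (w @ [j]) @ u))))"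
    unfolding pm.scale_sum_right by (simp add: mult.commute)
  finally have B: "?B = \<dots>" .
  have 2: "?M - ?B \<in> J"
    unfolding M B
  proof (rule modulo_J.N_sum_cong, rule modulo_J.N_sum_cong)
    fix u v assume uv: "u \<in> ?X" "v \<in> ?Z"
    then have v: "length v = length z" "set v \<subseteq> I" "length u = length x" "set u \<subseteq> I" by (auto simp: tuples_def)
    have c1: "(\<Sum>j\<in>I. \<Sum>w\<in>?Z. scale (cross1 I C z' i' j w) (T (j # w) (i # v))) -
      (\<Sum>w\<in>?Z. \<Sum>j\<in>I. scale (cross1 I C w j i v) (T (z' @ [i']) (w @ [j]))) \<in> J"
      using cross1_T[of z' v i' i] I z' v by simp
    have "(\<Sum>j\<in>I. \<Sum>w\<in>?Z. scale (cross1 I C z' i' j w) (T ([] @ (j # w) @ x') ([] @ (i # v) @ u))) -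
      (\<Sum>w\<in>?Z. \<Sum>j\<in>I. scale (cross1 I C w j i v) (T ([] @ (z' @ [i']) @ x') ([] @ (w @ [j]) @ u))) \<in> J"
    proof (rule sandwich_J[OF c1])
      fix j w assume "j \<in> I" "w \<in> ?Z" "cross1 I C z' i' j w \<noteq> 0"
      then show "deg (j # w) = deg (z' @ [i'])"
        using cross1_deg[of z' w i' j] I z' by (auto simp: tuples_def)
    next
      fix w j assume "w \<in> ?Z" "j \<in> I" "cross1 I C w j i v \<noteq> 0"
      then show "deg (w @ [j]) = deg (i # v)"
        using cross1_deg[of w v j i] I v by (auto simp: tuples_def)
    qed (use I z' v in \<open>auto simp: tuples_def\<close>)
    then show "scale (cross I C v u x z) (\<Sum>j\<in>I. \<Sum>w\<in>?Z. scale (cross1 I C z' i' j w) (T ([] @ (j # w) @ x') ([] @ (i # v) @ u))) -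
      scale (cross I C v u x z) (\<Sum>w\<in>?Z. \<Sum>j\<in>I. scale (cross1 I C w j i v) (T ([] @ (z' @ [i']) @ x') ([] @ (w @ [j]) @ u))) \<in> J"
      unfolding pm.scale_right_diff_distrib[symmetric] by (rule J_closed(3))
  qed
  show ?case by (rule modulo_J.N_trans[OF 1 2])
qed

section \<open>Bilinear forms from kernels\<close>

abbreviation AR0 where "AR0 \<equiv> AR \<sigma> I \<eta> R"

lemma AR_simps [simp]:
  "carrier AR0 = carrier A" "(X \<otimes>\<^bsub>AR0\<^esub> Y) = (X \<otimes>\<^bsub>A\<^esub> Y)" "(X \<oplus>\<^bsub>AR0\<^esub> Y) = (X \<oplus>\<^bsub>A\<^esub> Y)"
  "\<one>\<^bsub>AR0\<^esub> = \<one>\<^bsub>A\<^esub>" "\<zero>\<^bsub>AR0\<^esub> = \<zero>\<^bsub>A\<^esub>" "(c \<odot>\<^bsub>AR0\<^esub> X) = (c \<odot>\<^bsub>A\<^esub> X)" "component AR0 = component A"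
  "coproduct AR0 = \<Delta>" "counit AR0 = \<epsilon>"
  by (simp_all add: AR_def galgebra.defs gbialgebra.defs AR_coproduct AR_counit)

lemma tensor_class_AR: "tensor_class AR0 AR0 = tensor_class A A"
  by (intro ext) (simp add: tensor_class_def tensor_relations_def)

lemma represents_AR: "represents AR0 AR0 = represents A A"
  by (intro ext) (simp add: represents_def tensor_class_AR)

definition bform :: "('i list \<Rightarrow> 'i list \<Rightarrow> 'i list \<Rightarrow> 'i list \<Rightarrow> 'k) \<Rightarrow>
    (('i \<times> 'i) list \<Rightarrow>\<^sub>0 'k) set \<times> (('i \<times> 'i) list \<Rightarrow>\<^sub>0 'k) set \<Rightarrow> 'k" where
  "bform K = (\<lambda>(X, Y)\<in>carrier A \<times> carrier A. wlin (*) (\<lambda>x' x. wlin (*) (\<lambda>z' z. K x' x z' z) (rep Y)) (rep X))"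

definition compatible :: "('i list \<Rightarrow> 'i list \<Rightarrow> 'k) \<Rightarrow> bool" where
  "compatible k \<longleftrightarrow> kills_relators (*) {0} k"

definition form_kernel :: "('i list \<Rightarrow> 'i list \<Rightarrow> 'i list \<Rightarrow> 'i list \<Rightarrow> 'k) \<Rightarrow> bool" where
  "form_kernel K \<longleftrightarrow> (\<forall>z' z. length z' = length z \<and> set z' \<subseteq> I \<and> set z \<subseteq> I \<longrightarrow>
    compatible (\<lambda>x' x. K x' x z' z) \<and> compatible (\<lambda>x' x. K z' z x' x))"

lemma wlin_swap: "wlin (*) (\<lambda>x' x. wlin (*) (\<lambda>z' z. K x' x z' z) q) p = wlin (*) (\<lambda>z' z. wlin (*) (\<lambda>x' x. K x' x z' z) p) (q :: _ \<Rightarrow>\<^sub>0 'k)"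
  unfolding wlin_def lin_def sum_distrib_left by (subst sum.swap) (simp add: ac_simps)

lemma wlin_zero_fun:
  assumes "p \<in> carrier F" "\<And>x y. \<lbrakk>length x = length y; set x \<subseteq> I; set y \<subseteq> I\<rbrakk> \<Longrightarrow> K x y = (0 :: 'k)"
  shows "wlin (*) K p = 0"
  using scalar.wlin_cong_mod[OF assms(1), of K "\<lambda>_ _. 0"] assms(2) by (simp add: wlin_def lin_def)

lemma wlin_cong:
  assumes "p \<in> carrier F" "\<And>x y. \<lbrakk>length x = length y; set x \<subseteq> I; set y \<subseteq> I\<rbrakk> \<Longrightarrow> K x y = (L x y :: 'k)"
  shows "wlin (*) K p = wlin (*) L p"
  using scalar.wlin_cong_mod[OF assms(1), of K L] assms(2) by simp

text \<open>For a \<open>form_kernel\<close> the double linear extension vanishes as soon as either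
  argument lies in \<open>J\<close>, so the representatives chosen by \<open>rep\<close> do not
  matter.\<close>

lemma bform_pr:
  assumes K: "form_kernel K" and "p \<in> carrier F" "q \<in> carrier F"
  shows "bform K (pr p, pr q) = wlin (*) (\<lambda>x' x. wlin (*) (\<lambda>z' z. K x' x z' z) q) p"
proof -
  have k1: "wlin (*) (\<lambda>x' x. wlin (*) (\<lambda>z' z. K x' x z' z) q) p = 0" if "p \<in> J" "q \<in> carrier F" for p q
    unfolding wlin_swap[of K q p]
  proof (rule wlin_zero_fun[OF that(2)])
    fix z' z assume "length z' = length z" "set z' \<subseteq> I" "set z \<subseteq> I"
    then have "kills_relators (*) {0} (\<lambda>x' x. K x' x z' z)"
      using K by (auto simp: form_kernel_def compatible_def)
    from scalar.wlin_J[OF this that(1)] show "wlin (*) (\<lambda>x' x. K x' x z' z) p = 0"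
      by simp
  qed
  have k2: "wlin (*) (\<lambda>x' x. wlin (*) (\<lambda>z' z. K x' x z' z) q) p = 0" if "q \<in> J" "p \<in> carrier F" for p q
  proof (rule wlin_zero_fun[OF that(2)])
    fix x' x assume "length x' = length x" "set x' \<subseteq> I" "set x \<subseteq> I"
    then have "kills_relators (*) {0} (\<lambda>z' z. K x' x z' z)"
      using K by (auto simp: form_kernel_def compatible_def)
    from scalar.wlin_J[OF this that(1)] show "wlin (*) (\<lambda>z' z. K x' x z' z) q = 0"
      by simp
  qed
  have rq: "rep (pr q) \<in> carrier F" using assms rep[of "pr q"] by simp
  have "wlin (*) (\<lambda>x' x. wlin (*) (\<lambda>z' z. K x' x z' z) (rep (pr q))) (rep (pr p) - p) = 0"
    by (rule k1[OF rep_pr[OF assms(2)] rq])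
  moreover have "wlin (*) (\<lambda>x' x. wlin (*) (\<lambda>z' z. K x' x z' z) (rep (pr q) - q)) p = 0"
    by (rule k2[OF rep_pr[OF assms(3)] assms(2)])
  then have "wlin (*) (\<lambda>x' x. wlin (*) (\<lambda>z' z. K x' x z' z) (rep (pr q))) p
     = wlin (*) (\<lambda>x' x. wlin (*) (\<lambda>z' z. K x' x z' z) q) p"
    unfolding wlin_swap[of K _ p] by (simp add: scalar.wlin_linear)
  ultimately show ?thesis
    using assms by (simp add: bform_def scalar.wlin_linear)
qed

definition bilinear_on_A :: "((('i \<times> 'i) list \<Rightarrow>\<^sub>0 'k) set \<times> (('i \<times> 'i) list \<Rightarrow>\<^sub>0 'k) set \<Rightarrow> 'k) \<Rightarrow> bool" where
  "bilinear_on_A \<rho> \<longleftrightarrow> (\<forall>X\<in>carrier A. \<forall>p\<in>carrier F. \<forall>q\<in>carrier F. \<forall>c.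
    \<rho> (X, pr (scale c p + q)) = c * \<rho> (X, pr p) + \<rho> (X, pr q) \<and>
    \<rho> (pr (scale c p + q), X) = c * \<rho> (pr p, X) + \<rho> (pr q, X))"

lemma bilinear_form_iff: "bilinear_form A \<rho> \<longleftrightarrow> \<rho> \<in> extensional (carrier A \<times> carrier A) \<and> bilinear_on_A \<rho>"
proof
  assume \<rho>: "bilinear_form A \<rho>"
  have "\<rho> (X, pr (scale c p + q)) = c * \<rho> (X, pr p) + \<rho> (X, pr q) \<and>
    \<rho> (pr (scale c p + q), X) = c * \<rho> (pr p, X) + \<rho> (pr q, X)" if "X \<in> carrier A" "p \<in> carrier F" "q \<in> carrier F" for X p q c
  proof -
    have "pr (scale c p + q) = c \<odot>\<^bsub>A\<^esub> pr p \<oplus>\<^bsub>A\<^esub> pr q" "c \<odot>\<^bsub>A\<^esub> pr p \<in> carrier A"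
      using that by (simp_all add: A_smult A_add carrier_F_closed)
    then show ?thesis using \<rho> that by (simp add: bilinear_form_def)
  qed
  then show "\<rho> \<in> extensional (carrier A \<times> carrier A) \<and> bilinear_on_A \<rho>"
    using \<rho> unfolding bilinear_on_A_def bilinear_form_def by blast
next
  assume "\<rho> \<in> extensional (carrier A \<times> carrier A) \<and> bilinear_on_A \<rho>"
  then have e: "\<rho> \<in> extensional (carrier A \<times> carrier A)"
    and b: "\<And>X p q c. \<lbrakk>X \<in> carrier A; p \<in> carrier F; q \<in> carrier F\<rbrakk> \<Longrightarrow> \<rho> (X, pr (scale c p + q)) = c * \<rho> (X, pr p) + \<rho> (X, pr q)"
      "\<And>X p q c. \<lbrakk>X \<in> carrier A; p \<in> carrier F; q \<in> carrier F\<rbrakk> \<Longrightarrow> \<rho> (pr (scale c p + q), X) = c * \<rho> (pr p, X) + \<rho> (pr q, X)"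
    by (auto simp: bilinear_on_A_def)
  have z: "\<rho> (X, pr 0) = 0" "\<rho> (pr 0, X) = 0" if "X \<in> carrier A" for X
    using b[OF that, of 0 0 1] carrier_F_closed(1) by simp_all
  have add: "\<rho> (X, Y \<oplus>\<^bsub>A\<^esub> Y') = \<rho> (X, Y) + \<rho> (X, Y')" "\<rho> (Y \<oplus>\<^bsub>A\<^esub> Y', X) = \<rho> (Y, X) + \<rho> (Y', X)"
    if XY: "X \<in> carrier A" "Y \<in> carrier A" "Y' \<in> carrier A" for X Y Y'
  proof -
    obtain p q where "p \<in> carrier F" "Y = pr p" "q \<in> carrier F" "Y' = pr q"
      using XY by (auto simp: carrier_A)
    then show "\<rho> (X, Y \<oplus>\<^bsub>A\<^esub> Y') = \<rho> (X, Y) + \<rho> (X, Y')" "\<rho> (Y \<oplus>\<^bsub>A\<^esub> Y', X) = \<rho> (Y, X) + \<rho> (Y', X)"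
      using b[OF XY(1), of p q 1] by (simp_all add: A_add)
  qed
  moreover have "\<rho> (X, c \<odot>\<^bsub>A\<^esub> Y) = c * \<rho> (X, Y)" "\<rho> (c \<odot>\<^bsub>A\<^esub> Y, X) = c * \<rho> (Y, X)"
    if XY: "X \<in> carrier A" "Y \<in> carrier A" for X Y c
  proof -
    obtain p where "p \<in> carrier F" "Y = pr p"
      using XY by (auto simp: carrier_A)
    then show "\<rho> (X, c \<odot>\<^bsub>A\<^esub> Y) = c * \<rho> (X, Y)" "\<rho> (c \<odot>\<^bsub>A\<^esub> Y, X) = c * \<rho> (Y, X)"
      using b[OF XY(1), of p 0 c] z[OF XY(1)] carrier_F_closed(1) by (simp_all add: A_smult)
  qed
  ultimately show "bilinear_form A \<rho>"
    using e by (simp add: bilinear_form_def)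
qed

lemma bform_bilinear:
  assumes K: "form_kernel K"
  shows "bilinear_form A (bform K)"
  unfolding bilinear_form_iff
proof
  show "bform K \<in> extensional (carrier A \<times> carrier A)"
    by (simp add: bform_def)
  show "bilinear_on_A (bform K)"
    unfolding bilinear_on_A_def
  proof (intro ballI allI)
    fix X p q c assume X: "X \<in> carrier A" and pq: "p \<in> carrier F" "q \<in> carrier F"
    obtain r where r: "r \<in> carrier F" "X = pr r" using X by (auto simp: carrier_A)
    have s: "scale c p + q \<in> carrier F" using pq by (simp add: carrier_F_closed)
    note b = bform_pr[OF K]
    show "bform K (X, pr (scale c p + q)) = c * bform K (X, pr p) + bform K (X, pr q) \<and>
       bform K (pr (scale c p + q), X) = c * bform K (pr p, X) + bform K (pr q, X)"
      unfolding r b[OF r(1) s] b[OF r(1) pq(1)] b[OF r(1) pq(2)] b[OF s r(1)] b[OF pq(1) r(1)] b[OF pq(2) r(1)]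
      unfolding wlin_swap[of K _ r] by (simp add: scalar.wlin_linear) 
  qed
qed

lemma bform_degree_zero:
  assumes K: "form_kernel K"
    and deg: "\<And>x' x z' z. \<lbrakk>length x' = length x; set x' \<subseteq> I; set x \<subseteq> I; length z' = length z; set z' \<subseteq> I; set z \<subseteq> I;
      K x' x z' z \<noteq> 0\<rbrakk> \<Longrightarrow> (deg x - deg x') + (deg z - deg z') = 0"
  shows "form_degree_zero A (bform K)"
  unfolding form_degree_zero_def
proof (intro allI ballI impI)
  fix \<alpha> \<beta> X Y assume "X \<in> component A \<alpha>" "Y \<in> component A \<beta>" and ne: "\<alpha> + \<beta> \<noteq> 0"
  then obtain p q where pq: "p \<in> component F \<alpha>" "X = pr p" "q \<in> component F \<beta>" "Y = pr q"
    by (auto simp: A_component)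
  note b = bform_pr[OF K]
  have "wlin (*) (\<lambda>z' z. K x' x z' z) q = 0" if x: "length x' = length x" "set x' \<subseteq> I" "set x \<subseteq> I" "deg x - deg x' = \<alpha>" for x' x
    using pq(3)
  proof (induction rule: component_F_induct)
    case (step c y z q)
    then have "K x' x y z = 0" using deg[OF x(1-3), of y z] x ne by auto
    then show ?case using step by (simp add: scalar.wlin_linear)
  qed (simp add: scalar.wlin_linear)
  note 0 = this
  from pq(1) have "wlin (*) (\<lambda>x' x. wlin (*) (\<lambda>z' z. K x' x z' z) q) p = 0"
  proof (induction p rule: component_F_induct)
    case (step c y z q)
    then show ?case by (simp add: scalar.wlin_linear 0)
  qed (simp add: scalar.wlin_linear)
  then show "bform K (X, Y) = 0"
    using pq b[of p q] by (simp add: component_F_carrier)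
qed

text \<open>Nonzero entries of \<open>C\<close> preserve degree, so a weight that depends on the
  words through their degrees only has one value in all terms and factors out.\<close>

lemma compatible_weight:
  assumes "\<And>s' s i j k l r' r. relator_index s' s i j k l r' r \<Longrightarrow>
     (\<Sum>a\<in>I. \<Sum>b\<in>I. C i j a b * K (s' @ a # b # r') (s @ k # l # r)) =
     (\<Sum>a\<in>I. \<Sum>b\<in>I. C a b k l * K (s' @ i # j # r') (s @ a # b # r))"
  shows "compatible (\<lambda>x' x. f (deg x') (deg x) * K x' x)"
  unfolding compatible_def kills_relators_def
proof (intro allI impI)
  fix s' s i j k l r' r assume idx: "relator_index s' s i j k l r' r"
  let ?w = "f (deg s' + \<eta> i + \<eta> j + deg r') (deg s + \<eta> k + \<eta> l + deg r)"
  have 1: "C i j a b * (f (deg (s' @ a # b # r')) (deg (s @ k # l # r)) * K (s' @ a # b # r') (s @ k # l # r))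
     = ?w * (C i j a b * K (s' @ a # b # r') (s @ k # l # r))" if "a \<in> I" "b \<in> I" for a b
  proof (cases "C i j a b = 0")
    case False
    then have "\<eta> i + \<eta> j = \<eta> a + \<eta> b"
      using C_zero[of i j a b] idx that by (auto simp: relator_index_def)
    then have "deg s' + \<eta> i + \<eta> j + deg r' = deg (s' @ a # b # r')"
      by (simp add: add.assoc) 
    then show ?thesis by (simp add: add.assoc)
  qed simp
  have 2: "C a b k l * (f (deg (s' @ i # j # r')) (deg (s @ a # b # r)) * K (s' @ i # j # r') (s @ a # b # r))
     = ?w * (C a b k l * K (s' @ i # j # r') (s @ a # b # r))" if "a \<in> I" "b \<in> I" for a b
  proof (cases "C a b k l = 0")
    case False
    then have "\<eta> a + \<eta> b = \<eta> k + \<eta> l"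
      using C_zero[of a b k l] idx that by (auto simp: relator_index_def)
    then have "deg s + \<eta> k + \<eta> l + deg r = deg (s @ a # b # r)"
      by (simp add: add.assoc) 
    then show ?thesis by (simp add: add.assoc)
  qed simp
  have "(\<Sum>a\<in>I. \<Sum>b\<in>I. C i j a b * (f (deg (s' @ a # b # r')) (deg (s @ k # l # r)) * K (s' @ a # b # r') (s @ k # l # r)))
    = ?w * (\<Sum>a\<in>I. \<Sum>b\<in>I. C i j a b * K (s' @ a # b # r') (s @ k # l # r))"
    unfolding sum_distrib_left by (intro sum.cong[OF refl] 1)
  moreover have "(\<Sum>a\<in>I. \<Sum>b\<in>I. C a b k l * (f (deg (s' @ i # j # r')) (deg (s @ a # b # r)) * K (s' @ i # j # r') (s @ a # b # r)))
    = ?w * (\<Sum>a\<in>I. \<Sum>b\<in>I. C a b k l * K (s' @ i # j # r') (s @ a # b # r))"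
    unfolding sum_distrib_left by (intro sum.cong[OF refl] 2)
  ultimately show "(\<Sum>a\<in>I. \<Sum>b\<in>I. C i j a b * (f (deg (s' @ a # b # r')) (deg (s @ k # l # r)) * K (s' @ a # b # r') (s @ k # l # r)))
    - (\<Sum>a\<in>I. \<Sum>b\<in>I. C a b k l * (f (deg (s' @ i # j # r')) (deg (s @ a # b # r)) * K (s' @ i # j # r') (s @ a # b # r))) \<in> {0}"
    using assms[OF idx] by simp
qed

text \<open>With this weight the two hexagons of \<open>cross\<close> become the two
  multiplicativity rules including their signs, given the rescaling in \<open>T\<close>, and a
  single crossing yields the prescribed values on generators.\<close>

definition K\<rho> :: "'i list \<Rightarrow> 'i list \<Rightarrow> 'i list \<Rightarrow> 'i list \<Rightarrow> 'k" where
  "K\<rho> x' x z' z = 1 / \<sigma> (deg x) (deg z') * cross I C z' x' x z"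

text \<open>The word \<open>z\<close> of the second argument moves back across \<open>x\<close> by
  the inverse operator. In a convolution with \<open>K\<rho>\<close>, this weight makes all signs
  that involve the intermediate words cancel.\<close>

definition K\<rho>_inv :: "'i list \<Rightarrow> 'i list \<Rightarrow> 'i list \<Rightarrow> 'i list \<Rightarrow> 'k" where
  "K\<rho>_inv x' x z' z = \<sigma> (deg x' - deg x) (deg z') * \<sigma> (deg x) (deg z) * cross I C_inv x' z' z x"

definition \<rho> where "\<rho> = bform K\<rho>"
definition \<rho>_inv where "\<rho>_inv = bform K\<rho>_inv"

text \<open>The moving word of \<open>cross\<close> belongs to the first argument in
  \<open>K\<rho>\<close> and to the second in \<open>K\<rho>_inv\<close>, so left and right sliding
  exchange their roles.\<close>

lemma compatible_K\<rho>:
  assumes "length z' = length z" "set z' \<subseteq> I" "set z \<subseteq> I"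
  shows "compatible (\<lambda>x' x. K\<rho> x' x z' z)" "compatible (\<lambda>x' x. K\<rho> z' z x' x)"
    "compatible (\<lambda>x' x. K\<rho>_inv x' x z' z)" "compatible (\<lambda>x' x. K\<rho>_inv z' z x' x)"
proof -
  have z': "z' \<in> tuples I (length z)" using assms by (auto simp: tuples_def)
  show "compatible (\<lambda>x' x. K\<rho> x' x z' z)"
    unfolding K\<rho>_def
  proof (rule compatible_weight)
    fix s' s i j k l r' r assume "relator_index s' s i j k l r' r"
    then show "(\<Sum>a\<in>I. \<Sum>b\<in>I. C i j a b * cross I C z' (s' @ a # b # r') (s @ k # l # r) z) =
      (\<Sum>a\<in>I. \<Sum>b\<in>I. C a b k l * cross I C z' (s' @ i # j # r') (s @ a # b # r) z)"
      using cross_slides_left[OF fin C_slides_over_C, of s' s r' r z' z i j k l] z'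
      by (simp add: relator_index_def mult.commute[of "cross _ _ _ _ _ _"])
  qed
  show "compatible (\<lambda>x' x. K\<rho> z' z x' x)"
    unfolding K\<rho>_def
  proof (rule compatible_weight)
    fix s' s i j k l r' r assume "relator_index s' s i j k l r' r"
    then show "(\<Sum>a\<in>I. \<Sum>b\<in>I. C i j a b * cross I C (s' @ a # b # r') z' z (s @ k # l # r)) =
      (\<Sum>a\<in>I. \<Sum>b\<in>I. C a b k l * cross I C (s' @ i # j # r') z' z (s @ a # b # r))"
      using cross_slides_right[OF fin C_slides_over_C, of s' s r' r z' z i j k l] assms
      by (simp add: relator_index_def mult.commute[of "cross _ _ _ _ _ _"])
  qed
  show "compatible (\<lambda>x' x. K\<rho>_inv x' x z' z)"
    unfolding K\<rho>_inv_def
  proof (rule compatible_weight)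
    fix s' s i j k l r' r assume "relator_index s' s i j k l r' r"
    then show "(\<Sum>a\<in>I. \<Sum>b\<in>I. C i j a b * cross I C_inv (s' @ a # b # r') z' z (s @ k # l # r)) =
      (\<Sum>a\<in>I. \<Sum>b\<in>I. C a b k l * cross I C_inv (s' @ i # j # r') z' z (s @ a # b # r))"
      using cross_slides_right[OF fin C_inv_slides_over_C, of s' s r' r z' z i j k l] assms
      by (simp add: relator_index_def mult.commute[of "cross _ _ _ _ _ _"])
  qed
  show "compatible (\<lambda>x' x. K\<rho>_inv z' z x' x)"
    unfolding K\<rho>_inv_def
  proof (rule compatible_weight)
    fix s' s i j k l r' r assume "relator_index s' s i j k l r' r"
    then show "(\<Sum>a\<in>I. \<Sum>b\<in>I. C i j a b * cross I C_inv z' (s' @ a # b # r') (s @ k # l # r) z) =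
      (\<Sum>a\<in>I. \<Sum>b\<in>I. C a b k l * cross I C_inv z' (s' @ i # j # r') (s @ a # b # r) z)"
      using cross_slides_left[OF fin C_inv_slides_over_C, of s' s r' r z' z i j k l] z'
      by (simp add: relator_index_def mult.commute[of "cross _ _ _ _ _ _"])
  qed
qed

lemma form_kernels: "form_kernel K\<rho>" "form_kernel K\<rho>_inv"
  unfolding form_kernel_def using compatible_K\<rho> by blast+

lemmas \<rho>_pr = bform_pr[OF form_kernels(1), folded \<rho>_def]
lemmas \<rho>_inv_pr = bform_pr[OF form_kernels(2), folded \<rho>_inv_def]

lemma \<rho>_bilinear: "bilinear_form A \<rho>" "bilinear_form A \<rho>_inv"
  unfolding \<rho>_def \<rho>_inv_def by (intro bform_bilinear form_kernels)+

lemma \<rho>_degree_zero: "form_degree_zero A \<rho>" "form_degree_zero A \<rho>_inv"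
proof -
  show "form_degree_zero A \<rho>"
    unfolding \<rho>_def
  proof (rule bform_degree_zero[OF form_kernels(1)])
    fix x' x z' z assume *: "length x' = length x" "set x' \<subseteq> I" "set x \<subseteq> I" "length z' = length z" "set z' \<subseteq> I" "set z \<subseteq> I"
      "K\<rho> x' x z' z \<noteq> 0"
    then have "deg z' + deg x' = deg x + deg z"
      using cross_deg[of x' x z' z] by (auto simp: K\<rho>_def tuples_def)
    then show "(deg x - deg x') + (deg z - deg z') = 0"
      by (simp add: algebra_simps)
  qed
  show "form_degree_zero A \<rho>_inv"
    unfolding \<rho>_inv_def
  proof (rule bform_degree_zero[OF form_kernels(2)])
    fix x' x z' z assume *: "length x' = length x" "set x' \<subseteq> I" "set x \<subseteq> I" "length z' = length z" "set z' \<subseteq> I" "set z \<subseteq> I"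
      "K\<rho>_inv x' x z' z \<noteq> 0"
    then have "deg x' + deg z' = deg z + deg x"
      using cross_inv_deg[of z' z x' x] by (auto simp: K\<rho>_inv_def tuples_def)
    then show "(deg x - deg x') + (deg z - deg z') = 0"
      by (simp add: algebra_simps)
  qed
qed

lemma \<rho>_T:
  assumes "length x' = length x" "set x' \<subseteq> I" "set x \<subseteq> I" "length z' = length z" "set z' \<subseteq> I" "set z \<subseteq> I"
  shows "\<rho> (pr (T x' x), pr (T z' z)) = K\<rho> x' x z' z" "\<rho>_inv (pr (T x' x), pr (T z' z)) = K\<rho>_inv x' x z' z"
  using assms by (simp_all add: \<rho>_pr \<rho>_inv_pr)

section \<open>Convolution inverse and multiplicativity\<close>

lemma bilinear_lin_mod:
  assumes "bilinear_on_A r" "X \<in> carrier A"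
  shows "lin_mod (*) {0} (\<lambda>Y. r (X, Y) * k)" "lin_mod (*) {0} (\<lambda>Y. k * r (X, Y))"
    "lin_mod (*) {0} (\<lambda>Y. r (Y, X) * k)" "lin_mod (*) {0} (\<lambda>Y. k * r (Y, X))"
  using assms by (simp_all add: bilinear_on_A_def lin_mod_def algebra_simps)

lemma bilinear_wlin:
  assumes "bilinear_on_A r" "X \<in> carrier A" "p \<in> carrier F"
  shows "r (X, pr p) = wlin (*) (\<lambda>x y. r (X, pr (T x y))) p" "r (pr p, X) = wlin (*) (\<lambda>x y. r (pr (T x y), X)) p"
  using scalar.lin_mod_wlin[OF bilinear_lin_mod(1)[OF assms(1,2), of 1] assms(3)]
    scalar.lin_mod_wlin[OF bilinear_lin_mod(3)[OF assms(1,2), of 1] assms(3)] by simp_all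

lemma bilinear_smult:
  assumes "bilinear_on_A r" "X \<in> carrier A" "Y \<in> carrier A"
  shows "r (X, c \<odot>\<^bsub>A\<^esub> Y) = c * r (X, Y)" "r (c \<odot>\<^bsub>A\<^esub> Y, X) = c * r (Y, X)"
  using scalar.lin_mod_smult[OF bilinear_lin_mod(1)[OF assms(1,2), of 1] assms(3)]
    scalar.lin_mod_smult[OF bilinear_lin_mod(3)[OF assms(1,2), of 1] assms(3)] by simp_all

lemma represents_component:
  assumes "represents A A us X" "(a, \<alpha>, b, \<beta>) \<in> set us"
  shows "a \<in> component A \<alpha>" "b \<in> component A \<beta>" "a \<in> carrier A" "b \<in> carrier A"
  using assms component_A_carrier by (auto simp: represents_def)

lemma convolution_eval:
  assumes r: "bilinear_on_A r" "bilinear_on_A r'"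
    and "represents A A us (tensor_class A A (comult p))" "p \<in> carrier F"
    and "represents A A vs (tensor_class A A (comult q))" "q \<in> carrier F"
  shows "(\<Sum>(a1, \<alpha>1, a2, \<alpha>2)\<leftarrow>us. \<Sum>(b1, \<beta>1, b2, \<beta>2)\<leftarrow>vs. \<sigma> \<alpha>2 \<beta>1 * r (a1, b1) * r' (a2, b2)) =
    wlin (*) (\<lambda>x y. wlin (*) (\<lambda>x' y'. \<Sum>z\<in>tuples I (length x). \<Sum>z'\<in>tuples I (length x').
      \<sigma> (deg y - deg z) (deg z' - deg x') * (r (pr (T x z), pr (T x' z')) * r' (pr (T z y), pr (T z' y')))) q) p"
proof -
  have "scalar.quadrilin (\<lambda>a1 a2 b1 b2. r (a1, b1) * r' (a2, b2))"
    unfolding scalar.quadrilin_def bilin_mod_def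
    by (intro ballI conjI bilinear_lin_mod r)
  from scalar.represents_double[OF this assms(3-6), of "\<lambda>_ _. 1" \<sigma>]
  show ?thesis by (simp add: mult.assoc)
qed

lemma single_eval:
  assumes r: "bilinear_on_A r" "X \<in> carrier A" "Y \<in> carrier A"
    and "represents A A us (tensor_class A A (comult p))" "p \<in> carrier F"
  shows "(\<Sum>(b1, \<beta>1, b2, \<beta>2)\<leftarrow>us. \<chi> \<beta>1 * r (X, b1) * r (Y, b2)) =
    wlin (*) (\<lambda>z' z. \<Sum>w\<in>tuples I (length z'). \<chi> (deg w - deg z') * (r (X, pr (T z' w)) * r (Y, pr (T w z)))) p"
    and "(\<Sum>(a1, \<alpha>1, a2, \<alpha>2)\<leftarrow>us. r (a1, X) * r (a2, Y)) =
    wlin (*) (\<lambda>x' x. \<Sum>w\<in>tuples I (length x'). r (pr (T x' w), X) * r (pr (T w x), Y)) p"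
proof -
  have "bilin_mod (*) {0} (\<lambda>b1 b2. r (X, b1) * r (Y, b2))"
    unfolding bilin_mod_def by (intro ballI conjI bilinear_lin_mod r)
  from scalar.represents_single[OF this assms(4,5), of \<chi> "\<lambda>_. 1"]
  show "(\<Sum>(b1, \<beta>1, b2, \<beta>2)\<leftarrow>us. \<chi> \<beta>1 * r (X, b1) * r (Y, b2)) =
    wlin (*) (\<lambda>z' z. \<Sum>w\<in>tuples I (length z'). \<chi> (deg w - deg z') * (r (X, pr (T z' w)) * r (Y, pr (T w z)))) p"
    by (simp add: mult.assoc)
  have "bilin_mod (*) {0} (\<lambda>a1 a2. r (a1, X) * r (a2, Y))"
    unfolding bilin_mod_def by (intro ballI conjI bilinear_lin_mod r)
  from scalar.represents_single[OF this assms(4,5), of "\<lambda>_. 1" "\<lambda>_. 1"]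
  show "(\<Sum>(a1, \<alpha>1, a2, \<alpha>2)\<leftarrow>us. r (a1, X) * r (a2, Y)) =
    wlin (*) (\<lambda>x' x. \<Sum>w\<in>tuples I (length x'). r (pr (T x' w), X) * r (pr (T w x), Y)) p"
    by simp
qed

lemma \<rho>_bilinear_on: "bilinear_on_A \<rho>" "bilinear_on_A \<rho>_inv"
  using \<rho>_bilinear by (simp_all add: bilinear_form_iff)

lemma \<epsilon>_product:
  assumes "p \<in> carrier F" "q \<in> carrier F"
  shows "\<epsilon> (pr p) * \<epsilon> (pr q) = wlin (*) (\<lambda>x y. wlin (*) (\<lambda>x' y'. of_bool (x = y \<and> x' = y')) q) p"
proof -
  have "counit_F p * counit_F q = wlin (*) (\<lambda>x y. wlin (*) (\<lambda>x' y'. counit_F (T x y) * counit_F (T x' y')) q) p"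
    by (rule scalar.bilinear_expand[OF _ _ assms, of "\<lambda>p q. counit_F p * counit_F q"])
      (simp_all add: counit_F_linear algebra_simps)
  also have "\<dots> = wlin (*) (\<lambda>x y. wlin (*) (\<lambda>x' y'. of_bool (x = y \<and> x' = y')) q) p"
    by (intro wlin_cong assms) (auto simp: counit_F_T)
  finally show ?thesis
    using assms by (simp add: \<epsilon>_pr)
qed

lemma convolution_inverse_\<rho>: "convolution_inverse \<sigma> AR0 \<rho> \<rho>_inv"
  unfolding convolution_inverse_def represents_AR AR_simps
proof (intro ballI allI impI)
  fix X Y us vs assume XY: "X \<in> carrier A" "Y \<in> carrier A" and "represents A A us (\<Delta> X)" "represents A A vs (\<Delta> Y)"
  moreover obtain p q where p: "p \<in> carrier F" "X = pr p" and q: "q \<in> carrier F" "Y = pr q"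
    using XY by (auto simp: carrier_A)
  ultimately have us: "represents A A us (tensor_class A A (comult p))" and vs: "represents A A vs (tensor_class A A (comult q))"
    by (simp_all add: \<Delta>_pr)
  have "(\<Sum>(a1, \<alpha>1, a2, \<alpha>2)\<leftarrow>us. \<Sum>(b1, \<beta>1, b2, \<beta>2)\<leftarrow>vs. \<sigma> \<alpha>2 \<beta>1 * \<rho> (a1, b1) * \<rho>_inv (a2, b2)) = \<epsilon> X * \<epsilon> Y"
    unfolding p q convolution_eval[OF \<rho>_bilinear_on us p(1) vs q(1)] \<epsilon>_product[OF p(1) q(1)]
  proof (intro wlin_cong p q)
    fix x y x' y' assume xy: "length x = length y" "set x \<subseteq> I" "set y \<subseteq> I" "length x' = length y'" "set x' \<subseteq> I" "set y' \<subseteq> I"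
    \<comment> \<open>All signs in the intermediate words \<open>z\<close> and \<open>z'\<close>
      cancel. The surviving prefactor is 1 for \<open>x' = y'\<close>, and the inverse crossings
      give 0 otherwise.\<close>
    have "(\<Sum>z\<in>tuples I (length x). \<Sum>z'\<in>tuples I (length x').
      \<sigma> (deg y - deg z) (deg z' - deg x') * (\<rho> (pr (T x z), pr (T x' z')) * \<rho>_inv (pr (T z y), pr (T z' y')))) =
      (\<Sum>z\<in>tuples I (length x). \<Sum>z'\<in>tuples I (length x'). \<sigma> (deg y) (deg y' - deg x') * (cross I C x' x z z' * cross I C_inv z z' y' y))"
    proof (intro sum.cong[OF refl])
      fix z z' assume "z \<in> tuples I (length x)" "z' \<in> tuples I (length x')"
      then have r: "\<rho> (pr (T x z), pr (T x' z')) = K\<rho> x z x' z'" "\<rho>_inv (pr (T z y), pr (T z' y')) = K\<rho>_inv z y z' y'"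
        using xy by (auto intro!: \<rho>_T simp: tuples_def)
      show "\<sigma> (deg y - deg z) (deg z' - deg x') * (\<rho> (pr (T x z), pr (T x' z')) * \<rho>_inv (pr (T z y), pr (T z' y')))
        = \<sigma> (deg y) (deg y' - deg x') * (cross I C x' x z z' * cross I C_inv z z' y' y)"
        unfolding r by (simp add: K\<rho>_def K\<rho>_inv_def \<sigma>_simps field_simps)
    qed
    also have "\<dots> = \<sigma> (deg y) (deg y' - deg x') * of_bool (x' = y' \<and> x = y)"
      unfolding sum_distrib_left[symmetric]
      using cross_inverse[OF fin C_C_inv, of x y x' y'] xy by (simp add: tuples_def)
    finally show "(\<Sum>z\<in>tuples I (length x). \<Sum>z'\<in>tuples I (length x').
      \<sigma> (deg y - deg z) (deg z' - deg x') * (\<rho> (pr (T x z), pr (T x' z')) * \<rho>_inv (pr (T z y), pr (T z' y')))) = of_bool (x = y \<and> x' = y')"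
      by auto
  qed
  moreover have "(\<Sum>(a1, \<alpha>1, a2, \<alpha>2)\<leftarrow>us. \<Sum>(b1, \<beta>1, b2, \<beta>2)\<leftarrow>vs. \<sigma> \<alpha>2 \<beta>1 * \<rho>_inv (a1, b1) * \<rho> (a2, b2)) = \<epsilon> X * \<epsilon> Y"
    unfolding p q convolution_eval[OF \<rho>_bilinear_on(2,1) us p(1) vs q(1)] \<epsilon>_product[OF p(1) q(1)]
  proof (intro wlin_cong p q)
    fix x y x' y' assume xy: "length x = length y" "set x \<subseteq> I" "set y \<subseteq> I" "length x' = length y'" "set x' \<subseteq> I" "set y' \<subseteq> I"
    \<comment> \<open>The same cancellation in the other order; here the surviving prefactor is 1
      for \<open>x = y\<close>.\<close>
    have "(\<Sum>z\<in>tuples I (length x). \<Sum>z'\<in>tuples I (length x').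
      \<sigma> (deg y - deg z) (deg z' - deg x') * (\<rho>_inv (pr (T x z), pr (T x' z')) * \<rho> (pr (T z y), pr (T z' y')))) =
      (\<Sum>z\<in>tuples I (length x). \<Sum>z'\<in>tuples I (length x'). \<sigma> (deg x - deg y) (deg x') * (cross I C_inv x x' z' z * cross I C z' z y y'))"
    proof (intro sum.cong[OF refl])
      fix z z' assume "z \<in> tuples I (length x)" "z' \<in> tuples I (length x')"
      then have r: "\<rho>_inv (pr (T x z), pr (T x' z')) = K\<rho>_inv x z x' z'" "\<rho> (pr (T z y), pr (T z' y')) = K\<rho> z y z' y'"
        using xy by (auto intro!: \<rho>_T simp: tuples_def)
      show "\<sigma> (deg y - deg z) (deg z' - deg x') * (\<rho>_inv (pr (T x z), pr (T x' z')) * \<rho> (pr (T z y), pr (T z' y')))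
        = \<sigma> (deg x - deg y) (deg x') * (cross I C_inv x x' z' z * cross I C z' z y y')"
        unfolding r by (simp add: K\<rho>_def K\<rho>_inv_def \<sigma>_simps field_simps)
    qed
    also have "\<dots> = \<sigma> (deg x - deg y) (deg x') * of_bool (x = y \<and> x' = y')"
      unfolding sum_distrib_left[symmetric] sum.swap[of _ "tuples I (length x')"]
      using cross_inverse[OF fin C_inv_C, of x' y' x y] xy by (simp add: tuples_def)
    finally show "(\<Sum>z\<in>tuples I (length x). \<Sum>z'\<in>tuples I (length x').
      \<sigma> (deg y - deg z) (deg z' - deg x') * (\<rho>_inv (pr (T x z), pr (T x' z')) * \<rho> (pr (T z y), pr (T z' y')))) = of_bool (x = y \<and> x' = y')"
      by auto
  qed
  ultimately show "(\<Sum>(a1, \<alpha>1, a2, \<alpha>2)\<leftarrow>us. \<Sum>(b1, \<beta>1, b2, \<beta>2)\<leftarrow>vs. \<sigma> \<alpha>2 \<beta>1 * \<rho> (a1, b1) * \<rho>_inv (a2, b2)) = \<epsilon> X * \<epsilon> Y \<and>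
    (\<Sum>(a1, \<alpha>1, a2, \<alpha>2)\<leftarrow>us. \<Sum>(b1, \<beta>1, b2, \<beta>2)\<leftarrow>vs. \<sigma> \<alpha>2 \<beta>1 * \<rho>_inv (a1, b1) * \<rho> (a2, b2)) = \<epsilon> X * \<epsilon> Y"
    by blast
qed

text \<open>On monomials this is \<open>cross_append_left\<close>, and the general case follows by
  linearity. The factor \<open>p'\<close> stays homogeneous throughout because its degree enters the
  sign.\<close>

lemma hexagon_left:
  assumes "p \<in> carrier F" "p' \<in> component F \<gamma>" "length z' = length z" "set z' \<subseteq> I" "set z \<subseteq> I"
  shows "\<rho> (pr (p * p'), pr (T z' z)) = (\<Sum>w\<in>tuples I (length z').
    \<sigma> \<gamma> (deg w - deg z') * (\<rho> (pr p, pr (T z' w)) * \<rho> (pr p', pr (T w z))))"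
proof -
  have Z: "pr (T z' z) \<in> carrier A" and W: "\<And>w. w \<in> tuples I (length z') \<Longrightarrow> pr (T z' w) \<in> carrier A \<and> pr (T w z) \<in> carrier A"
    using assms by (auto simp: tuples_def)
  have z0: "\<rho> (pr 0, X) = 0" if "X \<in> carrier A" for X
    using bilinear_smult(2)[OF \<rho>_bilinear_on(1) that, of "pr 0" 0] carrier_F_closed(1) by (simp add: A_smult)
  have lin: "\<rho> (pr (scale c p + q), X) = c * \<rho> (pr p, X) + \<rho> (pr q, X)" if "p \<in> carrier F" "q \<in> carrier F" "X \<in> carrier A" for c p q X
    using \<rho>_bilinear_on(1) that by (simp add: bilinear_on_A_def)
  have TT: "\<rho> (pr (T x' x * T u' u), pr (T z' z)) = (\<Sum>w\<in>tuples I (length z').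
     \<sigma> (deg u - deg u') (deg w - deg z') * (\<rho> (pr (T x' x), pr (T z' w)) * \<rho> (pr (T u' u), pr (T w z))))"
    if x: "length x' = length x" "set x' \<subseteq> I" "set x \<subseteq> I" "length u' = length u" "set u' \<subseteq> I" "set u \<subseteq> I" for x' x u' u
  proof -
    have "\<rho> (pr (T x' x * T u' u), pr (T z' z)) = 1 / \<sigma> (deg x - deg x') (deg u') * K\<rho> (x' @ u') (x @ u) z' z"
      using x assms by (simp add: T_mult bilinear_smult(2)[OF \<rho>_bilinear_on(1)] \<rho>_T flip: A_smult)
    also have "\<dots> = (\<Sum>w\<in>tuples I (length z). 1 / \<sigma> (deg x - deg x') (deg u') * (1 / \<sigma> (deg x + deg u) (deg z') * (cross I C z' x' x w * cross I C w u' u z)))"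
      unfolding K\<rho>_def using cross_append_left[OF fin x(1), of z' z C u' u] assms
      by (simp add: sum_distrib_left tuples_def)
    also have "\<dots> = (\<Sum>w\<in>tuples I (length z').
     \<sigma> (deg u - deg u') (deg w - deg z') * (\<rho> (pr (T x' x), pr (T z' w)) * \<rho> (pr (T u' u), pr (T w z))))"
      unfolding assms(3)
    proof (intro sum.cong[OF refl])
      fix w assume w: "w \<in> tuples I (length z)"
      have r: "\<rho> (pr (T x' x), pr (T z' w)) = K\<rho> x' x z' w" "\<rho> (pr (T u' u), pr (T w z)) = K\<rho> u' u w z"
        using x w assms by (auto intro!: \<rho>_T simp: tuples_def)
      show "1 / \<sigma> (deg x - deg x') (deg u') * (1 / \<sigma> (deg x + deg u) (deg z') * (cross I C z' x' x w * cross I C w u' u z))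
        = \<sigma> (deg u - deg u') (deg w - deg z') * (\<rho> (pr (T x' x), pr (T z' w)) * \<rho> (pr (T u' u), pr (T w z)))"
      \<comment> \<open>For a nonzero kernel, conservation of degree determines
        \<open>deg w\<close>, after which the signs match.\<close>
      proof (cases "cross I C z' x' x w = 0")
        case False
        then have "deg z' + deg x' = deg x + deg w"
          using x w assms by (intro cross_deg) (auto simp: tuples_def)
        then have e: "deg w = deg z' + deg x' - deg x"
          by (simp add: algebra_simps)
        show ?thesis
          unfolding r K\<rho>_def e by (simp add: \<sigma>_simps \<sigma>_sym \<sigma>_cancel field_simps)
      qed (simp add: r K\<rho>_def)
    qed
    finally show ?thesis .
  qed
  have Tp: "\<rho> (pr (T x' x * p'), pr (T z' z)) = (\<Sum>w\<in>tuples I (length z').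
    \<sigma> \<gamma> (deg w - deg z') * (\<rho> (pr (T x' x), pr (T z' w)) * \<rho> (pr p', pr (T w z))))"
    if x: "length x' = length x" "set x' \<subseteq> I" "set x \<subseteq> I" for x' x
    using assms(2)
  proof (induction p' rule: component_F_induct)
    case zero
    then show ?case using z0 Z W by simp
  next
    case (step c u' u q)
    have "\<rho> (pr (T x' x * (scale c (T u' u) + q)), pr (T z' z)) =
       c * \<rho> (pr (T x' x * T u' u), pr (T z' z)) + \<rho> (pr (T x' x * q), pr (T z' z))"
      using step x Z by (simp add: ring_distribs scale_mult_right lin carrier_F_closed)
    also have "\<dots> = (\<Sum>w\<in>tuples I (length z').
      \<sigma> \<gamma> (deg w - deg z') * (\<rho> (pr (T x' x), pr (T z' w)) * (c * \<rho> (pr (T u' u), pr (T w z)) + \<rho> (pr q, pr (T w z)))))"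
      unfolding TT[OF x step(1-3)] step(6) step(4)
      by (simp add: sum_distrib_left ring_distribs sum.distrib ac_simps)
    also have "\<dots> = (\<Sum>w\<in>tuples I (length z').
      \<sigma> \<gamma> (deg w - deg z') * (\<rho> (pr (T x' x), pr (T z' w)) * \<rho> (pr (scale c (T u' u) + q), pr (T w z))))"
      using step W by (intro sum.cong[OF refl]) (simp add: lin)
    finally show ?case .
  qed
  show ?thesis
    using assms(1)
  proof (induction p rule: carrier_F_induct)
    case zero
    then show ?case using z0 Z W by simp
  next
    case (step c u' u q)
    have "\<rho> (pr ((scale c (T u' u) + q) * p'), pr (T z' z)) =
       c * \<rho> (pr (T u' u * p'), pr (T z' z)) + \<rho> (pr (q * p'), pr (T z' z))"
      using step Z component_F_carrier[OF assms(2)] by (simp add: ring_distribs scale_mult_left lin carrier_F_closed)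
    also have "\<dots> = (\<Sum>w\<in>tuples I (length z').
      \<sigma> \<gamma> (deg w - deg z') * ((c * \<rho> (pr (T u' u), pr (T z' w)) + \<rho> (pr q, pr (T z' w))) * \<rho> (pr p', pr (T w z))))"
      unfolding Tp[OF step(1-3)] step(5)
      by (simp add: sum_distrib_left ring_distribs sum.distrib ac_simps)
    also have "\<dots> = (\<Sum>w\<in>tuples I (length z').
      \<sigma> \<gamma> (deg w - deg z') * (\<rho> (pr (scale c (T u' u) + q), pr (T z' w)) * \<rho> (pr p', pr (T w z))))"
      using step W by (intro sum.cong[OF refl]) (simp add: lin)
    finally show ?case .
  qed
qed

text \<open>The moving word meets \<open>z\<close> before \<open>w\<close>, and its incoming word is
  the column index. Hence the crossing with \<open>z\<close> pairs with the second tensor factor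
  \<open>T u x\<close>, which is the reversal of order in this multiplicativity rule.\<close>

lemma hexagon_right:
  assumes "q \<in> carrier F" "q' \<in> carrier F" "length x' = length x" "set x' \<subseteq> I" "set x \<subseteq> I"
  shows "\<rho> (pr (T x' x), pr (q * q')) = (\<Sum>u\<in>tuples I (length x'). \<rho> (pr (T x' u), pr q') * \<rho> (pr (T u x), pr q))"
proof -
  have X: "pr (T x' x) \<in> carrier A" and U: "\<And>u. u \<in> tuples I (length x') \<Longrightarrow> pr (T x' u) \<in> carrier A \<and> pr (T u x) \<in> carrier A"
    using assms by (auto simp: tuples_def)
  have z0: "\<rho> (X, pr 0) = 0" if "X \<in> carrier A" for X
    using bilinear_smult(1)[OF \<rho>_bilinear_on(1) that, of "pr 0" 0] carrier_F_closed(1) by (simp add: A_smult)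
  have lin: "\<rho> (X, pr (scale c p + q)) = c * \<rho> (X, pr p) + \<rho> (X, pr q)" if "p \<in> carrier F" "q \<in> carrier F" "X \<in> carrier A" for c p q X
    using \<rho>_bilinear_on(1) that by (simp add: bilinear_on_A_def)
  have TT: "\<rho> (pr (T x' x), pr (T z' z * T w' w)) = (\<Sum>u\<in>tuples I (length x'). \<rho> (pr (T x' u), pr (T w' w)) * \<rho> (pr (T u x), pr (T z' z)))"
    if z: "length z' = length z" "set z' \<subseteq> I" "set z \<subseteq> I" "length w' = length w" "set w' \<subseteq> I" "set w \<subseteq> I" for z' z w' w
  proof -
    have "\<rho> (pr (T x' x), pr (T z' z * T w' w)) = 1 / \<sigma> (deg z - deg z') (deg w') * K\<rho> x' x (z' @ w') (z @ w)"
      using z assms by (simp add: T_mult bilinear_smult(1)[OF \<rho>_bilinear_on(1)] \<rho>_T flip: A_smult)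
    also have "\<dots> = (\<Sum>u\<in>tuples I (length x). 1 / \<sigma> (deg z - deg z') (deg w') * (1 / \<sigma> (deg x) (deg z' + deg w') * (cross I C z' u x z * cross I C w' x' u w)))"
      unfolding K\<rho>_def using cross_append_right[OF fin assms(3), of z' z w' w C] z assms
      by (simp add: sum_distrib_left)
    also have "\<dots> = (\<Sum>u\<in>tuples I (length x'). \<rho> (pr (T x' u), pr (T w' w)) * \<rho> (pr (T u x), pr (T z' z)))"
      unfolding assms(3)
    proof (intro sum.cong[OF refl])
      fix u assume u: "u \<in> tuples I (length x)"
      have r: "\<rho> (pr (T x' u), pr (T w' w)) = K\<rho> x' u w' w" "\<rho> (pr (T u x), pr (T z' z)) = K\<rho> u x z' z"
        using z u assms by (auto intro!: \<rho>_T simp: tuples_def)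
      show "1 / \<sigma> (deg z - deg z') (deg w') * (1 / \<sigma> (deg x) (deg z' + deg w') * (cross I C z' u x z * cross I C w' x' u w))
        = \<rho> (pr (T x' u), pr (T w' w)) * \<rho> (pr (T u x), pr (T z' z))"
      proof (cases "cross I C z' u x z = 0")
        case False
        then have "deg z' + deg u = deg x + deg z"
          using z u assms by (intro cross_deg) (auto simp: tuples_def)
        then have e: "deg u = deg x + deg z - deg z'"
          by (simp add: algebra_simps)
        show ?thesis
          unfolding r K\<rho>_def e by (simp add: \<sigma>_simps \<sigma>_sym \<sigma>_cancel field_simps)
      qed (simp add: r K\<rho>_def)
    qed
    finally show ?thesis .
  qed
  have Tq: "\<rho> (pr (T x' x), pr (T z' z * q')) = (\<Sum>u\<in>tuples I (length x'). \<rho> (pr (T x' u), pr q') * \<rho> (pr (T u x), pr (T z' z)))"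
    if z: "length z' = length z" "set z' \<subseteq> I" "set z \<subseteq> I" for z' z
    using assms(2)
  proof (induction q' rule: carrier_F_induct)
    case zero
    then show ?case using z0 X U by simp
  next
    case (step c w' w q)
    have "\<rho> (pr (T x' x), pr (T z' z * (scale c (T w' w) + q))) =
       c * \<rho> (pr (T x' x), pr (T z' z * T w' w)) + \<rho> (pr (T x' x), pr (T z' z * q))"
      using step z X by (simp add: ring_distribs scale_mult_right lin carrier_F_closed)
    also have "\<dots> = (\<Sum>u\<in>tuples I (length x'). (c * \<rho> (pr (T x' u), pr (T w' w)) + \<rho> (pr (T x' u), pr q)) * \<rho> (pr (T u x), pr (T z' z)))"
      unfolding TT[OF z step(1-3)] step(5)
      by (simp add: sum_distrib_left ring_distribs sum.distrib ac_simps)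
    also have "\<dots> = (\<Sum>u\<in>tuples I (length x'). \<rho> (pr (T x' u), pr (scale c (T w' w) + q)) * \<rho> (pr (T u x), pr (T z' z)))"
      using step U by (intro sum.cong[OF refl]) (simp add: lin)
    finally show ?case .
  qed
  show ?thesis
    using assms(1)
  proof (induction q rule: carrier_F_induct)
    case zero
    then show ?case using z0 X U by simp
  next
    case (step c w' w q)
    have "\<rho> (pr (T x' x), pr ((scale c (T w' w) + q) * q')) =
       c * \<rho> (pr (T x' x), pr (T w' w * q')) + \<rho> (pr (T x' x), pr (q * q'))"
      using step X assms(2) by (simp add: ring_distribs scale_mult_left lin carrier_F_closed)
    also have "\<dots> = (\<Sum>u\<in>tuples I (length x'). \<rho> (pr (T x' u), pr q') * (c * \<rho> (pr (T u x), pr (T w' w)) + \<rho> (pr (T u x), pr q)))"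
      unfolding Tq[OF step(1-3)] step(5)
      by (simp add: sum_distrib_left ring_distribs sum.distrib ac_simps)
    also have "\<dots> = (\<Sum>u\<in>tuples I (length x'). \<rho> (pr (T x' u), pr q') * \<rho> (pr (T u x), pr (scale c (T w' w) + q)))"
      using step U by (intro sum.cong[OF refl]) (simp add: lin)
    finally show ?case .
  qed
qed

lemma form_multiplicative_\<rho>: "form_multiplicative \<sigma> AR0 \<rho>"
  unfolding form_multiplicative_def represents_AR AR_simps
proof (intro conjI ballI allI impI)
  fix X \<gamma> X' Y vs assume X: "X \<in> carrier A" "X' \<in> component A \<gamma>" "Y \<in> carrier A" and vs: "represents A A vs (\<Delta> Y)"
  obtain p p' q where p: "p \<in> carrier F" "X = pr p" "p' \<in> component F \<gamma>" "X' = pr p'" "q \<in> carrier F" "Y = pr q"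
    using X by (auto simp: carrier_A A_component)
  have p': "p' \<in> carrier F" using p component_F_carrier by blast
  have vs': "represents A A vs (tensor_class A A (comult q))"
    using vs p by (simp add: \<Delta>_pr)
  have "\<rho> (X \<otimes>\<^bsub>A\<^esub> X', Y) = wlin (*) (\<lambda>z' z. \<rho> (pr (p * p'), pr (T z' z))) q"
    using bilinear_wlin(1)[OF \<rho>_bilinear_on(1), of "pr (p * p')" q] p p' by (simp add: A_mult carrier_F_closed)
  also have "\<dots> = wlin (*) (\<lambda>z' z. \<Sum>w\<in>tuples I (length z'). \<sigma> \<gamma> (deg w - deg z') * (\<rho> (X, pr (T z' w)) * \<rho> (X', pr (T w z)))) q"
    using p by (intro wlin_cong) (simp_all add: hexagon_left)
  also have "\<dots> = (\<Sum>(b1, \<beta>1, b2, \<beta>2)\<leftarrow>vs. \<sigma> \<gamma> \<beta>1 * \<rho> (X, b1) * \<rho> (X', b2))"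
    using single_eval(1)[OF \<rho>_bilinear_on(1) X(1) _ vs' p(5)] component_A_carrier[OF X(2)] by simp
  finally show "\<rho> (X \<otimes>\<^bsub>A\<^esub> X', Y) = (\<Sum>(b1, \<beta>1, b2, \<beta>2)\<leftarrow>vs. \<sigma> \<gamma> \<beta>1 * \<rho> (X, b1) * \<rho> (X', b2))" .
next
  fix X Y Y' us assume X: "X \<in> carrier A" "Y \<in> carrier A" "Y' \<in> carrier A" and us: "represents A A us (\<Delta> X)"
  obtain p q q' where p: "p \<in> carrier F" "X = pr p" "q \<in> carrier F" "Y = pr q" "q' \<in> carrier F" "Y' = pr q'"
    using X by (auto simp: carrier_A)
  have us': "represents A A us (tensor_class A A (comult p))"
    using us p by (simp add: \<Delta>_pr)
  have "\<rho> (X, Y \<otimes>\<^bsub>A\<^esub> Y') = wlin (*) (\<lambda>x' x. \<rho> (pr (T x' x), pr (q * q'))) p"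
    using bilinear_wlin(2)[OF \<rho>_bilinear_on(1), of "pr (q * q')" p] p by (simp add: A_mult carrier_F_closed)
  also have "\<dots> = wlin (*) (\<lambda>x' x. \<Sum>u\<in>tuples I (length x'). \<rho> (pr (T x' u), Y') * \<rho> (pr (T u x), Y)) p"
    using p by (intro wlin_cong) (simp_all add: hexagon_right)
  also have "\<dots> = (\<Sum>(a1, \<alpha>1, a2, \<alpha>2)\<leftarrow>us. \<rho> (a1, Y') * \<rho> (a2, Y))"
    by (rule single_eval(2)[OF \<rho>_bilinear_on(1) X(3,2) us' p(1), symmetric])
  finally show "\<rho> (X, Y \<otimes>\<^bsub>A\<^esub> Y') = (\<Sum>(a1, \<alpha>1, a2, \<alpha>2)\<leftarrow>us. \<rho> (a1, Y') * \<rho> (a2, Y))" .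
qed

end

section \<open>Quasi-commutativity and uniqueness\<close>

lemma sum_list_map_concat: "(\<Sum>x\<leftarrow>concat xss. f x) = (\<Sum>xs\<leftarrow>xss. \<Sum>x\<leftarrow>xs. f x)"
  by (induction xss) simp_all

lemma (in yb_target) lin_mod_scale:
  assumes "lin_mod s N \<phi>"
  shows "lin_mod s N (\<lambda>X. s k (\<phi> X))"
  unfolding lin_mod_def
proof (intro allI ballI)
  fix c p q assume "p \<in> carrier F" "q \<in> carrier F"
  then have "s k (\<phi> (pr (scale c p + q)) - (s c (\<phi> (pr p)) + \<phi> (pr q))) \<in> N"
    using assms by (intro N_closed(3)) (simp add: lin_mod_def)
  then show "s k (\<phi> (pr (scale c p + q))) - (s c (s k (\<phi> (pr p))) + s k (\<phi> (pr q))) \<in> N"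
    by (simp add: V.scale_right_diff_distrib V.scale_right_distrib mult.commute)
qed

context graded_yb
begin

lemma forms_AR0: "bilinear_form AR0 r \<longleftrightarrow> bilinear_form A r" "form_degree_zero AR0 r \<longleftrightarrow> form_degree_zero A r"
  by (simp_all add: bilinear_form_def form_degree_zero_def)

lemma list_sum_pr:
  assumes "set Xs \<subseteq> carrier A"
  shows "list_sum_in AR0 Xs = pr (\<Sum>X\<leftarrow>Xs. rep X)"
proof -
  have "list_sum_in AR0 Xs = pr (\<Sum>X\<leftarrow>Xs. rep X) \<and> (\<Sum>X\<leftarrow>Xs. rep X) \<in> carrier F"
    using assms
  proof (induction Xs)
    case (Cons X Xs)
    then have "X = pr (rep X)" "rep X \<in> carrier F"
      using rep[of X] by auto
    then show ?case
      using Cons A_add[of "rep X" "\<Sum>X\<leftarrow>Xs. rep X"] by (simp add: list_sum_in_def carrier_F_closed)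
  qed (simp add: list_sum_in_def A_zero carrier_F_closed)
  then show ?thesis by simp
qed

text \<open>Turns an identity between elements of the quotient into a congruence modulo
  \<open>J\<close> in the free algebra, where \<open>represents_double\<close> can evaluate
  it.\<close>

lemma lin_mod_rep: "lin_mod scale J rep"
  unfolding lin_mod_def
proof (intro allI ballI)
  fix c p q assume pq: "p \<in> carrier F" "q \<in> carrier F"
  have "rep (pr (scale c p + q)) - (scale c p + q) \<in> J"
    using pq by (intro rep_pr carrier_F_closed)
  moreover have "scale c (rep (pr p) - p) + (rep (pr q) - q) \<in> J"
    using pq by (intro J_closed(2) J_closed(3) rep_pr)
  ultimately have "(rep (pr (scale c p + q)) - (scale c p + q)) - (scale c (rep (pr p) - p) + (rep (pr q) - q)) \<in> J"
    by (rule J_closed(4))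
  then show "rep (pr (scale c p + q)) - (scale c (rep (pr p)) + rep (pr q)) \<in> J"
    by (simp add: pm.scale_right_diff_distrib algebra_simps)
qed

lemma A_smult_carrier: "X \<in> carrier A \<Longrightarrow> c \<odot>\<^bsub>A\<^esub> X \<in> carrier A"
  by (auto simp: carrier_A A_smult carrier_F_closed)

lemma A_mult_carrier: "\<lbrakk>X \<in> carrier A; Y \<in> carrier A\<rbrakk> \<Longrightarrow> X \<otimes>\<^bsub>A\<^esub> Y \<in> carrier A"
  by (auto simp: carrier_A A_mult carrier_F_closed)

lemma form_times_element:
  assumes "bilinear_on_A r" "X \<in> carrier A" "A_linear f" "Y \<in> carrier A"
  shows "bilin_mod scale J (\<lambda>a b. scale (r (X, a)) (rep (f b)))" "bilin_mod scale J (\<lambda>b a. scale (r (X, a)) (rep (f b)))"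
    "bilin_mod scale J (\<lambda>a b. scale (r (a, X)) (rep (f b)))" "bilin_mod scale J (\<lambda>b a. scale (r (a, X)) (rep (f b)))"
proof -
  have f: "lin_mod scale J (\<lambda>b. scale k (rep (f b)))" for k
    by (rule modulo_J.lin_mod_scale[OF modulo_J.lin_mod_comp[OF lin_mod_rep assms(3)]])
  have g: "lin_mod scale J (\<lambda>a. scale (r (X, a)) v)" "lin_mod scale J (\<lambda>a. scale (r (a, X)) v)" for v
    using assms(1,2) J_closed(1) by (simp_all add: bilinear_on_A_def lin_mod_def pm.scale_left_distrib)
  show "bilin_mod scale J (\<lambda>a b. scale (r (X, a)) (rep (f b)))" "bilin_mod scale J (\<lambda>b a. scale (r (X, a)) (rep (f b)))"
    "bilin_mod scale J (\<lambda>a b. scale (r (a, X)) (rep (f b)))" "bilin_mod scale J (\<lambda>b a. scale (r (a, X)) (rep (f b)))"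
    unfolding bilin_mod_def by (intro ballI conjI f g)+
qed

text \<open>Once the signs are collected, both sides carry the same scalar \<open>?c\<close>, which
  is free of the summation words; their difference is then a multiple of
  \<open>cross_T\<close>.\<close>

lemma quasi_commutative_basis:
  assumes x: "length x = length y" "set x \<subseteq> I" "set y \<subseteq> I" "length x' = length y'" "set x' \<subseteq> I" "set y' \<subseteq> I"
  shows "(\<Sum>z\<in>tuples I (length x). \<Sum>z'\<in>tuples I (length x').
      scale (1 * \<sigma> (deg y - deg z) (deg z' - deg x'))
        (scale (\<rho> (pr (T x z), pr (T x' z'))) (rep (pr (T z y) \<otimes>\<^bsub>A\<^esub> pr (T z' y'))))) -
    (\<Sum>z\<in>tuples I (length x). \<Sum>z'\<in>tuples I (length x').
      scale (\<sigma> (deg z - deg x) (deg z' - deg x') * \<sigma> (deg y - deg z) (deg z' - deg x'))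
        (scale (\<rho> (pr (T z y), pr (T z' y'))) (rep (pr (T x' z') \<otimes>\<^bsub>A\<^esub> pr (T x z))))) \<in> J" (is "?L - ?R \<in> J")
proof -
  let ?Z = "tuples I (length x)" and ?Z' = "tuples I (length x')"
  let ?c = "1 / \<sigma> (deg y) (deg x')"
  have repm: "rep (pr p \<otimes>\<^bsub>A\<^esub> pr q) - p * q \<in> J" if "p \<in> carrier F" "q \<in> carrier F" for p q
    using that by (simp add: A_mult rep_pr carrier_F_closed)
  have L: "?L - scale ?c (\<Sum>z\<in>?Z. \<Sum>z'\<in>?Z'. scale (cross I C x' x z z') (T (z @ z') (y @ y'))) \<in> J"
    unfolding pm.scale_sum_right
  proof (rule modulo_J.N_sum_cong, rule modulo_J.N_sum_cong)
    fix z z' assume z: "z \<in> ?Z" "z' \<in> ?Z'"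
    let ?k = "\<sigma> (deg y - deg z) (deg z' - deg x') * \<rho> (pr (T x z), pr (T x' z'))"
    have r: "\<rho> (pr (T x z), pr (T x' z')) = K\<rho> x z x' z'"
      using x z by (intro \<rho>_T) (auto simp: tuples_def)
    have "scale ?k (rep (pr (T z y) \<otimes>\<^bsub>A\<^esub> pr (T z' y')) - T z y * T z' y') \<in> J"
      using x z by (intro J_closed(3) repm T_carrier) (auto simp: tuples_def)
    moreover have "scale ?k (T z y * T z' y') = scale ?c (scale (cross I C x' x z z') (T (z @ z') (y @ y')))"
      using x z unfolding r by (simp add: T_mult tuples_def K\<rho>_def \<sigma>_simps field_simps)
    ultimately show "scale (1 * \<sigma> (deg y - deg z) (deg z' - deg x'))
        (scale (\<rho> (pr (T x z), pr (T x' z'))) (rep (pr (T z y) \<otimes>\<^bsub>A\<^esub> pr (T z' y')))) -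
       scale ?c (scale (cross I C x' x z z') (T (z @ z') (y @ y'))) \<in> J"
      by (simp add: pm.scale_right_diff_distrib)
  qed
  have R: "?R - scale ?c (\<Sum>z\<in>?Z. \<Sum>z'\<in>?Z'. scale (cross I C z' z y y') (T (x' @ x) (z' @ z))) \<in> J"
    unfolding pm.scale_sum_right
  proof (rule modulo_J.N_sum_cong, rule modulo_J.N_sum_cong)
    fix z z' assume z: "z \<in> ?Z" "z' \<in> ?Z'"
    let ?k = "\<sigma> (deg z - deg x) (deg z' - deg x') * \<sigma> (deg y - deg z) (deg z' - deg x') * \<rho> (pr (T z y), pr (T z' y'))"
    have r: "\<rho> (pr (T z y), pr (T z' y')) = K\<rho> z y z' y'"
      using x z by (intro \<rho>_T) (auto simp: tuples_def)
    have "scale ?k (rep (pr (T x' z') \<otimes>\<^bsub>A\<^esub> pr (T x z)) - T x' z' * T x z) \<in> J"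
      using x z by (intro J_closed(3) repm T_carrier) (auto simp: tuples_def)
    moreover have "scale ?k (T x' z' * T x z) = scale ?c (scale (cross I C z' z y y') (T (x' @ x) (z' @ z)))"
    proof -
      let ?e = "\<sigma> (deg z - deg x) (deg z' - deg x') * \<sigma> (deg y - deg z) (deg z' - deg x') *
        (1 / \<sigma> (deg y) (deg z')) / \<sigma> (deg z' - deg x') (deg x)"
      \<comment> \<open>All occurrences of \<open>z\<close> and \<open>z'\<close> cancel by the
        symmetry of \<sigma>.\<close>
      have e: "?e = ?c"
        by (simp add: \<sigma>_simps \<sigma>_sym \<sigma>_cancel field_simps)
      have "scale ?k (T x' z' * T x z) = scale ?e (scale (cross I C z' z y y') (T (x' @ x) (z' @ z)))"
        using x z unfolding r by (simp add: T_mult tuples_def K\<rho>_def)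
      then show ?thesis by (simp only: e)
    qed
    ultimately show "scale (\<sigma> (deg z - deg x) (deg z' - deg x') * \<sigma> (deg y - deg z) (deg z' - deg x'))
        (scale (\<rho> (pr (T z y), pr (T z' y'))) (rep (pr (T x' z') \<otimes>\<^bsub>A\<^esub> pr (T x z)))) -
       scale ?c (scale (cross I C z' z y y') (T (x' @ x) (z' @ z))) \<in> J"
      by (simp add: pm.scale_right_diff_distrib)
  qed
  have "(\<Sum>z\<in>?Z. \<Sum>z'\<in>?Z'. scale (cross I C x' x z z') (T (z @ z') (y @ y'))) -
     (\<Sum>z\<in>?Z. \<Sum>z'\<in>?Z'. scale (cross I C z' z y y') (T (x' @ x) (z' @ z))) \<in> J"
    using cross_T[of x y x' y'] x by (simp add: tuples_def)
  then have M: "scale ?c (\<Sum>z\<in>?Z. \<Sum>z'\<in>?Z'. scale (cross I C x' x z z') (T (z @ z') (y @ y'))) -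
     scale ?c (\<Sum>z\<in>?Z. \<Sum>z'\<in>?Z'. scale (cross I C z' z y y') (T (x' @ x) (z' @ z))) \<in> J"
    unfolding pm.scale_right_diff_distrib[symmetric] by (rule J_closed(3))
  show ?thesis
    by (rule modulo_J.N_trans[OF modulo_J.N_trans[OF L M] modulo_J.N_sym[OF R]])
qed

lemma quasi_commutative_\<rho>: "quasi_commutative \<sigma> AR0 \<rho>"
  unfolding quasi_commutative_def represents_AR AR_simps
proof (intro ballI allI impI)
  fix X Y us vs assume XY: "X \<in> carrier A" "Y \<in> carrier A" and "represents A A us (\<Delta> X)" "represents A A vs (\<Delta> Y)"
  moreover obtain p q where p: "p \<in> carrier F" "X = pr p" and q: "q \<in> carrier F" "Y = pr q"
    using XY by (auto simp: carrier_A)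
  ultimately have us: "represents A A us (tensor_class A A (comult p))" and vs: "represents A A vs (tensor_class A A (comult q))"
    by (simp_all add: \<Delta>_pr)
  let ?L = "[(\<sigma> \<alpha>2 \<beta>1 * \<rho> (a1, b1)) \<odot>\<^bsub>A\<^esub> (a2 \<otimes>\<^bsub>A\<^esub> b2). (a1, \<alpha>1, a2, \<alpha>2) \<leftarrow> us, (b1, \<beta>1, b2, \<beta>2) \<leftarrow> vs]"
  let ?R = "[(\<sigma> (\<alpha>1 + \<alpha>2) \<beta>1 * \<rho> (a2, b2)) \<odot>\<^bsub>A\<^esub> (b1 \<otimes>\<^bsub>A\<^esub> a1). (a1, \<alpha>1, a2, \<alpha>2) \<leftarrow> us, (b1, \<beta>1, b2, \<beta>2) \<leftarrow> vs]"
  let ?\<Phi> = "\<lambda>a1 a2 b1 b2. scale (\<rho> (a1, b1)) (rep (a2 \<otimes>\<^bsub>A\<^esub> b2))"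
  let ?\<Psi> = "\<lambda>a1 a2 b1 b2. scale (\<rho> (a2, b2)) (rep (b1 \<otimes>\<^bsub>A\<^esub> a1))"
  note comp = represents_component[OF us] represents_component[OF vs]
  have car: "set ?L \<subseteq> carrier A" "set ?R \<subseteq> carrier A"
    using comp by (auto intro!: A_smult_carrier A_mult_carrier)
  have quad: "modulo_J.quadrilin ?\<Phi>" "modulo_J.quadrilin ?\<Psi>"
    unfolding modulo_J.quadrilin_def by (intro ballI conjI form_times_element \<rho>_bilinear_on A_linear_mult; assumption)+
  have smult: "rep ((k * r) \<odot>\<^bsub>A\<^esub> Z) - scale k (scale r (rep Z)) \<in> J" if "Z \<in> carrier A" for k r Z
    using modulo_J.lin_mod_smult[OF lin_mod_rep that, of "k * r"] by simp
  have "(\<Sum>X\<leftarrow>?L. rep X) = (\<Sum>(a1, \<alpha>1, a2, \<alpha>2)\<leftarrow>us. \<Sum>(b1, \<beta>1, b2, \<beta>2)\<leftarrow>vs.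
      rep ((\<sigma> \<alpha>2 \<beta>1 * \<rho> (a1, b1)) \<odot>\<^bsub>A\<^esub> (a2 \<otimes>\<^bsub>A\<^esub> b2)))"
    by (simp add: sum_list_map_concat comp_def split_def)
  moreover have "\<dots> - (\<Sum>(a1, \<alpha>1, a2, \<alpha>2)\<leftarrow>us. \<Sum>(b1, \<beta>1, b2, \<beta>2)\<leftarrow>vs. scale (1 * \<sigma> \<alpha>2 \<beta>1) (?\<Phi> a1 a2 b1 b2)) \<in> J"
    by (rule modulo_J.N_sum_list_cong, clarify, rule modulo_J.N_sum_list_cong, clarify, unfold mult_1_left)
      (intro smult A_mult_carrier comp(4) comp(8); assumption)
  ultimately have L: "(\<Sum>X\<leftarrow>?L. rep X) - (\<Sum>(a1, \<alpha>1, a2, \<alpha>2)\<leftarrow>us. \<Sum>(b1, \<beta>1, b2, \<beta>2)\<leftarrow>vs.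
      scale (1 * \<sigma> \<alpha>2 \<beta>1) (?\<Phi> a1 a2 b1 b2)) \<in> J"
    by (simp only:)
  have "(\<Sum>X\<leftarrow>?R. rep X) = (\<Sum>(a1, \<alpha>1, a2, \<alpha>2)\<leftarrow>us. \<Sum>(b1, \<beta>1, b2, \<beta>2)\<leftarrow>vs.
      rep ((\<sigma> \<alpha>1 \<beta>1 * \<sigma> \<alpha>2 \<beta>1 * \<rho> (a2, b2)) \<odot>\<^bsub>A\<^esub> (b1 \<otimes>\<^bsub>A\<^esub> a1)))"
    by (simp add: sum_list_map_concat comp_def split_def \<sigma>_add_left)
  moreover have "\<dots> - (\<Sum>(a1, \<alpha>1, a2, \<alpha>2)\<leftarrow>us. \<Sum>(b1, \<beta>1, b2, \<beta>2)\<leftarrow>vs.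
      scale (\<sigma> \<alpha>1 \<beta>1 * \<sigma> \<alpha>2 \<beta>1) (?\<Psi> a1 a2 b1 b2)) \<in> J"
    by (rule modulo_J.N_sum_list_cong, clarify, rule modulo_J.N_sum_list_cong, clarify)
      (intro smult A_mult_carrier comp(3) comp(7); assumption)
  ultimately have R: "(\<Sum>X\<leftarrow>?R. rep X) - (\<Sum>(a1, \<alpha>1, a2, \<alpha>2)\<leftarrow>us. \<Sum>(b1, \<beta>1, b2, \<beta>2)\<leftarrow>vs.
      scale (\<sigma> \<alpha>1 \<beta>1 * \<sigma> \<alpha>2 \<beta>1) (?\<Psi> a1 a2 b1 b2)) \<in> J"
    by (simp only:)
  have M: "wlin scale (\<lambda>x y. wlin scale (\<lambda>x' y'. \<Sum>z\<in>tuples I (length x). \<Sum>z'\<in>tuples I (length x').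
      scale (1 * \<sigma> (deg y - deg z) (deg z' - deg x')) (?\<Phi> (pr (T x z)) (pr (T z y)) (pr (T x' z')) (pr (T z' y')))) q) p -
    wlin scale (\<lambda>x y. wlin scale (\<lambda>x' y'. \<Sum>z\<in>tuples I (length x). \<Sum>z'\<in>tuples I (length x').
      scale (\<sigma> (deg z - deg x) (deg z' - deg x') * \<sigma> (deg y - deg z) (deg z' - deg x'))
        (?\<Psi> (pr (T x z)) (pr (T z y)) (pr (T x' z')) (pr (T z' y')))) q) p \<in> J"
    by (intro modulo_J.wlin_cong_mod p q quasi_commutative_basis)
  note L' = modulo_J.N_trans[OF L modulo_J.represents_double[OF quad(1) us p(1) vs q(1), of "\<lambda>_ _. 1" \<sigma>]]
  note R' = modulo_J.N_trans[OF R modulo_J.represents_double[OF quad(2) us p(1) vs q(1), of \<sigma> \<sigma>]]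
  show "list_sum_in AR0 ?L = list_sum_in AR0 ?R"
    unfolding list_sum_pr[OF car(1)] list_sum_pr[OF car(2)] pr_eq_iff
    by (rule modulo_J.N_trans[OF modulo_J.N_trans[OF L' M] modulo_J.N_sym[OF R']])
qed

text \<open>For single letters the kernel is one entry of \<open>C\<close>. The rescalings of the
  two generators, the weight in \<open>K\<rho>\<close> and the signs in \<open>C\<close> combine to
  the prescribed factor by homogeneity of \<open>R\<close>.\<close>

lemma \<rho>_gen:
  assumes I: "i \<in> I" "j \<in> I" "k \<in> I" "l \<in> I"
  shows "\<rho> (AR_gen \<sigma> I \<eta> R i k, AR_gen \<sigma> I \<eta> R j l) = \<sigma> (\<eta> i - \<eta> k) (\<eta> j - \<eta> l) * R i j k l"
proof -
  have t: "AR_gen \<sigma> I \<eta> R a b = (1 / \<sigma> (\<eta> b - \<eta> a) (\<eta> b)) \<odot>\<^bsub>A\<^esub> pr (T [a] [b])" for a b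
    by (simp add: AR_gen_pr A_smult free_gen_T)
  have c: "cross I C [j] [i] [k] [l] = C j i k l"
    using I by (simp add: sum_tuples_Suc sum_of_bool_left[OF fin] del: sum_of_bool_mult_eq sum_mult_of_bool_eq)
  have "\<rho> (AR_gen \<sigma> I \<eta> R i k, AR_gen \<sigma> I \<eta> R j l) =
      1 / \<sigma> (\<eta> k - \<eta> i) (\<eta> k) * (1 / \<sigma> (\<eta> l - \<eta> j) (\<eta> l)) * (1 / \<sigma> (\<eta> k) (\<eta> j) * C j i k l)"
    unfolding t using I
    by (simp add: bilinear_smult[OF \<rho>_bilinear_on(1)] A_smult_carrier \<rho>_T K\<rho>_def c del: cross.simps)
  also have "\<dots> = \<sigma> (\<eta> i - \<eta> k) (\<eta> j - \<eta> l) * R i j k l"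
  proof (cases "R i j k l = 0")
    case False
    then have "\<eta> i + \<eta> j = \<eta> k + \<eta> l"
      using R_zero I by blast
    then have e: "\<eta> j = \<eta> k + \<eta> l - \<eta> i"
      by (simp add: algebra_simps)
    show ?thesis
      by (simp add: C_def e \<sigma>_simps \<sigma>_sym \<sigma>_cancel field_simps)
  qed (simp add: C_def)
  finally show ?thesis .
qed

lemma universal_r_form_\<rho>: "universal_r_form \<sigma> AR0 \<rho>"
  unfolding universal_r_form_def forms_AR0 using convolution_inverse_\<rho>
  by (simp add: \<rho>_bilinear \<rho>_degree_zero quasi_commutative_\<rho> form_multiplicative_\<rho>)
    (use \<rho>_bilinear(2) \<rho>_degree_zero(2) in blast)

section \<open>Uniqueness of the form\<close>

lemma idempotent_invertible:
  assumes "finite S" "x \<in> S" "y \<in> S"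
    and idem: "\<And>a b. \<lbrakk>a \<in> S; b \<in> S\<rbrakk> \<Longrightarrow> f a b = (\<Sum>c\<in>S. f a c * f c b)"
    and inv: "\<And>a b. \<lbrakk>a \<in> S; b \<in> S\<rbrakk> \<Longrightarrow> (\<Sum>c\<in>S. f a c * g c b) = of_bool (a = b)"
  shows "f x y = (of_bool (x = y) :: 'k)"
proof -
  \<comment> \<open>In matrix notation: \<open>f = f 1 = f f g = f g = 1\<close>.\<close>
  have "f x y = (\<Sum>c\<in>S. f x c * of_bool (c = y))"
    using sum_of_bool_left(4)[OF assms(1,3), of "f x"] by simp
  also have "\<dots> = (\<Sum>c\<in>S. \<Sum>d\<in>S. f x c * f c d * g d y)"
  proof (intro sum.cong[OF refl])
    fix c assume "c \<in> S"
    then show "f x c * of_bool (c = y) = (\<Sum>d\<in>S. f x c * f c d * g d y)"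
      using inv[of c y] assms(3) by (simp flip: sum_distrib_left add: mult.assoc)
  qed
  also have "\<dots> = (\<Sum>d\<in>S. (\<Sum>c\<in>S. f x c * f c d) * g d y)"
    unfolding sum_distrib_right by (rule sum.swap)
  also have "\<dots> = (\<Sum>d\<in>S. f x d * g d y)"
    using idem[OF assms(2)] by (intro sum.cong[OF refl] arg_cong2[of _ _ _ _ "(*)"]) simp_all
  also have "\<dots> = of_bool (x = y)"
    by (rule inv[OF assms(2,3)])
  finally show ?thesis .
qed

context
  fixes r
  assumes r: "universal_r_form \<sigma> AR0 r"
begin

lemma r_bilinear: "bilinear_on_A r"
  using r by (simp add: universal_r_form_def forms_AR0 bilinear_form_iff)

lemma r_mult:
  assumes "X \<in> carrier A" "X' \<in> component A \<gamma>" "q \<in> carrier F" "represents A A vs (tensor_class A A (comult q))"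
  shows "r (X \<otimes>\<^bsub>A\<^esub> X', pr q) = (\<Sum>(b1, \<beta>1, b2, \<beta>2)\<leftarrow>vs. \<sigma> \<gamma> \<beta>1 * r (X, b1) * r (X', b2))"
proof -
  have "form_multiplicative \<sigma> AR0 r" using r by (simp add: universal_r_form_def)
  then show ?thesis
    unfolding form_multiplicative_def represents_AR AR_simps using assms by (auto simp: \<Delta>_pr)
qed

lemma r_mult':
  assumes "p \<in> carrier F" "Y \<in> carrier A" "Y' \<in> carrier A" "represents A A us (tensor_class A A (comult p))"
  shows "r (pr p, Y \<otimes>\<^bsub>A\<^esub> Y') = (\<Sum>(a1, \<alpha>1, a2, \<alpha>2)\<leftarrow>us. r (a1, Y') * r (a2, Y))"
proof -
  have "form_multiplicative \<sigma> AR0 r" using r by (simp add: universal_r_form_def)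
  then show ?thesis
    unfolding form_multiplicative_def represents_AR AR_simps using assms by (auto simp: \<Delta>_pr)
qed

lemma r_mult'_T:
  assumes "length x' = length x" "set x' \<subseteq> I" "set x \<subseteq> I" "Y \<in> carrier A" "Y' \<in> carrier A"
  shows "r (pr (T x' x), Y \<otimes>\<^bsub>A\<^esub> Y') = (\<Sum>w\<in>tuples I (length x'). r (pr (T x' w), Y') * r (pr (T w x), Y))"
proof -
  have t: "T x' x \<in> carrier F" using assms by simp
  obtain us where us: "represents A A us (tensor_class A A (comult (T x' x)))"
    using represents_comult_exists[OF t] .
  show ?thesis
    using r_mult'[OF t assms(4,5) us] single_eval(2)[OF r_bilinear assms(5,4) us t] assms(1) by simp
qed

text \<open>The unit is grouplike of degree 0. Multiplicativity with both factors equal to the unit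
  therefore makes \<open>r (pr 1, pr (T a b))\<close> an idempotent matrix in \<open>a\<close>,
  \<open>b\<close>, and the convolution inverse provides a right inverse of it. The other side is
  symmetric.\<close>

lemma r_one:
  assumes "length x = length y" "set x \<subseteq> I" "set y \<subseteq> I"
  shows "r (pr 1, pr (T x y)) = of_bool (x = y)" "r (pr (T x y), pr 1) = of_bool (x = y)"
proof -
  obtain r' where r': "bilinear_on_A r'" "convolution_inverse \<sigma> AR0 r r'"
    using r unfolding universal_r_form_def forms_AR0 bilinear_form_iff by blast
  let ?S = "tuples I (length x)"
  have one: "1 \<in> carrier F" "(1 :: ('i \<times> 'i) list \<Rightarrow>\<^sub>0 'k) = T [] []"
    by (simp_all add: T_Nil)
  obtain us1 where us1: "represents A A us1 (tensor_class A A (comult 1))"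
    using represents_comult_exists[OF one(1)] .
  have one0: "pr 1 \<in> component A 0"
    using pr_T_component[of "[]" "[]"] by (simp add: one(2))
  have one1: "pr 1 \<otimes>\<^bsub>A\<^esub> pr 1 = pr 1"
    by (simp add: A_mult)
  have S: "a \<in> ?S \<Longrightarrow> T a b \<in> carrier F" if "b \<in> ?S" for a b
    using that by (auto simp: tuples_def)
  have conv: "(\<Sum>(a1, \<alpha>1, a2, \<alpha>2)\<leftarrow>us. \<Sum>(b1, \<beta>1, b2, \<beta>2)\<leftarrow>vs. \<sigma> \<alpha>2 \<beta>1 * r (a1, b1) * r' (a2, b2)) = counit_F p * counit_F q"
    if "p \<in> carrier F" "q \<in> carrier F" "represents A A us (tensor_class A A (comult p))" "represents A A vs (tensor_class A A (comult q))" for p q us vs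
  proof -
    have "\<forall>X\<in>carrier A. \<forall>Y\<in>carrier A. \<forall>us vs. represents A A us (\<Delta> X) \<longrightarrow> represents A A vs (\<Delta> Y) \<longrightarrow>
      (\<Sum>(a1, \<alpha>1, a2, \<alpha>2)\<leftarrow>us. \<Sum>(b1, \<beta>1, b2, \<beta>2)\<leftarrow>vs. \<sigma> \<alpha>2 \<beta>1 * r (a1, b1) * r' (a2, b2)) = \<epsilon> X * \<epsilon> Y"
      using r'(2) unfolding convolution_inverse_def represents_AR AR_simps by blast
    from this[rule_format, of "pr p" "pr q" us vs] show ?thesis
      using that by (simp add: \<Delta>_pr \<epsilon>_pr)
  qed
  have xy: "x \<in> ?S" "y \<in> ?S" using assms by (auto simp: tuples_def)
  show "r (pr 1, pr (T x y)) = of_bool (x = y)"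
  proof (rule idempotent_invertible[OF finite_tuples[OF fin] xy, of "\<lambda>a b. r (pr 1, pr (T a b))" "\<lambda>a b. r' (pr 1, pr (T a b))"])
    fix a b assume ab: "a \<in> ?S" "b \<in> ?S"
    then have len: "length a = length b" "length a = length x" by (simp_all add: tuples_def)
    obtain vs where vs: "represents A A vs (tensor_class A A (comult (T a b)))"
      using represents_comult_exists[OF S[OF ab(2,1)]] .
    show "r (pr 1, pr (T a b)) = (\<Sum>c\<in>?S. r (pr 1, pr (T a c)) * r (pr 1, pr (T c b)))"
      using r_mult[OF pr_carrier[OF one(1)] one0 S[OF ab(2,1)] vs]
        single_eval(1)[OF r_bilinear pr_carrier[OF one(1)] pr_carrier[OF one(1)] vs S[OF ab(2,1)], of "\<lambda>_. 1"] len
      by (simp add: one1)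
    have "counit_F 1 * counit_F (T a b) = (\<Sum>c\<in>?S. r (pr 1, pr (T a c)) * r' (pr 1, pr (T c b)))"
      using conv[OF one(1) S[OF ab(2,1)] us1 vs] convolution_eval[OF r_bilinear r'(1) us1 one(1) vs S[OF ab(2,1)]] len
      unfolding one(2) by simp
    then show "(\<Sum>c\<in>?S. r (pr 1, pr (T a c)) * r' (pr 1, pr (T c b))) = of_bool (a = b)"
      using len by (simp add: one(2) counit_F_T)
  qed
  show "r (pr (T x y), pr 1) = of_bool (x = y)"
  proof (rule idempotent_invertible[OF finite_tuples[OF fin] xy, of "\<lambda>a b. r (pr (T a b), pr 1)" "\<lambda>a b. r' (pr (T a b), pr 1)"])
    fix a b assume ab: "a \<in> ?S" "b \<in> ?S"
    then have len: "length a = length b" "length a = length x" "set a \<subseteq> I" "set b \<subseteq> I" by (simp_all add: tuples_def)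
    obtain vs where vs: "represents A A vs (tensor_class A A (comult (T a b)))"
      using represents_comult_exists[OF S[OF ab(2,1)]] .
    show "r (pr (T a b), pr 1) = (\<Sum>c\<in>?S. r (pr (T a c), pr 1) * r (pr (T c b), pr 1))"
      using r_mult'_T[OF len(1,3,4) pr_carrier[OF one(1)] pr_carrier[OF one(1)]] len by (simp add: one1)
    have "counit_F (T a b) * counit_F 1 = (\<Sum>c\<in>?S. r (pr (T a c), pr 1) * r' (pr (T c b), pr 1))"
      using conv[OF S[OF ab(2,1)] one(1) vs us1] convolution_eval[OF r_bilinear r'(1) vs S[OF ab(2,1)] us1 one(1)] len
      unfolding one(2) by simp
    then show "(\<Sum>c\<in>?S. r (pr (T a c), pr 1) * r' (pr (T c b), pr 1)) = of_bool (a = b)"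
      using len by (simp add: one(2) counit_F_T)
  qed
qed

end

lemma universal_r_form_unique:
  assumes r: "universal_r_form \<sigma> AR0 r1" "universal_r_form \<sigma> AR0 r2"
    and gen: "\<And>i j k l. \<lbrakk>i \<in> I; j \<in> I; k \<in> I; l \<in> I\<rbrakk> \<Longrightarrow>
      r1 (AR_gen \<sigma> I \<eta> R i k, AR_gen \<sigma> I \<eta> R j l) = r2 (AR_gen \<sigma> I \<eta> R i k, AR_gen \<sigma> I \<eta> R j l)"
  shows "r1 = r2"
proof -
  note bl = r_bilinear[OF r(1)] r_bilinear[OF r(2)]
  have ext: "r1 (X, pr p) = r2 (X, pr p)"
    if "X \<in> carrier A" "p \<in> carrier F" "\<And>x y. \<lbrakk>length x = length y; set x \<subseteq> I; set y \<subseteq> I\<rbrakk> \<Longrightarrow> r1 (X, pr (T x y)) = r2 (X, pr (T x y))" for X p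
    unfolding bilinear_wlin(1)[OF bl(1) that(1,2)] bilinear_wlin(1)[OF bl(2) that(1,2)] by (rule wlin_cong[OF that(2,3)])
  have ext': "r1 (pr p, X) = r2 (pr p, X)"
    if "X \<in> carrier A" "p \<in> carrier F" "\<And>x y. \<lbrakk>length x = length y; set x \<subseteq> I; set y \<subseteq> I\<rbrakk> \<Longrightarrow> r1 (pr (T x y), X) = r2 (pr (T x y), X)" for X p
    unfolding bilinear_wlin(2)[OF bl(1) that(1,2)] bilinear_wlin(2)[OF bl(2) that(1,2)] by (rule wlin_cong[OF that(2,3)])
  have t: "pr (T [a] [b]) = \<sigma> (\<eta> b - \<eta> a) (\<eta> b) \<odot>\<^bsub>A\<^esub> AR_gen \<sigma> I \<eta> R a b" for a b
    by (simp add: AR_gen_pr A_smult free_gen_T)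
  have g: "AR_gen \<sigma> I \<eta> R a b \<in> carrier A" if "a \<in> I" "b \<in> I" for a b
    using that by (simp add: AR_gen_pr)
  \<comment> \<open>Induction on the second argument. Multiplicativity introduces an intermediate
    letter \<open>w\<close>, so the claim is carried for all letters \<open>i\<close>,
    \<open>k\<close> at once.\<close>
  have letter_word: "r1 (pr (T [i] [k]), pr (T x y)) = r2 (pr (T [i] [k]), pr (T x y))"
    if "length x = length y" "i \<in> I" "k \<in> I" "set x \<subseteq> I" "set y \<subseteq> I" for i k x y
    using that
  proof (induction x y arbitrary: i k rule: list_induct2)
    case Nil
    then show ?case
      using r_one(2)[OF r(1), of "[i]" "[k]"] r_one(2)[OF r(2), of "[i]" "[k]"] by (simp add: T_Nil)
  next
    case (Cons j x l y)
    let ?g = "AR_gen \<sigma> I \<eta> R j l"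
    have c: "?g \<in> carrier A" "pr (T x y) \<in> carrier A" "pr (T [i] [k]) \<in> carrier A"
      using Cons.prems g by auto
    have "r1 (pr (T [i] [k]), ?g \<otimes>\<^bsub>A\<^esub> pr (T x y)) = r2 (pr (T [i] [k]), ?g \<otimes>\<^bsub>A\<^esub> pr (T x y))"
    proof -
      have "r1 (pr (T [i] [w]), pr (T x y)) * r1 (pr (T [w] [k]), ?g) = r2 (pr (T [i] [w]), pr (T x y)) * r2 (pr (T [w] [k]), ?g)"
        if "w \<in> I" for w
      proof -
        have "r1 (pr (T [w] [k]), ?g) = r2 (pr (T [w] [k]), ?g)"
          using that Cons.prems unfolding t
          by (simp add: bilinear_smult(2)[OF bl(1)] bilinear_smult(2)[OF bl(2)] g gen)
        then show ?thesis
          using Cons.IH[of i w] Cons.prems that by simp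
      qed
      then show ?thesis
        using Cons.prems c r_mult'_T[OF r(1), of "[i]" "[k]"] r_mult'_T[OF r(2), of "[i]" "[k]"]
        by (simp add: sum_tuples_Suc)
    qed
    then show ?case
      using Cons.prems c A_mult_carrier[OF c(1,2)]
      by (simp add: T_Cons bilinear_smult(1)[OF bl(1)] bilinear_smult(1)[OF bl(2)])
  qed
  have letter: "r1 (pr (T [i] [k]), Y) = r2 (pr (T [i] [k]), Y)" if ik: "i \<in> I" "k \<in> I" "Y \<in> carrier A" for i k Y
  proof -
    obtain q where q: "q \<in> carrier F" "Y = pr q" using ik by (auto simp: carrier_A)
    show ?thesis
      unfolding q(2) by (rule ext[OF _ q(1)]) (use ik letter_word in auto)
  qed
  \<comment> \<open>Induction on the first argument, now against an arbitrary second one: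
    \<open>letter\<close> treats the leading letter, and \<open>r_one\<close> the empty
    word.\<close>
  have word: "r1 (pr (T x y), Y) = r2 (pr (T x y), Y)" if "length x = length y" "set x \<subseteq> I" "set y \<subseteq> I" "Y \<in> carrier A" for x y Y
    using that
  proof (induction x y arbitrary: Y rule: list_induct2)
    case Nil
    obtain q where q: "q \<in> carrier F" "Y = pr q" using Nil by (auto simp: carrier_A)
    show ?case
      unfolding q(2) T_Nil
      by (rule ext[OF _ q(1)]) (simp_all add: r_one[OF r(1)] r_one[OF r(2)])
  next
    case (Cons i x k y)
    obtain q where q: "q \<in> carrier F" "Y = pr q" using Cons.prems by (auto simp: carrier_A)
    obtain vs where vs: "represents A A vs (tensor_class A A (comult q))"
      using represents_comult_exists[OF q(1)] .
    have I: "i \<in> I" "k \<in> I" "set x \<subseteq> I" "set y \<subseteq> I" using Cons.prems by auto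
    have c: "pr (T [i] [k]) \<in> carrier A" "pr (T x y) \<in> component A (deg y - deg x)" "pr (T x y) \<in> carrier A"
      using I Cons.hyps pr_T_component by auto
    have e: "pr (T (i # x) (k # y)) = \<sigma> (\<eta> k - \<eta> i) (deg x) \<odot>\<^bsub>A\<^esub> (pr (T [i] [k]) \<otimes>\<^bsub>A\<^esub> pr (T x y))"
      using T_append[of "[i]" "[k]" x y] I by (simp add: A_mult A_smult carrier_F_closed)
    have "(\<Sum>(b1, \<beta>1, b2, \<beta>2)\<leftarrow>vs. \<sigma> (deg y - deg x) \<beta>1 * r1 (pr (T [i] [k]), b1) * r1 (pr (T x y), b2)) =
      (\<Sum>(b1, \<beta>1, b2, \<beta>2)\<leftarrow>vs. \<sigma> (deg y - deg x) \<beta>1 * r2 (pr (T [i] [k]), b1) * r2 (pr (T x y), b2))"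
      using represents_component(3,4)[OF vs] I Cons.IH letter
      by (intro arg_cong[of _ _ sum_list] map_cong[OF refl]) auto
    then have "r1 (pr (T [i] [k]) \<otimes>\<^bsub>A\<^esub> pr (T x y), pr q) = r2 (pr (T [i] [k]) \<otimes>\<^bsub>A\<^esub> pr (T x y), pr q)"
      unfolding r_mult[OF r(1) c(1,2) q(1) vs] r_mult[OF r(2) c(1,2) q(1) vs] .
    then show ?case
      using A_mult_carrier[OF c(1,3)] q unfolding e
      by (simp add: bilinear_smult(2)[OF bl(1)] bilinear_smult(2)[OF bl(2)])
  qed
  have "r1 \<in> extensional (carrier A \<times> carrier A)" "r2 \<in> extensional (carrier A \<times> carrier A)"
    using r by (simp_all add: universal_r_form_def forms_AR0 bilinear_form_iff)
  then show ?thesis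
  proof (rule extensionalityI)
    fix XY assume "XY \<in> carrier A \<times> carrier A"
    then obtain p Y where "XY = (pr p, Y)" "p \<in> carrier F" "Y \<in> carrier A"
      by (auto simp: carrier_A)
    then show "r1 XY = r2 XY"
      using ext'[of Y p] word by auto
  qed
qed

end

theorem theorem1:
  fixes \<sigma> :: "'g::ab_group_add \<Rightarrow> 'g \<Rightarrow> 'k::field_char_0"
    and I :: "'i set" and \<eta> :: "'i \<Rightarrow> 'g"
    and R :: "'i \<Rightarrow> 'i \<Rightarrow> 'i \<Rightarrow> 'i \<Rightarrow> 'k"
  assumes "commutation_factor \<sigma>"
    and "finite I"
    and "R_homogeneous I \<eta> R"
    and "mat_invertible (I \<times> I) (R_map \<sigma> I \<eta> R)"
    and "graded_yang_baxter \<sigma> I \<eta> R"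
  shows "\<exists>!\<rho>. universal_r_form \<sigma> (AR \<sigma> I \<eta> R) \<rho> \<and>
    (\<forall>i\<in>I. \<forall>j\<in>I. \<forall>k\<in>I. \<forall>l\<in>I.
      \<rho> (AR_gen \<sigma> I \<eta> R i k, AR_gen \<sigma> I \<eta> R j l) = \<sigma> (\<eta> i - \<eta> k) (\<eta> j - \<eta> l) * R i j k l)"
proof -
  interpret graded_yb \<sigma> I \<eta> R
    using assms by unfold_locales
  show ?thesis
  proof (rule ex1I[of _ \<rho>])
    show "universal_r_form \<sigma> (AR \<sigma> I \<eta> R) \<rho> \<and> (\<forall>i\<in>I. \<forall>j\<in>I. \<forall>k\<in>I. \<forall>l\<in>I.
      \<rho> (AR_gen \<sigma> I \<eta> R i k, AR_gen \<sigma> I \<eta> R j l) = \<sigma> (\<eta> i - \<eta> k) (\<eta> j - \<eta> l) * R i j k l)"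
      using universal_r_form_\<rho> \<rho>_gen by blast
    fix r assume r: "universal_r_form \<sigma> (AR \<sigma> I \<eta> R) r \<and> (\<forall>i\<in>I. \<forall>j\<in>I. \<forall>k\<in>I. \<forall>l\<in>I.
      r (AR_gen \<sigma> I \<eta> R i k, AR_gen \<sigma> I \<eta> R j l) = \<sigma> (\<eta> i - \<eta> k) (\<eta> j - \<eta> l) * R i j k l)"
    show "r = \<rho>"
      by (rule universal_r_form_unique[OF conjunct1[OF r] universal_r_form_\<rho>])
        (use r \<rho>_gen in simp)
  qed
qed

end
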